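(* Assume ZFC together with the continuum hypothesis. Let $(\Omega,\mathcal F)$ be a measurable space and let $\mathfrak P\subset\Delta(\mathcal F)$ be nonempty and of class (S). (1) If there is a disjoint supported alternative to $\mathfrak P$ of cardinality $\kappa$ with $0<\kappa\le2^{\aleph_0}$ and if $ca_{\mathbf c}\setminus sca_{\mathbf c}$ is nonempty, then $L^\infty_{\mathbf c^{\mathcal H}}$ is not Dedekind complete. (2) If $\Omega$ is Polish, $\mathcal F$ is the Borel $\sigma$-algebra on $\Omega$ (so $\mathfrak P$ is a set of Borel probability measures), and a disjoint supported alternative $\mathfrak Q$ to $\mathfrak P$ contains a nonempty perfect, or an uncountable analytic, or an uncountable Borel subset $\mathfrak R$ of $\Delta(\mathcal F)$, then $L^\infty_{\mathbf c^{\mathcal H}}$ is not Dedekind complete.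
   Context: $\Delta(\mathcal F)$ is the set of probability measures on $(\Omega,\mathcal F)$ (with the topology of weak convergence in the Polish case); $ca$ is the space of finite countably additive signed measures on $\mathcal F$, with total variation $|\mu|$. Put $\mathbf c(A)=\sup_{\mathbb P\in\mathfrak P}\mathbb P(A)$. A property holds $\mathfrak P$-quasi surely (q.s.) if it holds outside an event $A$ with $\mathbf c(A)=0$. $L^\infty_{\mathbf c}$ is the vector lattice of classes, up to $\mathfrak P$-q.s. equality, of $\mathfrak P$-q.s. bounded real-valued $\mathcal F$-measurable functions, with the $\mathfrak P$-q.s. order. For sets of (signed) measures, $\mathfrak S\ll\mathfrak T$ means that $\sup_{\nu\in\mathfrak T}|\nu|(N)=0$ implies $\sup_{\mu\in\mathfrak S}|\mu|(N)=0$ for all $N\in\mathcal F$; $\mathfrak S\approx\mathfrak T$ means both $\ll$ relations. $ca_{\mathbf c}=\{\mu\in ca\mid\{\mu\}\ll\mathfrak P\}$. A measure $\mu$ is supported if there is $S(\mu)\in\mathcal F$ with $\mu(S(\mu)^c)=0$ such that every $N\in\mathcal F$ with $\mu(N\cap S(\mu))=0$ satisfies $\mathbf c(N\cap S(\mu))=0$; a signed $\mu\in ca_{\mathbf c}$ is supported if $|\mu|$ is; $sca_{\mathbf c}$ is the set of supported $\mu\in ca_{\mathbf c}$. $\mathfrak P$ is of class (S) if there is a supported alternative to $\mathfrak P$, i.e. $\mathfrak Q\subset\Delta(\mathcal F)$ with $\mathfrak Q\approx\mathfrak P$ and $\mathfrak Q\subset sca_{\mathbf c}$. A supported alternative $\mathfrak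 Q$ is disjoint if $\mathbf 1_{S(\mathbb Q)}\wedge\mathbf 1_{S(\mathbb Q')}=0$ in $L^\infty_{\mathbf c}$ for all $\mathbb Q\ne\mathbb Q'$ in $\mathfrak Q$. $\mathcal H$ is the universal completion of $\mathcal F$, i.e. $\mathcal H=\bigcap_{\mu\in\Delta(\mathcal F)}\sigma(\mathcal F\cup\mathfrak n(\mu))$ with $\mathfrak n(\mu)=\{A\subset\Omega\mid\exists N\in\mathcal F:\ \mu(N)=0,\ A\subset N\}$; $\mathfrak P^{\mathcal H}=\{\mathbb P^{\mathcal H}\mid\mathbb P\in\mathfrak P\}$ is the set of unique extensions $\mathbb P^{\mathcal H}$ of the members $\mathbb P$ of $\mathfrak P$ to probability measures on $\mathcal H$, and $\mathbf c^{\mathcal H}(A)=\sup_{\mathbb P\in\mathfrak P}\mathbb P^{\mathcal H}(A)$, $A\in\mathcal H$, is its upper probability on $\mathcal H$. A property holds $\mathfrak P^{\mathcal H}$-q.s. if it holds outside an event $A\in\mathcal H$ with $\mathbf c^{\mathcal H}(A)=0$. $L^\infty_{\mathbf c^{\mathcal H}}$ is the vector lattice of classes, up to $\mathfrak P^{\mathcal H}$-q.s. equality, of $\mathfrak P^{\mathcal H}$-q.s. bounded real-valued $\mathcal H$-measurable functions, with the $\mathfrak P^{\mathcal H}$-q.s. order. A vector lattice is Dedekind complete if every nonempty subset with an upper bound has a supremum. A subset $P$ of a Polish space is perfect if it is closed and, for every $\sigma\in P$, the closure of $P\setminus\{\sigma\}$ is $P$. *)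

theory Defs
  imports "HOL-Probability.Probability" "HOL-Algebra.Order" "HOL-Library.Equipollence"
begin

text \<open>
  A measurable space \<open>(\<Omega>, \<F>)\<close> is represented by \<open>M :: 'a measure\<close> with \<open>\<Omega> = space M\<close> and
  \<open>\<F> = sets M\<close>; the measure carried by \<open>M\<close> itself plays no role. The set \<open>\<Delta>(\<F>)\<close> of probability
  measures on \<open>\<F>\<close> is \<open>space (prob_algebra M)\<close>.
\<close>

definition continuum_hypothesis :: bool where
  "continuum_hypothesis \<longleftrightarrow>
     (\<forall>S :: nat set set. countable S \<or> S \<approx> (UNIV :: nat set set))"

subsection \<open>Upper probability and the lattice of quasi surely bounded functions\<close>

definition upper_prob :: "'a measure set \<Rightarrow> 'a set \<Rightarrow> ennreal" where
  "upper_prob P A = (SUP p\<in>P. emeasure p A)"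

definition qs :: "'a measure \<Rightarrow> 'a measure set \<Rightarrow> ('a \<Rightarrow> bool) \<Rightarrow> bool" where
  "qs M P \<phi> \<longleftrightarrow> (\<exists>A\<in>sets M. upper_prob P A = 0 \<and> (\<forall>\<omega>\<in>space M - A. \<phi> \<omega>))"

definition qs_bounded_funs :: "'a measure \<Rightarrow> 'a measure set \<Rightarrow> ('a \<Rightarrow> real) set" where
  "qs_bounded_funs M P = {f \<in> borel_measurable M. \<exists>B. qs M P (\<lambda>\<omega>. \<bar>f \<omega>\<bar> \<le> B)}"

definition qs_eq_rel :: "'a measure \<Rightarrow> 'a measure set \<Rightarrow> (('a \<Rightarrow> real) \<times> ('a \<Rightarrow> real)) set" where
  "qs_eq_rel M P = {(f, g). f \<in> qs_bounded_funs M P \<and> g \<in> qs_bounded_funs M P \<and>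
                            qs M P (\<lambda>\<omega>. f \<omega> = g \<omega>)}"

definition qs_class :: "'a measure \<Rightarrow> 'a measure set \<Rightarrow> ('a \<Rightarrow> real) \<Rightarrow> ('a \<Rightarrow> real) set" where
  "qs_class M P f = qs_eq_rel M P `` {f}"

text \<open>The vector lattice \<open>L\<^sup>\<infinity>\<^sub>c\<close> with its order; Dedekind completeness and infima do not involve
  the linear structure, which is therefore not recorded.\<close>

definition Linf :: "'a measure \<Rightarrow> 'a measure set \<Rightarrow> ('a \<Rightarrow> real) set gorder" where
  "Linf M P = \<lparr> carrier = qs_bounded_funs M P // qs_eq_rel M P,
                eq = (=),
                le = (\<lambda>X Y. \<exists>f\<in>X. \<exists>g\<in>Y. qs M P (\<lambda>\<omega>. f \<omega> \<le> g \<omega>)) \<rparr>"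

definition dedekind_complete :: "('b, 'c) gorder_scheme \<Rightarrow> bool" where
  "dedekind_complete L \<longleftrightarrow>
     (\<forall>A \<subseteq> carrier L. A \<noteq> {} \<and> Upper L A \<noteq> {} \<longrightarrow> (\<exists>s. least L s (Upper L A)))"

subsection \<open>Signed measures, supports and class (S)\<close>

text \<open>Finite signed measures are real-valued set functions, normalised to vanish outside \<open>sets M\<close>
  (as \<^const>\<open>measure\<close> does); a finite measure \<open>\<mu>\<close> on \<open>sets M\<close> is the element \<open>measure \<mu>\<close>.\<close>

definition ca :: "'a measure \<Rightarrow> ('a set \<Rightarrow> real) set" where
  "ca M = {\<mu>. \<mu> {} = 0 \<and> (\<forall>A. A \<notin> sets M \<longrightarrow> \<mu> A = 0) \<and>
              (\<forall>A :: nat \<Rightarrow> 'a set. range A \<subseteq> sets M \<longrightarrow> disjoint_family A \<longrightarrow>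
                 (\<lambda>i. \<mu> (A i)) sums \<mu> (\<Union>i. A i))}"

definition total_variation :: "'a measure \<Rightarrow> ('a set \<Rightarrow> real) \<Rightarrow> 'a set \<Rightarrow> ennreal" where
  "total_variation M \<mu> A =
     (SUP D \<in> {D. finite D \<and> D \<subseteq> sets M \<and> partition_on A D}. \<Sum>B\<in>D. ennreal \<bar>\<mu> B\<bar>)"

definition dominated :: "'a measure \<Rightarrow> ('a set \<Rightarrow> real) set \<Rightarrow> ('a set \<Rightarrow> real) set \<Rightarrow> bool" where
  "dominated M S T \<longleftrightarrow>
     (\<forall>N\<in>sets M. (SUP \<nu>\<in>T. total_variation M \<nu> N) = 0 \<longrightarrow> (SUP \<mu>\<in>S. total_variation M \<mu> N) = 0)"

definition equiv_measures :: "'a measure \<Rightarrow> ('a set \<Rightarrow> real) set \<Rightarrow> ('a set \<Rightarrow> real) set \<Rightarrow> bool" where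
  "equiv_measures M S T \<longleftrightarrow> dominated M S T \<and> dominated M T S"

definition ca_c :: "'a measure \<Rightarrow> 'a measure set \<Rightarrow> ('a set \<Rightarrow> real) set" where
  "ca_c M P = {\<mu> \<in> ca M. dominated M {\<mu>} (measure ` P)}"

definition is_support :: "'a measure \<Rightarrow> 'a measure set \<Rightarrow> ('a set \<Rightarrow> ennreal) \<Rightarrow> 'a set \<Rightarrow> bool" where
  "is_support M P m S \<longleftrightarrow> S \<in> sets M \<and> m (space M - S) = 0 \<and>
     (\<forall>N\<in>sets M. m (N \<inter> S) = 0 \<longrightarrow> upper_prob P (N \<inter> S) = 0)"

definition sca_c :: "'a measure \<Rightarrow> 'a measure set \<Rightarrow> ('a set \<Rightarrow> real) set" where
  "sca_c M P = {\<mu> \<in> ca_c M P. \<exists>S. is_support M P (total_variation M \<mu>) S}"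

definition supported_alternative :: "'a measure \<Rightarrow> 'a measure set \<Rightarrow> 'a measure set \<Rightarrow> bool" where
  "supported_alternative M P Q \<longleftrightarrow> Q \<subseteq> space (prob_algebra M) \<and>
     equiv_measures M (measure ` Q) (measure ` P) \<and> measure ` Q \<subseteq> sca_c M P"

definition class_S :: "'a measure \<Rightarrow> 'a measure set \<Rightarrow> bool" where
  "class_S M P \<longleftrightarrow> (\<exists>Q. supported_alternative M P Q)"

text \<open>Supports are unique up to quasi sure equality, so quantifying over all of them is the same as
  choosing one for each measure.\<close>

definition disjoint_supported_alternative ::
    "'a measure \<Rightarrow> 'a measure set \<Rightarrow> 'a measure set \<Rightarrow> bool" where
  "disjoint_supported_alternative M P Q \<longleftrightarrow> supported_alternative M P Q \<and>
     (\<forall>q\<in>Q. \<forall>q'\<in>Q. q \<noteq> q' \<longrightarrow>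
        (\<forall>S S'. is_support M P (emeasure q) S \<longrightarrow> is_support M P (emeasure q') S' \<longrightarrow>
           greatest (Linf M P) (qs_class M P (\<lambda>_. 0))
             (Lower (Linf M P) {qs_class M P (indicator S), qs_class M P (indicator S')})))"

subsection \<open>Universal completion\<close>

definition neglig :: "'a measure \<Rightarrow> 'a measure \<Rightarrow> 'a set set" where
  "neglig M \<mu> = {A. A \<subseteq> space M \<and> (\<exists>N\<in>sets M. emeasure \<mu> N = 0 \<and> A \<subseteq> N)}"

definition univ_sets :: "'a measure \<Rightarrow> 'a set set" where
  "univ_sets M = (\<Inter>\<mu>\<in>space (prob_algebra M). sigma_sets (space M) (sets M \<union> neglig M \<mu>))"

definition univ_completion :: "'a measure \<Rightarrow> 'a measure" where
  "univ_completion M = sigma (space M) (univ_sets M)"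

definition univ_extension :: "'a measure \<Rightarrow> 'a measure \<Rightarrow> 'a measure" where
  "univ_extension M p =
     (THE r. r \<in> space (prob_algebra (univ_completion M)) \<and> (\<forall>A\<in>sets M. emeasure r A = emeasure p A))"

lemma space_univ_completion [simp]: "space (univ_completion M) = space M"
  by (simp add: univ_completion_def space_measure_of_conv)

lemma sets_univ_completion:
  assumes "p \<in> space (prob_algebra M)"
  shows "sets (univ_completion M) = univ_sets M"
proof -
  let ?A = "\<lambda>\<mu>. sigma_sets (space M) (sets M \<union> neglig M \<mu>)"
  have sub: "sets M \<union> neglig M \<mu> \<subseteq> Pow (space M)" for \<mu>
    by (auto simp: neglig_def dest: sets.sets_into_space)
  have Pow: "univ_sets M \<subseteq> Pow (space M)"
    using assms sigma_sets_into_sp[OF sub] unfolding univ_sets_def by blast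
  have "sigma_sets (space M) (univ_sets M) \<subseteq> ?A \<mu>" if "\<mu> \<in> space (prob_algebra M)" for \<mu>
  proof -
    have "sigma_algebra (space M) (?A \<mu>)"
      by (rule sigma_algebra_sigma_sets[OF sub])
    moreover have "univ_sets M \<subseteq> ?A \<mu>"
      using that unfolding univ_sets_def by blast
    ultimately show ?thesis
      by (rule sigma_algebra.sigma_sets_subset)
  qed
  then have "sigma_sets (space M) (univ_sets M) \<subseteq> univ_sets M"
    unfolding univ_sets_def by blast
  moreover have "univ_sets M \<subseteq> sigma_sets (space M) (univ_sets M)"
    by (rule sigma_sets_superset_generator)
  ultimately show ?thesis
    using Pow by (simp add: univ_completion_def)
qed

lemma univ_extension_ex1:
  assumes p: "p \<in> space (prob_algebra M)"
  shows "\<exists>!r. r \<in> space (prob_algebra (univ_completion M)) \<and>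
              (\<forall>A\<in>sets M. emeasure r A = emeasure p A)"
proof -
  have sp: "sets p = sets M" "prob_space p"
    using p by (auto simp: space_prob_algebra)
  then have spc: "space p = space M" by (auto dest: sets_eq_imp_space_eq)
  have "sigma_sets (space M) (sets M \<union> neglig M p) \<subseteq> sets (completion p)"
  proof -
    have "neglig M p \<subseteq> sets (completion p)"
    proof
      fix A assume "A \<in> neglig M p"
      then obtain N where "N \<in> null_sets p" "A \<subseteq> N"
        using sp by (auto simp: neglig_def null_sets_def)
      then show "A \<in> sets (completion p)"
        using sets_completionI_sub by blast
    qed
    moreover have "sets M \<subseteq> sets (completion p)" using sp by auto
    ultimately show ?thesis
      using spc sets.sigma_sets_subset[of "sets M \<union> neglig M p" "completion p"] by simp
  qed
  then have H: "sets (univ_completion M) \<subseteq> sets (completion p)"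
    using p by (auto simp: sets_univ_completion[OF p] univ_sets_def)
  then have sa: "subalgebra (completion p) (univ_completion M)"
    by (simp add: subalgebra_def spc)
  have MH: "sets M \<subseteq> sets (univ_completion M)"
    by (auto simp: sets_univ_completion[OF p] univ_sets_def)
  let ?r = "restr_to_subalg (completion p) (univ_completion M)"
  have e: "A \<in> sets (univ_completion M) \<Longrightarrow> emeasure ?r A = emeasure (completion p) A" for A
    using emeasure_restr_to_subalg[OF sa] by simp
  have "prob_space (completion p)"
    using sp(2) by (simp add: prob_space.prob_space_completion)
  then have r1: "?r \<in> space (prob_algebra (univ_completion M))"
    by (simp add: space_prob_algebra sets_restr_to_subalg[OF sa] prob_space_restr_to_subalg[OF sa])
  have r2: "\<forall>A\<in>sets M. emeasure ?r A = emeasure p A"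
    using e MH sp by (auto simp: subset_iff)
  show ?thesis
  proof (rule ex1I[of _ ?r], use r1 r2 in blast)
    fix r assume r: "r \<in> space (prob_algebra (univ_completion M)) \<and>
              (\<forall>A\<in>sets M. emeasure r A = emeasure p A)"
    then have sr: "sets r = sets (univ_completion M)" by (auto simp: space_prob_algebra)
    show "r = ?r"
    proof (rule measure_eqI)
      show "sets r = sets ?r" using sr by (simp add: sets_restr_to_subalg[OF sa])
      fix A assume "A \<in> sets r"
      then have A: "A \<in> sets (univ_completion M)" using sr by simp
      then obtain S N N' where S: "A = S \<union> N" "N \<subseteq> N'" "N' \<in> null_sets p" "S \<in> sets p"
        using H by (auto elim!: sets_completionE)
      have "emeasure r S \<le> emeasure r A"
        using A S sr by (intro emeasure_mono) auto
      moreover have "emeasure r A \<le> emeasure r (S \<union> N')"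
        using A S sr MH sp by (intro emeasure_mono) (auto simp: null_sets_def)
      moreover have "emeasure r (S \<union> N') = emeasure p (S \<union> N')"
        using r S sp by (auto simp: null_sets_def)
      moreover have "emeasure p (S \<union> N') = emeasure p S"
        using S by (simp add: emeasure_Un_null_set)
      moreover have "emeasure r S = emeasure p S" using r S sp by auto
      ultimately have "emeasure r A = emeasure p S" by simp
      moreover have "emeasure (completion p) A = emeasure p S"
      proof (rule antisym)
        have Ac: "A \<in> sets (completion p)" using A H by auto
        have SN: "S \<union> N' \<in> sets p"
          using S by (auto simp: null_sets_def)
        then have "emeasure (completion p) A \<le> emeasure (completion p) (S \<union> N')"
          using S by (intro emeasure_mono) auto
        also have "\<dots> = emeasure p (S \<union> N')"
          using SN by simp
        finally show "emeasure (completion p) A \<le> emeasure p S"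
          using S by (simp add: emeasure_Un_null_set)
        have "emeasure p S = emeasure (completion p) S" using S by simp
        also have "\<dots> \<le> emeasure (completion p) A"
          using S Ac by (intro emeasure_mono) auto
        finally show "emeasure p S \<le> emeasure (completion p) A" .
      qed
      ultimately show "emeasure r A = emeasure ?r A" using e[OF A] by simp
    qed
  qed
qed

subsection \<open>Topology on the probability measures over a Polish space\<close>

definition polish :: "'a topology \<Rightarrow> bool" where
  "polish X \<longleftrightarrow> completely_metrizable_space X \<and> separable_space X"

definition borel_sets :: "'a topology \<Rightarrow> 'a set set" where
  "borel_sets X = sigma_sets (topspace X) {U. openin X U}"

definition weak_topology :: "'a topology \<Rightarrow> 'a measure \<Rightarrow> 'a measure topology" where
  "weak_topology X M = topology_generated_by
     {{\<mu> \<in> space (prob_algebra M). (\<integral>x. f x \<partial>\<mu>) \<in> U} | f U.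
        continuous_map X euclideanreal f \<and> bounded (f ` topspace X) \<and> open U}"

definition perfect_in :: "'b topology \<Rightarrow> 'b set \<Rightarrow> bool" where
  "perfect_in T S \<longleftrightarrow> closedin T S \<and> (\<forall>\<sigma>\<in>S. T closure_of (S - {\<sigma>}) = S)"

definition baire_space :: "(nat \<Rightarrow> nat) topology" where
  "baire_space = product_topology (\<lambda>_. discrete_topology UNIV) UNIV"

definition analytic_in :: "'b topology \<Rightarrow> 'b set \<Rightarrow> bool" where
  "analytic_in T S \<longleftrightarrow>
     S = {} \<or> (\<exists>f. continuous_map baire_space T f \<and> f ` topspace baire_space = S)"

end

(*
Suppose the lattice on the universal completion is Dedekind complete and Q is a disjoint supported
alternative. For every subset J of Q the supremum of the indicators of the supports S(q), q in J,
yields a universally measurable set A(J) with q(A(J)) = 1 for q in J and q(A(J)) = 0 for the other q.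
Any probability mu << P then induces the measure J |-> mu(A(J)) on all subsets of Q. By the continuum
hypothesis Q has at most aleph_1 elements, so this measure is carried by a countable set C (Ulam),
i.e. mu is carried by the countable union of the supports S(q), q in C.

For (1) this makes the total variation of every element of ca_c supported. For (2) a subfamily R as
assumed contains an injective measurable image of the Cantor space; the mixture of its members
under coin tossing gives mass 0 to every countable union of supports. The image is produced by a Cantor scheme.
For a measurable R it is run on a code of the measures in nat => nat. A nonempty perfect R is
closed, hence measurable. It is uncountable: otherwise one can choose balls whose spheres are null for
all its members, so that the masses of the cells cut out by the balls embed R homeomorphically as
a G_delta subset without isolated points of a complete space.
*)

theory Submission
  imports Defs
begin

subsection \<open>Measures on all subsets under the continuum hypothesis\<close>

text \<open>The supremum of uncountably many indicators is determined only up to quasi sure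
  equality, so J |-> A(J) respects countable unions and disjointness only modulo exceptional sets.
  These are null for every q. They are null for mu as well, because a universally measurable set can
  be approximated from inside by a set of \<open>sets M\<close> chosen for mu. This is where
  universal measurability matters: mu is an arbitrary dominated measure, possibly unrelated to any
  single q, and must nevertheless measure every A(J).

  For (1), being carried by countably many supports is turned into having a support by means of a
  Radon-Nikodym density on each of them. For (2), the mixture must depend measurably on the bits;
  hence the detour through explicit codes of points and of measures, whose decoding maps are
  measurable. Spheres can be made null for countably many measures at once but not for an arbitrary
  family, which is why the perfect case argues by contradiction from countability.\<close>

lemma countable_initial_segments:
  assumes CH: "continuum_hypothesis" and I: "I \<lesssim> (UNIV :: nat set set)" and unc: "uncountable I"
  obtains r where "well_order_on I r" and "\<And>a. a \<in> I \<Longrightarrow> countable (underS r a)"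
proof -
  from I obtain h :: "'a \<Rightarrow> nat set" where h: "inj_on h I"
    by (auto simp: lepoll_def)
  have alt: "countable J \<or> J \<approx> I" if "J \<subseteq> I" for J
  proof (cases "countable J")
    case False
    have inj: "inj_on h J" using h that by (rule inj_on_subset)
    then have "J \<approx> h ` J" by (simp add: inj_on_image_eqpoll_self eqpoll_sym)
    moreover have "h ` J \<approx> (UNIV :: nat set set)"
      using CH False inj countable_image_inj_on[of h J] unfolding continuum_hypothesis_def by blast
    ultimately have "I \<lesssim> J"
      using I by (blast intro: lepoll_trans2 eqpoll_sym eqpoll_trans)
    then show ?thesis
      using that lepoll_antisym subset_imp_lepoll by blast
  qed simp
  \<comment> \<open>\<open>card_of I\<close> is a well-order of least possible type, so its proper
    initial segments are strictly smaller than \<open>I\<close>; by \<open>alt\<close> a subset of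
    \<open>I\<close> that is not equipollent to \<open>I\<close> is countable.\<close>
  have "countable (underS (card_of I) a)" if "a \<in> I" for a
  proof -
    have less: "(card_of (underS (card_of I) a), card_of I) \<in> ordLess"
      using card_of_underS[OF card_of_Card_order, of a I] that by (simp add: Field_card_of)
    have "underS (card_of I) a \<subseteq> I"
      using Field_card_of[of I] by (auto simp: underS_def Field_def)
    moreover have "\<not> underS (card_of I) a \<approx> I"
      using less not_ordLess_ordIso unfolding eqpoll_iff_card_of_ordIso by blast
    ultimately show ?thesis using alt by blast
  qed
  then show ?thesis using that card_of_well_order_on by blast
qed

text \<open>For each n only finitely many of the disjoint sets can have mass above 1/(n+1). Applied
  below to single points, to the entries of one row of the Ulam matrix, and to concentric spheres of
  different radii.\<close>

lemma finite_measure_disjoint_countable_support: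
  assumes "finite_measure N" and A: "\<And>i. i \<in> I \<Longrightarrow> A i \<in> sets N" and disj: "disjoint_family_on A I"
  shows "countable {i \<in> I. emeasure N (A i) \<noteq> 0}"
proof -
  interpret finite_measure N by fact
  have fin: "finite {i \<in> I. measure N (A i) > 1 / real (Suc n)}" for n
  proof (rule ccontr)
    let ?J = "{i \<in> I. measure N (A i) > 1 / real (Suc n)}"
    assume inf: "infinite ?J"
    obtain m where m: "real m > measure N (space N) * real (Suc n)"
      using reals_Archimedean2 by blast
    obtain F where F: "F \<subseteq> ?J" "finite F" "card F = m"
      using infinite_arbitrarily_large[OF inf] by metis
    have "real m / real (Suc n) = (\<Sum>i\<in>F. 1 / real (Suc n))" using F by simp
    also have "\<dots> \<le> (\<Sum>i\<in>F. measure N (A i))"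
      using F by (intro sum_mono) (auto simp: less_imp_le)
    also have "\<dots> = measure N (\<Union>i\<in>F. A i)"
      using F A disj by (intro finite_measure_finite_Union[symmetric])
        (auto simp: disjoint_family_on_def subset_iff)
    also have "\<dots> \<le> measure N (space N)"
      by (rule bounded_measure)
    finally show False using m by (simp add: field_simps)
  qed
  have "{i \<in> I. emeasure N (A i) \<noteq> 0} \<subseteq> (\<Union>n. {i \<in> I. measure N (A i) > 1 / real (Suc n)})"
  proof safe
    fix i assume "i \<in> I" "emeasure N (A i) \<noteq> 0"
    then have "measure N (A i) > 0"
      by (simp add: emeasure_eq_measure zero_less_measure_iff)
    then obtain n where "inverse (real (Suc n)) < measure N (A i)"
      using reals_Archimedean by blast
    then show "i \<in> (\<Union>n. {i \<in> I. measure N (A i) > 1 / real (Suc n)})"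
      using \<open>i \<in> I\<close> by (auto simp: inverse_eq_divide)
  qed
  then show ?thesis
    using fin by (meson countable_UN countable_finite countable_subset uncountable_def countableI_type)
qed

text \<open>Ulam's matrix. Once the countably many atoms \<open>C\<close> are removed, countable
  sets are null. If the rest is uncountable, it is well-ordered with countable initial segments, and
  the predecessors of each point are numbered injectively. Some column of the resulting matrix
  consists of null sets only, yet it covers everything above its index; so the rest is null.\<close>

theorem Ulam_continuum_hypothesis:
  assumes CH: "continuum_hypothesis" and "finite_measure N" and sets: "sets N = Pow (space N)"
    and card: "space N \<lesssim> (UNIV :: nat set set)"
  obtains C where "countable C" "C \<subseteq> space N" "emeasure N (space N - C) = 0"
proof -
  interpret finite_measure N by fact
  let ?I = "space N"
  have cnt0: "emeasure N B = 0" if "countable B" "B \<subseteq> ?I" "\<And>x. x \<in> B \<Longrightarrow> emeasure N {x} = 0" for B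
  proof -
    have "(\<Union>x\<in>B. {x}) \<in> null_sets N"
      using that sets by (intro null_sets_UN') (auto simp: null_sets_def)
    then show ?thesis by auto
  qed
  define C where "C = {x \<in> ?I. emeasure N {x} \<noteq> 0}"
  have C: "countable C" "C \<subseteq> ?I"
    using finite_measure_disjoint_countable_support[of N ?I "\<lambda>x. {x}"] sets \<open>finite_measure N\<close>
    by (auto simp: C_def disjoint_family_on_def)
  show thesis
  proof (cases "countable (?I - C)")
    case True
    then have "emeasure N (?I - C) = 0"
      by (rule cnt0) (auto simp: C_def)
    then show ?thesis using C that by blast
  next
    case False
    have "?I - C \<lesssim> (UNIV :: nat set set)"
      using lepoll_trans[OF subset_imp_lepoll[OF Diff_subset] card] .
    then obtain r where r: "well_order_on (?I - C) r"
      and cr: "\<And>a. a \<in> ?I - C \<Longrightarrow> countable (underS r a)"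
      using countable_initial_segments[OF CH _ False] by blast
    define f where "f a = to_nat_on (underS r a)" for a
    have finj: "f a b = f a c \<Longrightarrow> b = c" if "a \<in> ?I - C" "b \<in> underS r a" "c \<in> underS r a" for a b c
      using cr[OF that(1)] that(2,3) by (auto simp: f_def)
    \<comment> \<open>Entry (n, b) of the matrix: the points above b that give b the number n. In a
      fixed row n the entries are disjoint, since \<open>f a\<close> is injective on the
      predecessors of a.\<close>
    define U where "U n b = {a \<in> ?I - C. b \<in> underS r a \<and> f a b = n}" for n b
    have "countable {b \<in> ?I - C. emeasure N (U n b) \<noteq> 0}" for n
      using finj sets by (intro finite_measure_disjoint_countable_support \<open>finite_measure N\<close>)
        (auto simp: disjoint_family_on_def U_def)
    then have "countable (\<Union>n. {b \<in> ?I - C. emeasure N (U n b) \<noteq> 0})"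
      by (intro countable_UN) auto
    then have "\<not> ?I - C \<subseteq> (\<Union>n. {b \<in> ?I - C. emeasure N (U n b) \<noteq> 0})"
      using False countable_subset by blast
    \<comment> \<open>Each row has only countably many entries of positive mass, so uncountably many
      indices remain, and any of them has null entries in all rows.\<close>
    then obtain b where b: "b \<in> ?I - C" "\<And>n. emeasure N (U n b) = 0"
      by blast
    have "(\<Union>n. U n b) \<in> null_sets N"
      using b(2) sets by (intro null_sets_UN) (auto simp: U_def null_sets_def)
    moreover have "underS r b \<inter> (?I - C) \<union> {b} \<in> null_sets N"
    proof -
      have "emeasure N (underS r b \<inter> (?I - C) \<union> {b}) = 0"
        using b(1) cr[OF b(1)] by (intro cnt0[where B = "underS r b \<inter> (?I - C) \<union> {b}"])
          (auto simp: C_def)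
      then show ?thesis using sets b(1) by (auto simp: null_sets_def)
    qed
    ultimately have U: "(\<Union>n. U n b) \<union> (underS r b \<inter> (?I - C) \<union> {b}) \<in> null_sets N"
      by (rule null_sets.Un)
    have sub: "?I - C \<subseteq> (\<Union>n. U n b) \<union> (underS r b \<inter> (?I - C) \<union> {b})"
      using r b(1) unfolding well_order_on_def linear_order_on_def total_on_def
      by (auto simp: U_def underS_def)
    have "?I - C \<in> null_sets N"
      using null_sets_subset[OF U _ sub] sets by auto
    then show ?thesis using C that by auto
  qed
qed

subsection \<open>Total variation\<close>

lemma ca_empty: "\<mu> \<in> ca M \<Longrightarrow> \<mu> {} = 0"
  by (simp add: ca_def)

lemma ca_sums:
  assumes "\<mu> \<in> ca M" "range A \<subseteq> sets M" "disjoint_family A"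
  shows "(\<lambda>i. \<mu> (A i)) sums \<mu> (\<Union>i. A i)"
  using assms unfolding ca_def by blast

lemma ca_Un:
  assumes \<mu>: "\<mu> \<in> ca M" and "A \<in> sets M" "B \<in> sets M" "A \<inter> B = {}"
  shows "\<mu> (A \<union> B) = \<mu> A + \<mu> B"
proof -
  have "(\<lambda>i. \<mu> (binaryset A B i)) sums \<mu> (\<Union>i. binaryset A B i)"
    using assms by (intro ca_sums[OF \<mu>]) (auto simp: range_binaryset_eq disjoint_family_on_def binaryset_def)
  moreover have "(\<lambda>i. \<mu> (binaryset A B i)) sums (\<mu> A + \<mu> B)"
    using ca_empty[OF \<mu>] by (rule binaryset_sums)
  ultimately show ?thesis
    by (simp add: UN_binaryset_eq sums_unique2)
qed

lemma ca_finite_UN: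
  assumes \<mu>: "\<mu> \<in> ca M" and "finite I" "\<And>i. i \<in> I \<Longrightarrow> A i \<in> sets M" "disjoint_family_on A I"
  shows "\<mu> (\<Union>i\<in>I. A i) = (\<Sum>i\<in>I. \<mu> (A i))"
  using assms(2-)
proof (induction I)
  case empty
  then show ?case using ca_empty[OF \<mu>] by simp
next
  case (insert i I)
  have "\<mu> (A i \<union> (\<Union>i\<in>I. A i)) = \<mu> (A i) + \<mu> (\<Union>i\<in>I. A i)"
    using insert.prems insert.hyps by (intro ca_Un[OF \<mu>]) (auto simp: disjoint_family_on_def)
  then show ?case using insert by (simp add: disjoint_family_on_def)
qed

text \<open>\<open>D\<close> may cover more than \<open>A\<close>: the traces of its cells on
  \<open>A\<close> form a partition once the empty ones are dropped, which
  \<open>partition_on\<close> excludes.\<close>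

lemma total_variation_ge:
  assumes \<mu>: "\<mu> {} = 0" and "finite D" "D \<subseteq> sets M" "disjoint D" "A \<in> sets M" "A \<subseteq> \<Union>D"
  shows "(\<Sum>B\<in>D. ennreal \<bar>\<mu> (B \<inter> A)\<bar>) \<le> total_variation M \<mu> A"
proof -
  let ?D = "{B \<in> D. B \<inter> A \<noteq> {}}" and ?f = "\<lambda>B. B \<inter> A"
  have inj: "inj_on ?f ?D"
    using \<open>disjoint D\<close> by (fastforce simp: inj_on_def disjoint_def)
  have "(\<Sum>B\<in>D. ennreal \<bar>\<mu> (B \<inter> A)\<bar>) = (\<Sum>B\<in>?D. ennreal \<bar>\<mu> (B \<inter> A)\<bar>)"
    using assms by (intro sum.mono_neutral_right) auto
  also have "\<dots> = (\<Sum>B\<in>?f ` ?D. ennreal \<bar>\<mu> B\<bar>)"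
    using inj by (subst sum.reindex) auto
  also have "\<dots> \<le> total_variation M \<mu> A"
  proof -
    have "partition_on A (?f ` ?D)"
    proof (rule partition_onI)
      show "\<Union>(?f ` ?D) = A" using \<open>A \<subseteq> \<Union>D\<close> by blast
    next
      fix p q assume "p \<in> ?f ` ?D" "q \<in> ?f ` ?D" "p \<noteq> q"
      then show "disjnt p q"
        using \<open>disjoint D\<close> by (auto simp: disjnt_def disjoint_def)
    qed auto
    then show ?thesis
      unfolding total_variation_def using assms by (intro SUP_upper) auto
  qed
  finally show ?thesis .
qed

lemma total_variation_partition:
  assumes "c < total_variation M \<mu> A"
  obtains D where "finite D" "D \<subseteq> sets M" "partition_on A D" "c < (\<Sum>B\<in>D. ennreal \<bar>\<mu> B\<bar>)"
  using assms unfolding total_variation_def less_SUP_iff by blast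

lemma total_variation_empty:
  assumes "\<mu> {} = 0"
  shows "total_variation M \<mu> {} = 0"
proof -
  have "{D. finite D \<and> D \<subseteq> sets M \<and> partition_on {} D} = {{}}"
    by (auto simp: partition_on_def)
  then show ?thesis by (simp add: total_variation_def)
qed

text \<open>Partitions of two disjoint sets can be joined; since cells are nonempty, no cell belongs
  to both.\<close>

lemma total_variation_superadditive:
  assumes \<mu>: "\<mu> \<in> ca M" and A: "A \<in> sets M" and B: "B \<in> sets M" and disj: "A \<inter> B = {}"
  shows "total_variation M \<mu> A + total_variation M \<mu> B \<le> total_variation M \<mu> (A \<union> B)"
proof -
  let ?P = "\<lambda>A. {D. finite D \<and> D \<subseteq> sets M \<and> partition_on A D}"
  let ?s = "\<lambda>D. \<Sum>B\<in>D. ennreal \<bar>\<mu> B\<bar>"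
  have ne: "?P C \<noteq> {}" if "C \<in> sets M" for C
  proof -
    \<comment> \<open>Removing the empty set covers C = {}, whose only partition is the empty
      one.\<close>
    have "{C} - {{}} \<in> ?P C" using that by (auto simp: partition_on_def disjoint_def)
    then show ?thesis by blast
  qed
  have le: "?s D + ?s E \<le> total_variation M \<mu> (A \<union> B)" if D: "D \<in> ?P A" and E: "E \<in> ?P B" for D E
  proof -
    have sub: "C \<subseteq> A" if "C \<in> D" for C
      using D that by (auto simp: partition_on_def)
    have sub': "C \<subseteq> B" if "C \<in> E" for C
      using E that by (auto simp: partition_on_def)
    have *: "D \<inter> E = {}"
    proof (rule ccontr)
      assume "D \<inter> E \<noteq> {}"
      then obtain C where "C \<in> D" "C \<in> E" by blast
      moreover from this have "C = {}" using sub sub' disj by blast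
      ultimately show False using D by (simp add: partition_on_def)
    qed
    have DE: "partition_on (A \<union> B) (D \<union> E)"
    proof (rule partition_onI)
      fix p q assume "p \<in> D \<union> E" "q \<in> D \<union> E" "p \<noteq> q"
      moreover have "disjnt p q" if "p \<in> D" "q \<in> D" "p \<noteq> q" for p q
        using D that by (simp add: partition_on_def disjoint_def disjnt_def)
      moreover have "disjnt p q" if "p \<in> E" "q \<in> E" "p \<noteq> q" for p q
        using E that by (simp add: partition_on_def disjoint_def disjnt_def)
      moreover have "disjnt p q" if "p \<in> D" "q \<in> E" for p q
        using sub[OF that(1)] sub'[OF that(2)] disj by (auto simp: disjnt_def)
      ultimately show "disjnt p q"
        by (metis Un_iff disjnt_sym)
    qed (use D E in \<open>auto simp: partition_on_def\<close>)
    have "?s D + ?s E = ?s (D \<union> E)"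
      using D E * by (intro sum.union_disjoint[symmetric]) auto
    also have "\<dots> \<le> total_variation M \<mu> (A \<union> B)"
      unfolding total_variation_def
      using D E DE by (intro SUP_upper) auto
    finally show ?thesis .
  qed
  have "total_variation M \<mu> A + total_variation M \<mu> B = (SUP D\<in>?P A. ?s D + total_variation M \<mu> B)"
    unfolding total_variation_def[of _ _ A] by (rule ennreal_SUP_add_left[symmetric, OF ne[OF A]])
  also have "\<dots> \<le> total_variation M \<mu> (A \<union> B)"
  proof (rule SUP_least)
    fix D assume D: "D \<in> ?P A"
    have "?s D + total_variation M \<mu> B = (SUP E\<in>?P B. ?s D + ?s E)"
      unfolding total_variation_def by (rule ennreal_SUP_add_right[OF ne[OF B]])
    also have "\<dots> \<le> total_variation M \<mu> (A \<union> B)"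
      using le[OF D] by (rule SUP_least)
    finally show "?s D + total_variation M \<mu> B \<le> total_variation M \<mu> (A \<union> B)" .
  qed
  finally show ?thesis .
qed

lemma total_variation_mono:
  assumes \<mu>: "\<mu> \<in> ca M" and "A \<in> sets M" "B \<in> sets M" "A \<subseteq> B"
  shows "total_variation M \<mu> A \<le> total_variation M \<mu> B"
proof -
  have "total_variation M \<mu> A + 0 \<le> total_variation M \<mu> A + total_variation M \<mu> (B - A)"
    by (intro add_mono) auto
  also have "\<dots> \<le> total_variation M \<mu> (A \<union> (B - A))"
    using assms by (intro total_variation_superadditive[OF \<mu>]) auto
  finally show ?thesis using \<open>A \<subseteq> B\<close> by (simp add: Un_absorb1)
qed

text \<open>Superadditivity and monotonicity bound the series by the whole. Conversely, every cell
  of a partition of the union is cut along the \<open>A i\<close>, and its mass is at most the sum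
  over the pieces, a divergent sum being infinite in \<open>ennreal\<close>.\<close>

lemma total_variation_countably_additive:
  assumes \<mu>: "\<mu> \<in> ca M"
  shows "countably_additive (sets M) (total_variation M \<mu>)"
  unfolding countably_additive_def
proof safe
  fix A :: "nat \<Rightarrow> _" assume A: "range A \<subseteq> sets M" "disjoint_family A"
  let ?t = "total_variation M \<mu>"
  have As: "A i \<in> sets M" for i using A by auto
  have fin: "(\<Sum>i<n. ?t (A i)) \<le> ?t (\<Union>i<n. A i)" for n
  proof (induction n)
    case 0
    then show ?case by simp
  next
    case (Suc n)
    have "A i \<inter> A n = {}" if "i < n" for i
      using A(2) that by (auto simp: disjoint_family_on_def)
    then have dj: "(\<Union>i<n. A i) \<inter> A n = {}" by auto
    have "(\<Sum>i<Suc n. ?t (A i)) \<le> ?t (\<Union>i<n. A i) + ?t (A n)"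
      using Suc by (simp add: add_mono)
    also have "\<dots> \<le> ?t ((\<Union>i<n. A i) \<union> A n)"
      using As by (intro total_variation_superadditive[OF \<mu> _ _ dj]) auto
    finally show ?case by (simp add: lessThan_Suc Un_commute)
  qed
  show "(\<Sum>i. ?t (A i)) = ?t (\<Union>i. A i)"
  proof (rule antisym)
    show "(\<Sum>i. ?t (A i)) \<le> ?t (\<Union>i. A i)"
    proof (rule suminf_le_const[OF summableI])
      fix n
      have "?t (\<Union>i<n. A i) \<le> ?t (\<Union>i. A i)"
        using As by (intro total_variation_mono[OF \<mu>]) auto
      then show "(\<Sum>i<n. ?t (A i)) \<le> ?t (\<Union>i. A i)" using fin order_trans by blast
    qed
    show "?t (\<Union>i. A i) \<le> (\<Sum>i. ?t (A i))"
    proof (subst (1) total_variation_def, rule SUP_least)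
      fix D assume "D \<in> {D. finite D \<and> D \<subseteq> sets M \<and> partition_on (\<Union>i. A i) D}"
      then have D: "finite D" "D \<subseteq> sets M" "partition_on (\<Union>i. A i) D" by auto
      have "ennreal \<bar>\<mu> B\<bar> \<le> (\<Sum>i. ennreal \<bar>\<mu> (B \<inter> A i)\<bar>)" if B: "B \<in> D" for B
      proof (cases "summable (\<lambda>i. \<bar>\<mu> (B \<inter> A i)\<bar>)")
        case True
        have "(\<lambda>i. \<mu> (B \<inter> A i)) sums \<mu> (\<Union>i. B \<inter> A i)"
          using A As B D by (intro ca_sums[OF \<mu>]) (auto simp: disjoint_family_on_def)
        moreover have "(\<Union>i. B \<inter> A i) = B"
          using B D by (auto simp: partition_on_def)
        ultimately have "\<mu> B = (\<Sum>i. \<mu> (B \<inter> A i))"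
          by (simp add: sums_iff)
        then have "\<bar>\<mu> B\<bar> \<le> (\<Sum>i. \<bar>\<mu> (B \<inter> A i)\<bar>)"
          using summable_rabs[OF True] by simp
        then show ?thesis
          using True by (simp add: suminf_ennreal2)
      next
        case False
        then have "(\<Sum>i. ennreal \<bar>\<mu> (B \<inter> A i)\<bar>) = \<top>"
          using summable_suminf_not_top[of "\<lambda>i. \<bar>\<mu> (B \<inter> A i)\<bar>"] by (metis abs_ge_zero)
        then show ?thesis by simp
      qed
      then have "(\<Sum>B\<in>D. ennreal \<bar>\<mu> B\<bar>) \<le> (\<Sum>B\<in>D. \<Sum>i. ennreal \<bar>\<mu> (B \<inter> A i)\<bar>)"
        by (rule sum_mono)
      also have "\<dots> = (\<Sum>i. \<Sum>B\<in>D. ennreal \<bar>\<mu> (B \<inter> A i)\<bar>)"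
        by (rule suminf_sum[symmetric]) (rule summableI)
      also have "\<dots> \<le> (\<Sum>i. ?t (A i))"
      proof (rule suminf_le[OF _ summableI summableI])
        show "(\<Sum>B\<in>D. ennreal \<bar>\<mu> (B \<inter> A i)\<bar>) \<le> ?t (A i)" for i
          using D As ca_empty[OF \<mu>] by (intro total_variation_ge) (auto simp: partition_on_def)
      qed
      finally show "(\<Sum>B\<in>D. ennreal \<bar>\<mu> B\<bar>) \<le> (\<Sum>i. ?t (A i))" .
    qed
  qed
qed

definition tv_measure :: "'a measure \<Rightarrow> ('a set \<Rightarrow> real) \<Rightarrow> 'a measure" where
  "tv_measure M \<mu> = measure_of (space M) (sets M) (total_variation M \<mu>)"

lemma space_tv_measure [simp]: "space (tv_measure M \<mu>) = space M"
  and sets_tv_measure [simp, measurable_cong]: "sets (tv_measure M \<mu>) = sets M"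
  by (simp_all add: tv_measure_def)

lemma emeasure_tv_measure:
  assumes \<mu>: "\<mu> \<in> ca M" and "A \<in> sets M"
  shows "emeasure (tv_measure M \<mu>) A = total_variation M \<mu> A"
  unfolding tv_measure_def
  using total_variation_countably_additive[OF \<mu>] assms
  by (intro emeasure_measure_of_sigma)
    (auto simp: positive_def total_variation_empty ca_empty sets.sigma_algebra_axioms)

text \<open>In a fine enough partition the cells of one sign have a union C with |\<mu> C| \<ge> 1 +
  |\<mu> E|. Then C and E - C both have mass of modulus at least 1, and one of them keeps infinite
  variation, so the other can be cut off.\<close>

lemma total_variation_infinite_split:
  assumes \<mu>: "\<mu> \<in> ca M" and E: "E \<in> sets M" and inf: "total_variation M \<mu> E = \<top>"
  obtains A where "A \<in> sets M" "A \<subseteq> E" "\<bar>\<mu> A\<bar> \<ge> 1" "total_variation M \<mu> (E - A) = \<top>"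
proof -
  \<comment> \<open>The factor 2 leaves 1 + |\<mu> E| for one of the two signs; the summand |\<mu>
    E| makes the complement heavy too.\<close>
  have "ennreal (2 * (1 + \<bar>\<mu> E\<bar>)) < total_variation M \<mu> E"
    using inf by simp
  then obtain D where D: "finite D" "D \<subseteq> sets M" "partition_on E D"
    and "ennreal (2 * (1 + \<bar>\<mu> E\<bar>)) < (\<Sum>B\<in>D. ennreal \<bar>\<mu> B\<bar>)"
    by (rule total_variation_partition)
  then have big: "2 * (1 + \<bar>\<mu> E\<bar>) < (\<Sum>B\<in>D. \<bar>\<mu> B\<bar>)"
    by (simp only: sum_ennreal[OF abs_ge_zero]) (subst (asm) ennreal_less_iff, auto)
  let ?P = "{B \<in> D. \<mu> B \<ge> 0}" and ?N = "{B \<in> D. \<mu> B < 0}"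
  have sum: "\<mu> (\<Union>C) = (\<Sum>B\<in>C. \<mu> B)" if "C \<subseteq> D" for C
    using ca_finite_UN[OF \<mu>, of C "\<lambda>B. B"] D that finite_subset[OF that]
    by (auto simp: partition_on_def disjoint_def disjoint_family_on_def subset_iff)
  have "(\<Sum>B\<in>D. \<bar>\<mu> B\<bar>) = (\<Sum>B\<in>?P. \<bar>\<mu> B\<bar>) + (\<Sum>B\<in>?N. \<bar>\<mu> B\<bar>)"
    using D by (subst sum.union_disjoint[symmetric]) (auto intro!: sum.cong)
  also have "(\<Sum>B\<in>?P. \<bar>\<mu> B\<bar>) = \<mu> (\<Union>?P)"
    by (subst sum) auto
  also have "(\<Sum>B\<in>?N. \<bar>\<mu> B\<bar>) = - \<mu> (\<Union>?N)"
    by (subst sum) (auto simp: sum_negf[symmetric])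
  finally have "1 + \<bar>\<mu> E\<bar> \<le> \<bar>\<mu> (\<Union>?P)\<bar> \<or> 1 + \<bar>\<mu> E\<bar> \<le> \<bar>\<mu> (\<Union>?N)\<bar>"
    using big by (smt (verit))
  then obtain C where C: "C \<subseteq> D" "1 + \<bar>\<mu> E\<bar> \<le> \<bar>\<mu> (\<Union>C)\<bar>"
    by (metis (no_types, lifting) mem_Collect_eq subsetI)
  let ?A = "\<Union>C"
  have A: "?A \<in> sets M" "?A \<subseteq> E"
    using C D finite_subset[OF C(1)] by (auto simp: partition_on_def intro!: sets.finite_Union)
  have "\<mu> (?A \<union> (E - ?A)) = \<mu> ?A + \<mu> (E - ?A)"
    using A E by (intro ca_Un[OF \<mu>]) auto
  then have "\<mu> E = \<mu> ?A + \<mu> (E - ?A)" using A by (simp add: Un_absorb1)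
  then have ge: "\<bar>\<mu> ?A\<bar> \<ge> 1" "\<bar>\<mu> (E - ?A)\<bar> \<ge> 1"
    using C(2) by linarith+
  have "total_variation M \<mu> E = total_variation M \<mu> ?A + total_variation M \<mu> (E - ?A)"
  proof -
    have "emeasure (tv_measure M \<mu>) (?A \<union> (E - ?A)) =
        emeasure (tv_measure M \<mu>) ?A + emeasure (tv_measure M \<mu>) (E - ?A)"
      using A E by (intro plus_emeasure[symmetric]) auto
    then show ?thesis using A E by (simp add: Un_absorb1 emeasure_tv_measure[OF \<mu>])
  qed
  then consider "total_variation M \<mu> (E - ?A) = \<top>" | "total_variation M \<mu> (E - (E - ?A)) = \<top>"
    using inf A by (metis double_diff ennreal_add_eq_top order_refl)
  then show ?thesis
  proof cases
    case 1
    then show ?thesis using that[of ?A] A ge by blast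
  next
    case 2
    then show ?thesis using that[of "E - ?A"] A E ge by blast
  qed
qed

text \<open>Cutting off a piece of mass at least 1 in modulus, again and again from a remainder of
  infinite variation, yields disjoint sets whose masses form a series that cannot converge.\<close>

lemma finite_measure_tv_measure:
  assumes \<mu>: "\<mu> \<in> ca M"
  shows "finite_measure (tv_measure M \<mu>)"
proof (rule finite_measureI, rule notI)
  let ?I = "\<lambda>E. E \<in> sets M \<and> total_variation M \<mu> E = \<top>"
  assume "emeasure (tv_measure M \<mu>) (space (tv_measure M \<mu>)) = \<infinity>"
  then have I: "?I (space M)" by (simp add: emeasure_tv_measure[OF \<mu>])
  define cut where "cut E = (SOME A. A \<in> sets M \<and> A \<subseteq> E \<and> \<bar>\<mu> A\<bar> \<ge> 1 \<and> ?I (E - A))" for E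
  have cut: "cut E \<in> sets M \<and> cut E \<subseteq> E \<and> \<bar>\<mu> (cut E)\<bar> \<ge> 1 \<and> ?I (E - cut E)" if E: "?I E" for E
  proof -
    obtain A where "A \<in> sets M" "A \<subseteq> E" "\<bar>\<mu> A\<bar> \<ge> 1" "total_variation M \<mu> (E - A) = \<top>"
      using total_variation_infinite_split[OF \<mu>] E by metis
    moreover from this have "E - A \<in> sets M" using E by blast
    ultimately show ?thesis
      unfolding cut_def by (intro someI_ex[of "\<lambda>A. A \<in> sets M \<and> A \<subseteq> E \<and> \<bar>\<mu> A\<bar> \<ge> 1 \<and> ?I (E - A)"]) auto
  qed
  define E where "E n = ((\<lambda>E. E - cut E) ^^ n) (space M)" for n
  have E_Suc: "E (Suc n) = E n - cut (E n)" for n by (simp add: E_def)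
  have E: "?I (E n)" for n
  proof (induction n)
    case 0
    then show ?case using I by (simp add: E_def)
  next
    case (Suc n)
    then show ?case using cut[OF Suc] by (simp add: E_Suc)
  qed
  have "decseq E" by (rule decseq_SucI) (simp add: E_Suc)
  have disj: "cut (E m) \<inter> cut (E n) = {}" if "m < n" for m n
  proof -
    have "E n \<subseteq> E (Suc m)" using \<open>decseq E\<close> that by (auto simp: decseq_def)
    moreover have "cut (E n) \<subseteq> E n" using cut[OF E[of n]] by blast
    ultimately show ?thesis unfolding E_Suc by blast
  qed
  have "disjoint_family (\<lambda>n. cut (E n))"
    unfolding disjoint_family_on_def
  proof (intro ballI impI)
    fix m n :: nat assume "m \<noteq> n"
    then show "cut (E m) \<inter> cut (E n) = {}"
      using disj[of m n] disj[of n m] by (cases m n rule: linorder_cases) auto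
  qed
  then have "(\<lambda>n. \<mu> (cut (E n))) sums \<mu> (\<Union>n. cut (E n))"
    using cut[OF E] by (intro ca_sums[OF \<mu>]) blast
  then have "(\<lambda>n. \<mu> (cut (E n))) \<longlonglongrightarrow> 0"
    by (simp add: sums_iff summable_LIMSEQ_zero)
  from LIMSEQ_D[OF this zero_less_one] obtain n where "norm (\<mu> (cut (E n)) - 0) < 1"
    by blast
  then show False using cut[OF E[of n]] by simp
qed

text \<open>Lets the definitions, which are phrased through total variations, be read as statements
  about \<open>emeasure\<close>.\<close>

lemma total_variation_measure:
  assumes q: "q \<in> space (prob_algebra M)" and A: "A \<in> sets M"
  shows "total_variation M (measure q) A = emeasure q A"
proof -
  interpret prob_space q using q by (simp add: space_prob_algebra)
  have sq: "sets q = sets M" using q by (simp add: space_prob_algebra)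
  have eq: "(\<Sum>B\<in>D. ennreal \<bar>measure q B\<bar>) = emeasure q A"
    if "finite D" "D \<subseteq> sets M" "partition_on A D" for D
  proof -
    have "(\<Sum>B\<in>D. ennreal \<bar>measure q B\<bar>) = (\<Sum>B\<in>D. emeasure q B)"
      by (simp add: emeasure_eq_measure)
    also have "\<dots> = emeasure q (\<Union>B\<in>D. B)"
      using that sq by (intro sum_emeasure) (auto simp: partition_on_def disjoint_def disjoint_family_on_def)
    finally show ?thesis using that by (simp add: partition_on_def)
  qed
  have "{A} - {{}} \<in> {D. finite D \<and> D \<subseteq> sets M \<and> partition_on A D}"
    using A by (auto simp: partition_on_def disjoint_def)
  then have "{D. finite D \<and> D \<subseteq> sets M \<and> partition_on A D} \<noteq> {}" by blast
  moreover have "total_variation M (measure q) A =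
      (SUP D \<in> {D. finite D \<and> D \<subseteq> sets M \<and> partition_on A D}. emeasure q A)"
    unfolding total_variation_def by (rule SUP_cong[OF refl]) (rule eq, auto)
  ultimately show ?thesis by simp
qed

subsection \<open>Quasi sure suprema and supports\<close>

lemma SUP_ennreal_eq_0_iff: "(SUP i\<in>I. f i :: ennreal) = 0 \<longleftrightarrow> (\<forall>i\<in>I. f i = 0)"
  by (simp flip: bot_ennreal)

lemma upper_prob_eq_0_iff: "upper_prob P A = 0 \<longleftrightarrow> (\<forall>p\<in>P. emeasure p A = 0)"
  by (simp add: upper_prob_def SUP_ennreal_eq_0_iff)

lemma sets_prob_algebraD: "p \<in> space (prob_algebra M) \<Longrightarrow> sets p = sets M"
  and prob_space_prob_algebraD: "p \<in> space (prob_algebra M) \<Longrightarrow> prob_space p"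
  by (simp_all add: space_prob_algebra)

lemma space_prob_algebraD: "p \<in> space (prob_algebra M) \<Longrightarrow> space p = space M"
  by (rule sets_eq_imp_space_eq[OF sets_prob_algebraD])

lemma dominated_measure_iff:
  assumes "P \<subseteq> space (prob_algebra M)" "Q \<subseteq> space (prob_algebra M)"
  shows "dominated M (measure ` Q) (measure ` P) \<longleftrightarrow>
    (\<forall>N\<in>sets M. (\<forall>p\<in>P. emeasure p N = 0) \<longrightarrow> (\<forall>q\<in>Q. emeasure q N = 0))"
  unfolding dominated_def SUP_ennreal_eq_0_iff ball_simps
  using assms by (auto simp: total_variation_measure subset_iff)

locale supported_alt =
  fixes M :: "'a measure" and P Q :: "'a measure set"
  assumes P: "P \<subseteq> space (prob_algebra M)" and Q: "disjoint_supported_alternative M P Q"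
begin

lemma Q_prob: "Q \<subseteq> space (prob_algebra M)"
  using Q by (simp add: disjoint_supported_alternative_def supported_alternative_def)

lemma null_iff:
  assumes "N \<in> sets M"
  shows "upper_prob P N = 0 \<longleftrightarrow> (\<forall>q\<in>Q. emeasure q N = 0)"
  using Q assms unfolding disjoint_supported_alternative_def supported_alternative_def equiv_measures_def
    dominated_measure_iff[OF P Q_prob] dominated_measure_iff[OF Q_prob P] upper_prob_eq_0_iff
  by blast

text \<open>The choice is harmless: disjointness is demanded of all pairs of supports.\<close>

definition supp :: "'a measure \<Rightarrow> 'a set" where
  "supp q = (SOME S. is_support M P (emeasure q) S)"

lemma is_support_supp:
  assumes q: "q \<in> Q"
  shows "is_support M P (emeasure q) (supp q)"
proof -
  have "measure q \<in> sca_c M P"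
    using q Q by (auto simp: disjoint_supported_alternative_def supported_alternative_def)
  then obtain S where "is_support M P (total_variation M (measure q)) S"
    by (auto simp: sca_c_def)
  then have "is_support M P (emeasure q) S"
    using total_variation_measure[of q M] q Q_prob by (auto simp: is_support_def)
  then show ?thesis
    unfolding supp_def by (rule someI)
qed

lemma supp_sets: "q \<in> Q \<Longrightarrow> supp q \<in> sets M"
  and supp_compl: "q \<in> Q \<Longrightarrow> emeasure q (space M - supp q) = 0"
  and supp_null: "q \<in> Q \<Longrightarrow> N \<in> sets M \<Longrightarrow> emeasure q (N \<inter> supp q) = 0 \<Longrightarrow> upper_prob P (N \<inter> supp q) = 0"
  using is_support_supp[of q] by (simp_all add: is_support_def)

end

lemma qsI: "A \<in> sets M \<Longrightarrow> upper_prob P A = 0 \<Longrightarrow> (\<And>\<omega>. \<omega> \<in> space M \<Longrightarrow> \<omega> \<notin> A \<Longrightarrow> \<phi> \<omega>) \<Longrightarrow> qs M P \<phi>"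
  unfolding qs_def by blast

lemma qs_everywhere: "(\<And>\<omega>. \<omega> \<in> space M \<Longrightarrow> \<phi> \<omega>) \<Longrightarrow> qs M P \<phi>"
  by (rule qsI[of "{}"]) (auto simp: upper_prob_eq_0_iff)

lemma qs_mono: "qs M P \<phi> \<Longrightarrow> (\<And>\<omega>. \<omega> \<in> space M \<Longrightarrow> \<phi> \<omega> \<Longrightarrow> \<psi> \<omega>) \<Longrightarrow> qs M P \<psi>"
  unfolding qs_def by blast

lemma qs_conj:
  assumes sets: "\<And>p. p \<in> P \<Longrightarrow> sets p = sets M" and "qs M P \<phi>" "qs M P \<psi>"
  shows "qs M P (\<lambda>\<omega>. \<phi> \<omega> \<and> \<psi> \<omega>)"
proof -
  obtain A B where A: "A \<in> sets M" "upper_prob P A = 0" "\<And>\<omega>. \<omega> \<in> space M \<Longrightarrow> \<omega> \<notin> A \<Longrightarrow> \<phi> \<omega>"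
    and B: "B \<in> sets M" "upper_prob P B = 0" "\<And>\<omega>. \<omega> \<in> space M \<Longrightarrow> \<omega> \<notin> B \<Longrightarrow> \<psi> \<omega>"
    using assms(2,3) unfolding qs_def by blast
  show ?thesis
  proof (rule qsI[of "A \<union> B"])
    show "upper_prob P (A \<union> B) = 0"
      unfolding upper_prob_eq_0_iff
    proof
      fix p assume p: "p \<in> P"
      have "A \<in> null_sets p" "B \<in> null_sets p"
        using A B p sets by (auto simp: null_sets_def upper_prob_eq_0_iff)
      then have "A \<union> B \<in> null_sets p" by (rule null_sets.Un)
      then show "emeasure p (A \<union> B) = 0" by auto
    qed
  qed (use A B in auto)
qed

text \<open>Interpreted with \<open>M\<close> and \<open>P\<close> to read off the disjointness of
  supports, and with the universal completion and the extended measures to take suprema.\<close>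

locale prob_family =
  fixes M :: "'a measure" and P :: "'a measure set"
  assumes P: "P \<subseteq> space (prob_algebra M)"
begin

lemma qs_conjI: "qs M P \<phi> \<Longrightarrow> qs M P \<psi> \<Longrightarrow> qs M P (\<lambda>\<omega>. \<phi> \<omega> \<and> \<psi> \<omega>)"
  using P by (intro qs_conj) (auto dest: sets_prob_algebraD)

lemma qs_mp: "qs M P \<phi> \<Longrightarrow> qs M P \<psi> \<Longrightarrow> (\<And>\<omega>. \<omega> \<in> space M \<Longrightarrow> \<phi> \<omega> \<Longrightarrow> \<psi> \<omega> \<Longrightarrow> \<theta> \<omega>) \<Longrightarrow> qs M P \<theta>"
  by (rule qs_mono[OF qs_conjI[of \<phi> \<psi>]]) auto

abbreviation "\<B> \<equiv> qs_bounded_funs M P"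

lemma equiv_qs_eq_rel: "equiv \<B> (qs_eq_rel M P)"
proof (rule equivI)
  show "qs_eq_rel M P \<subseteq> \<B> \<times> \<B>" by (auto simp: qs_eq_rel_def)
  show "refl_on \<B> (qs_eq_rel M P)"
    by (auto simp: refl_on_def qs_eq_rel_def intro: qs_everywhere)
  show "sym (qs_eq_rel M P)"
    by (auto simp: sym_def qs_eq_rel_def eq_commute)
  show "trans (qs_eq_rel M P)"
  proof (rule transI, unfold qs_eq_rel_def, safe)
    fix f g h assume "qs M P (\<lambda>\<omega>. f \<omega> = g \<omega>)" "qs M P (\<lambda>\<omega>. g \<omega> = h \<omega>)"
    then show "qs M P (\<lambda>\<omega>. f \<omega> = h \<omega>)" by (rule qs_mp) simp
  qed
qed

lemma qs_class_self: "f \<in> \<B> \<Longrightarrow> f \<in> qs_class M P f"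
  unfolding qs_class_def by (rule equiv_class_self[OF equiv_qs_eq_rel])

lemma qs_class_carrier: "f \<in> \<B> \<Longrightarrow> qs_class M P f \<in> carrier (Linf M P)"
  by (simp add: Linf_def qs_class_def quotientI)

lemma carrier_Linf_cases:
  assumes "X \<in> carrier (Linf M P)"
  obtains f where "f \<in> \<B>" "X = qs_class M P f"
  using assms by (auto simp: Linf_def qs_class_def elim: quotientE)

lemma le_qs_class_iff:
  assumes "f \<in> \<B>" "g \<in> \<B>"
  shows "qs_class M P f \<sqsubseteq>\<^bsub>Linf M P\<^esub> qs_class M P g \<longleftrightarrow> qs M P (\<lambda>\<omega>. f \<omega> \<le> g \<omega>)"
proof
  assume "qs_class M P f \<sqsubseteq>\<^bsub>Linf M P\<^esub> qs_class M P g"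
  then obtain f' g' where f': "qs M P (\<lambda>\<omega>. f \<omega> = f' \<omega>)" and g': "qs M P (\<lambda>\<omega>. g \<omega> = g' \<omega>)"
    and le: "qs M P (\<lambda>\<omega>. f' \<omega> \<le> g' \<omega>)"
    by (auto simp: Linf_def qs_class_def qs_eq_rel_def)
  show "qs M P (\<lambda>\<omega>. f \<omega> \<le> g \<omega>)"
    by (rule qs_mp[OF qs_conjI[OF f' g'] le]) auto
next
  assume "qs M P (\<lambda>\<omega>. f \<omega> \<le> g \<omega>)"
  then show "qs_class M P f \<sqsubseteq>\<^bsub>Linf M P\<^esub> qs_class M P g"
    using qs_class_self[OF assms(1)] qs_class_self[OF assms(2)] by (auto simp: Linf_def)
qed

lemma indicator_bounded: "A \<in> sets M \<Longrightarrow> indicator A \<in> \<B>"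
  unfolding qs_bounded_funs_def by (auto intro!: exI[of _ 1] qs_everywhere split: split_indicator)

lemma const_bounded: "(\<lambda>_. c) \<in> \<B>"
  unfolding qs_bounded_funs_def by (auto intro!: exI[of _ "\<bar>c\<bar>"] qs_everywhere)

text \<open>Passes from classes to representatives once and for all; below, suprema are functions
  compared quasi surely.\<close>

lemma dedekind_complete_sup:
  assumes dc: "dedekind_complete (Linf M P)"
    and F: "F \<subseteq> \<B>" "F \<noteq> {}" and b: "b \<in> \<B>" "\<And>f. f \<in> F \<Longrightarrow> qs M P (\<lambda>\<omega>. f \<omega> \<le> b \<omega>)"
  obtains h where "h \<in> \<B>" "\<And>f. f \<in> F \<Longrightarrow> qs M P (\<lambda>\<omega>. f \<omega> \<le> h \<omega>)"
    "\<And>g. g \<in> \<B> \<Longrightarrow> (\<And>f. f \<in> F \<Longrightarrow> qs M P (\<lambda>\<omega>. f \<omega> \<le> g \<omega>)) \<Longrightarrow> qs M P (\<lambda>\<omega>. h \<omega> \<le> g \<omega>)"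
proof -
  let ?L = "Linf M P" and ?A = "qs_class M P ` F"
  have A: "?A \<subseteq> carrier ?L" using F qs_class_carrier by blast
  have upper: "qs_class M P g \<in> Upper ?L ?A \<longleftrightarrow> (\<forall>f\<in>F. qs M P (\<lambda>\<omega>. f \<omega> \<le> g \<omega>))" if g: "g \<in> \<B>" for g
  proof -
    have "qs_class M P g \<in> Upper ?L ?A \<longleftrightarrow> (\<forall>f\<in>F. qs_class M P f \<sqsubseteq>\<^bsub>?L\<^esub> qs_class M P g)"
      using A qs_class_carrier[OF g] unfolding Upper_def by blast
    also have "\<dots> \<longleftrightarrow> (\<forall>f\<in>F. qs M P (\<lambda>\<omega>. f \<omega> \<le> g \<omega>))"
      using F g le_qs_class_iff by (intro ball_cong) auto
    finally show ?thesis .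
  qed
  have "qs_class M P b \<in> Upper ?L ?A" using upper[OF b(1)] b(2) by simp
  then have "Upper ?L ?A \<noteq> {}" by blast
  then obtain s where s: "least ?L s (Upper ?L ?A)"
    using dc A F(2) unfolding dedekind_complete_def by (metis image_is_empty)
  then have sU: "s \<in> Upper ?L ?A" by (simp add: least_def)
  then have "s \<in> carrier ?L" by (simp add: Upper_def)
  then obtain h where h: "h \<in> \<B>" "s = qs_class M P h" by (rule carrier_Linf_cases)
  show ?thesis
  proof (rule that[OF h(1)])
    show "qs M P (\<lambda>\<omega>. f \<omega> \<le> h \<omega>)" if f: "f \<in> F" for f
      using sU[unfolded h(2) upper[OF h(1)]] f by (rule bspec)
    fix g assume g: "g \<in> \<B>" "\<And>f. f \<in> F \<Longrightarrow> qs M P (\<lambda>\<omega>. f \<omega> \<le> g \<omega>)"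
    then have "qs_class M P g \<in> Upper ?L ?A" using upper[OF g(1)] by simp
    then have "s \<sqsubseteq>\<^bsub>?L\<^esub> qs_class M P g"
      using s unfolding least_def by blast
    then show "qs M P (\<lambda>\<omega>. h \<omega> \<le> g \<omega>)"
      using le_qs_class_iff[OF h(1) g(1)] h(2) by simp
  qed
qed

text \<open>The indicator of the intersection is a lower bound of both indicators, hence at most the
  class of 0.\<close>

lemma inf_indicators_eq_0_imp_null:
  assumes S: "S \<in> sets M" "S' \<in> sets M"
    and inf: "greatest (Linf M P) (qs_class M P (\<lambda>_. 0))
      (Lower (Linf M P) {qs_class M P (indicator S), qs_class M P (indicator S')})"
  shows "upper_prob P (S \<inter> S') = 0"
proof -
  let ?L = "Linf M P" and ?c = "qs_class M P"
  have b: "indicator S \<in> \<B>" "indicator S' \<in> \<B>" "indicator (S \<inter> S') \<in> \<B>"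
    using S by (auto intro!: indicator_bounded)
  have "?c (indicator (S \<inter> S')) \<sqsubseteq>\<^bsub>?L\<^esub> ?c (indicator S)" "?c (indicator (S \<inter> S')) \<sqsubseteq>\<^bsub>?L\<^esub> ?c (indicator S')"
    using b by (auto simp: le_qs_class_iff indicator_def intro!: qs_everywhere)
  then have "?c (indicator (S \<inter> S')) \<in> Lower ?L {?c (indicator S), ?c (indicator S')}"
    using b by (auto simp: Lower_def qs_class_carrier)
  then have "?c (indicator (S \<inter> S')) \<sqsubseteq>\<^bsub>?L\<^esub> ?c (\<lambda>_. 0)"
    using inf by (auto simp: greatest_def)
  then have "qs M P (\<lambda>\<omega>. indicator (S \<inter> S') \<omega> \<le> (0::real))"
    using b const_bounded by (simp add: le_qs_class_iff)
  then obtain A where A: "A \<in> sets M" "upper_prob P A = 0"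
      "\<And>\<omega>. \<omega> \<in> space M \<Longrightarrow> \<omega> \<notin> A \<Longrightarrow> indicator (S \<inter> S') \<omega> \<le> (0::real)"
    unfolding qs_def by blast
  have "S \<inter> S' \<subseteq> A"
    using A(3) sets.sets_into_space[OF S(1)] by (fastforce simp: indicator_def split: if_splits)
  moreover have "sets p = sets M" if "p \<in> P" for p using that P sets_prob_algebraD by blast
  ultimately show ?thesis
    using A(1,2) S unfolding upper_prob_eq_0_iff
    by (metis emeasure_mono le_zero_eq)
qed

end

lemma (in supported_alt) supp_disjoint:
  assumes "q \<in> Q" "q' \<in> Q" "q \<noteq> q'"
  shows "upper_prob P (supp q \<inter> supp q') = 0"
proof -
  interpret prob_family M P using P by unfold_locales
  show ?thesis
    using assms Q is_support_supp unfolding disjoint_supported_alternative_def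
    by (intro inf_indicators_eq_0_imp_null supp_sets) auto
qed

subsection \<open>Selectors on the universal completion\<close>

lemma sets_subset_univ_completion:
  assumes "p \<in> space (prob_algebra M)"
  shows "sets M \<subseteq> sets (univ_completion M)"
  by (auto simp: sets_univ_completion[OF assms] univ_sets_def)

lemma sets_univ_completion_subset:
  assumes p: "p \<in> space (prob_algebra M)"
  shows "sets (univ_completion M) \<subseteq> sets (completion p)"
proof -
  have "neglig M p \<subseteq> sets (completion p)"
  proof
    fix A assume "A \<in> neglig M p"
    then obtain N where "N \<in> null_sets p" "A \<subseteq> N"
      using sets_prob_algebraD[OF p] by (auto simp: neglig_def null_sets_def)
    then show "A \<in> sets (completion p)"
      using sets_completionI_sub by blast
  qed
  moreover have "sets M \<subseteq> sets (completion p)"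
    using sets_prob_algebraD[OF p] by auto
  ultimately have "sigma_sets (space M) (sets M \<union> neglig M p) \<subseteq> sets (completion p)"
    using sets.sigma_sets_subset[of "sets M \<union> neglig M p" "completion p"] space_prob_algebraD[OF p]
    by simp
  then show ?thesis
    using p by (auto simp: sets_univ_completion[OF p] univ_sets_def)
qed

lemma univ_extension:
  assumes "p \<in> space (prob_algebra M)"
  shows "univ_extension M p \<in> space (prob_algebra (univ_completion M))"
    and "A \<in> sets M \<Longrightarrow> emeasure (univ_extension M p) A = emeasure p A"
  using theI'[OF univ_extension_ex1[OF assms]] unfolding univ_extension_def by blast+

lemma univ_completion_sandwich:
  assumes p: "p \<in> space (prob_algebra M)" and A: "A \<in> sets (univ_completion M)"
  obtains S N where "S \<in> sets M" "S \<subseteq> A" "N \<in> null_sets p" "A \<subseteq> S \<union> N"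
proof -
  have "A \<in> sets (completion p)"
    using sets_univ_completion_subset[OF p] A by blast
  then obtain S N N' where "A = S \<union> N" "N \<subseteq> N'" "N' \<in> null_sets p" "S \<in> sets p"
    by (rule sets_completionE)
  then show thesis
    using that[of S N'] sets_prob_algebraD[OF p] by auto
qed

text \<open>Trades the definite description of the extension for the completion, whose null sets are
  just the subsets of null sets of \<open>p\<close>.\<close>

lemma null_sets_univ_extension_iff:
  assumes p: "p \<in> space (prob_algebra M)" and A: "A \<in> sets (univ_completion M)"
  shows "emeasure (univ_extension M p) A = 0 \<longleftrightarrow> A \<in> null_sets (completion p)"
proof -
  let ?r = "univ_extension M p"
  note sp = sets_prob_algebraD[OF p] and sr = sets_prob_algebraD[OF univ_extension(1)[OF p]]
  note MH = sets_subset_univ_completion[OF p]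
  show ?thesis
  proof
    assume 0: "emeasure ?r A = 0"
    obtain S N where S: "S \<in> sets M" "S \<subseteq> A" "N \<in> null_sets p" "A \<subseteq> S \<union> N"
      using univ_completion_sandwich[OF p A] .
    have "emeasure ?r S \<le> emeasure ?r A"
      using S A sr by (intro emeasure_mono) auto
    then have "emeasure p S = 0"
      using 0 univ_extension(2)[OF p S(1)] by simp
    then have "S \<in> null_sets p" using S(1) sp by auto
    then have "S \<union> N \<in> null_sets p" using S(3) by (rule null_sets.Un)
    then show "A \<in> null_sets (completion p)"
      using S(4) unfolding null_sets_completion_iff2 by blast
  next
    assume "A \<in> null_sets (completion p)"
    then obtain N where N: "N \<in> null_sets p" "A \<subseteq> N"
      unfolding null_sets_completion_iff2 by blast
    have NM: "N \<in> sets M" using N sp by auto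
    have "emeasure ?r A \<le> emeasure ?r N"
      using N(2) NM MH sr by (intro emeasure_mono) auto
    also have "\<dots> = 0" using univ_extension(2)[OF p NM] N by auto
    finally show "emeasure ?r A = 0" by simp
  qed
qed

text \<open>Domination on \<open>sets M\<close> extends to universally measurable sets. The inner
  set S is chosen for \<open>p\<close> alone; as a subset of A it is null for every q, and so for
  \<open>p\<close> by domination, while the remainder of A is null for \<open>p\<close> by the
  choice of S.\<close>

lemma null_sets_completion_transfer:
  assumes p: "p \<in> space (prob_algebra M)" and Q: "Q \<subseteq> space (prob_algebra M)"
    and ac: "\<And>N. N \<in> sets M \<Longrightarrow> (\<And>q. q \<in> Q \<Longrightarrow> emeasure q N = 0) \<Longrightarrow> emeasure p N = 0"
    and A: "A \<in> sets (univ_completion M)" and null: "\<And>q. q \<in> Q \<Longrightarrow> A \<in> null_sets (completion q)"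
  shows "A \<in> null_sets (completion p)"
proof -
  obtain S N where S: "S \<in> sets M" "S \<subseteq> A" "N \<in> null_sets p" "A \<subseteq> S \<union> N"
    using univ_completion_sandwich[OF p A] .
  have "emeasure q S = 0" if q: "q \<in> Q" for q
  proof -
    obtain N' where "N' \<in> null_sets q" "A \<subseteq> N'"
      using null[OF q] unfolding null_sets_completion_iff2 by blast
    moreover have "S \<in> sets q"
      using S(1) sets_prob_algebraD[of q M] q Q by auto
    ultimately have "S \<in> null_sets q"
      using S(2) null_sets_subset[of N' q S] by blast
    then show ?thesis by auto
  qed
  then have "S \<in> null_sets p"
    using ac[OF S(1)] S(1) sets_prob_algebraD[OF p] by auto
  then have "S \<union> N \<in> null_sets p" using S(3) by (rule null_sets.Un)
  then show ?thesis
    using S(4) unfolding null_sets_completion_iff2 by blast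
qed

context supported_alt
begin

lemma univ_null_iff:
  assumes A: "A \<in> sets (univ_completion M)"
  shows "upper_prob (univ_extension M ` P) A = 0 \<longleftrightarrow> (\<forall>q\<in>Q. A \<in> null_sets (completion q))"
proof -
  have "upper_prob (univ_extension M ` P) A = 0 \<longleftrightarrow> (\<forall>p\<in>P. A \<in> null_sets (completion p))"
    unfolding upper_prob_eq_0_iff using P null_sets_univ_extension_iff[OF _ A] by auto
  also have "\<dots> \<longleftrightarrow> (\<forall>q\<in>Q. A \<in> null_sets (completion q))"
  proof (intro iffI ballI)
    fix q assume null: "\<forall>p\<in>P. A \<in> null_sets (completion p)" and q: "q \<in> Q"
    show "A \<in> null_sets (completion q)"
    proof (rule null_sets_completion_transfer[OF _ P _ A])
      fix N assume "N \<in> sets M" "\<And>p. p \<in> P \<Longrightarrow> emeasure p N = 0"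
      then show "emeasure q N = 0" using null_iff[of N] q by (simp add: upper_prob_eq_0_iff)
    qed (use null q Q_prob in auto)
  next
    fix p assume null: "\<forall>q\<in>Q. A \<in> null_sets (completion q)" and p: "p \<in> P"
    show "A \<in> null_sets (completion p)"
    proof (rule null_sets_completion_transfer[OF _ Q_prob _ A])
      fix N assume "N \<in> sets M" "\<And>q. q \<in> Q \<Longrightarrow> emeasure q N = 0"
      then show "emeasure p N = 0" using null_iff[of N] p by (simp add: upper_prob_eq_0_iff)
    qed (use null p P in auto)
  qed
  finally show ?thesis .
qed

text \<open>The set is the one where the supremum h of the support indicators is positive. It
  contains each S(q), q in J, up to null sets because h is an upper bound. It misses S(q) for the
  other q because setting h to 0 on S(q) gives, by disjointness, another upper bound, and h lies
  below it.\<close>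

lemma selector_exists:
  assumes ne: "P \<noteq> {}" and dc: "dedekind_complete (Linf (univ_completion M) (univ_extension M ` P))"
    and J: "J \<subseteq> Q"
  shows "\<exists>A\<in>sets (univ_completion M). (\<forall>q\<in>J. space M - A \<in> null_sets (completion q)) \<and>
    (\<forall>q\<in>Q - J. A \<in> null_sets (completion q))"
proof (cases "J = {}")
  \<comment> \<open>Completeness speaks of nonempty families, so J = {} is served directly by the
    empty set.\<close>
  case True
  then show ?thesis by (intro bexI[of _ "{}"]) auto
next
  case False
  let ?H = "univ_completion M" and ?P = "univ_extension M ` P"
  interpret H: prob_family ?H ?P
    using P univ_extension(1) by unfold_locales blast
  have MH: "sets M \<subseteq> sets ?H"
    using P ne sets_subset_univ_completion by blast
  have suppH: "supp q \<in> sets ?H" if "q \<in> Q" for q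
    using supp_sets[OF that] MH by blast
  have supp_null': "space M - supp q \<in> null_sets (completion q)" if "q \<in> Q" for q
  proof -
    have "space M - supp q \<in> null_sets q"
      using supp_sets[OF that] supp_compl[OF that] sets_prob_algebraD[of q M] Q_prob that
      by (auto simp: null_sets_def)
    then show ?thesis by (rule null_sets_completionI)
  qed
  have disj_null: "upper_prob ?P (supp q \<inter> supp q') = 0" if "q \<in> Q" "q' \<in> Q" "q \<noteq> q'" for q q'
  proof -
    have "supp q \<inter> supp q' \<in> sets M" using supp_sets that by auto
    then have "emeasure (univ_extension M p) (supp q \<inter> supp q') = 0" if "p \<in> P" for p
      using that P supp_disjoint[OF \<open>q \<in> Q\<close> \<open>q' \<in> Q\<close> \<open>q \<noteq> q'\<close>] univ_extension(2)[of p M]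
      by (auto simp: upper_prob_eq_0_iff)
    then show ?thesis by (auto simp: upper_prob_eq_0_iff)
  qed
  let ?F = "(\<lambda>q. indicator (supp q) :: 'a \<Rightarrow> real) ` J"
  have F: "?F \<subseteq> H.\<B>" "?F \<noteq> {}"
    using J suppH H.indicator_bounded False by auto
  have F1: "qs ?H ?P (\<lambda>\<omega>. f \<omega> \<le> 1)" if "f \<in> ?F" for f
    using that by (intro qs_everywhere) (auto simp: indicator_le_1)
  obtain h where h: "h \<in> H.\<B>"
    and upperF: "\<And>f. f \<in> ?F \<Longrightarrow> qs ?H ?P (\<lambda>\<omega>. f \<omega> \<le> h \<omega>)"
    and leastF: "\<And>g. g \<in> H.\<B> \<Longrightarrow> (\<And>f. f \<in> ?F \<Longrightarrow> qs ?H ?P (\<lambda>\<omega>. f \<omega> \<le> g \<omega>)) \<Longrightarrow>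
      qs ?H ?P (\<lambda>\<omega>. h \<omega> \<le> g \<omega>)"
  proof (rule H.dedekind_complete_sup[OF dc F H.const_bounded F1])
    fix h assume "h \<in> H.\<B>" "\<And>f. f \<in> ?F \<Longrightarrow> qs ?H ?P (\<lambda>\<omega>. f \<omega> \<le> h \<omega>)"
      "\<And>g. g \<in> H.\<B> \<Longrightarrow> (\<And>f. f \<in> ?F \<Longrightarrow> qs ?H ?P (\<lambda>\<omega>. f \<omega> \<le> g \<omega>)) \<Longrightarrow>
        qs ?H ?P (\<lambda>\<omega>. h \<omega> \<le> g \<omega>)"
    then show thesis by (rule that)
  qed
  have upper: "qs ?H ?P (\<lambda>\<omega>. indicator (supp q) \<omega> \<le> h \<omega>)" if "q \<in> J" for q
    using upperF[OF imageI[OF that]] .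
  have least: "qs ?H ?P (\<lambda>\<omega>. h \<omega> \<le> g \<omega>)"
    if "g \<in> H.\<B>" "\<And>q. q \<in> J \<Longrightarrow> qs ?H ?P (\<lambda>\<omega>. indicator (supp q) \<omega> \<le> g \<omega>)" for g
    by (rule leastF[OF that(1)]) (use that(2) in auto)
  have hm: "h \<in> borel_measurable ?H" using h by (simp add: qs_bounded_funs_def)
  define A where "A = {\<omega> \<in> space M. h \<omega> > 0}"
  have AH: "A \<in> sets ?H"
    using borel_measurable_less[OF borel_measurable_const[of 0] hm] by (simp add: A_def)
  show ?thesis
  proof (intro bexI[OF _ AH] conjI ballI)
    fix q assume q: "q \<in> J"
    then have qQ: "q \<in> Q" using J by blast
    obtain N where N: "N \<in> sets ?H" "upper_prob ?P N = 0"
      "\<And>\<omega>. \<omega> \<in> space M \<Longrightarrow> \<omega> \<notin> N \<Longrightarrow> indicator (supp q) \<omega> \<le> h \<omega>"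
      using upper[OF q] unfolding qs_def by auto
    have "N \<union> (space M - supp q) \<in> null_sets (completion q)"
      using N univ_null_iff[OF N(1)] qQ supp_null'[OF qQ] by auto
    moreover have "space M - A \<subseteq> N \<union> (space M - supp q)"
    proof
      fix \<omega> assume \<omega>: "\<omega> \<in> space M - A"
      show "\<omega> \<in> N \<union> (space M - supp q)"
      proof (rule ccontr)
        assume "\<omega> \<notin> N \<union> (space M - supp q)"
        then have "1 \<le> h \<omega>" using N(3)[of \<omega>] \<omega> by auto
        then show False using \<omega> by (auto simp: A_def)
      qed
    qed
    ultimately show "space M - A \<in> null_sets (completion q)"
      using null_sets_completion_subset by blast
  next
    fix q assume q: "q \<in> Q - J"
    then have qQ: "q \<in> Q" by blast
    \<comment> \<open>Still an upper bound for the indicators indexed by J, since on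
      \<open>supp q\<close> these vanish up to null overlaps.\<close>
    define g where "g \<omega> = h \<omega> * indicator (space M - supp q) \<omega>" for \<omega>
    have "g \<in> H.\<B>"
    proof -
      obtain B where "qs ?H ?P (\<lambda>\<omega>. \<bar>h \<omega>\<bar> \<le> B)" using h by (auto simp: qs_bounded_funs_def)
      then have "qs ?H ?P (\<lambda>\<omega>. \<bar>g \<omega>\<bar> \<le> \<bar>B\<bar>)"
        by (rule qs_mono) (auto simp: g_def indicator_def)
      moreover have "space M - supp q \<in> sets ?H"
        using suppH[OF qQ] sets.compl_sets[of "supp q" ?H] by simp
      then have "g \<in> borel_measurable ?H"
        unfolding g_def by (intro borel_measurable_times hm borel_measurable_indicator)
      ultimately show ?thesis by (auto simp: qs_bounded_funs_def)
    qed
    moreover have "qs ?H ?P (\<lambda>\<omega>. indicator (supp q') \<omega> \<le> g \<omega>)" if q': "q' \<in> J" for q'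
    proof -
      have *: "q' \<in> Q" "q \<noteq> q'" using q q' J by auto
      have "qs ?H ?P (\<lambda>\<omega>. \<omega> \<notin> supp q \<inter> supp q')"
        using disj_null[OF qQ *] suppH[OF qQ] suppH[OF *(1)]
        by (intro qsI[of "supp q \<inter> supp q'"]) auto
      then show ?thesis
      proof (rule H.qs_mp[OF _ upper[OF q']])
        fix \<omega> assume "\<omega> \<in> space ?H" "\<omega> \<notin> supp q \<inter> supp q'" "indicator (supp q') \<omega> \<le> h \<omega>"
        then show "indicator (supp q') \<omega> \<le> g \<omega>"
          by (cases "\<omega> \<in> supp q"; cases "\<omega> \<in> supp q'") (auto simp: g_def)
      qed
    qed
    ultimately have "qs ?H ?P (\<lambda>\<omega>. h \<omega> \<le> g \<omega>)" by (rule least)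
    then obtain N where N: "N \<in> sets ?H" "upper_prob ?P N = 0"
      "\<And>\<omega>. \<omega> \<in> space M \<Longrightarrow> \<omega> \<notin> N \<Longrightarrow> h \<omega> \<le> g \<omega>"
      unfolding qs_def by auto
    have "N \<union> (space M - supp q) \<in> null_sets (completion q)"
      using N univ_null_iff[OF N(1)] qQ supp_null'[OF qQ] by auto
    moreover have "A \<subseteq> N \<union> (space M - supp q)"
    proof
      fix \<omega> assume \<omega>: "\<omega> \<in> A"
      show "\<omega> \<in> N \<union> (space M - supp q)"
      proof (rule ccontr)
        assume "\<omega> \<notin> N \<union> (space M - supp q)"
        then have "h \<omega> \<le> g \<omega>" "g \<omega> = 0" using N(3)[of \<omega>] \<omega> by (auto simp: A_def g_def)
        then show False using \<omega> by (auto simp: A_def)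
      qed
    qed
    ultimately show "A \<in> null_sets (completion q)"
      using null_sets_completion_subset by blast
  qed
qed

theorem countably_many_supports_carry:
  assumes CH: "continuum_hypothesis" and ne: "P \<noteq> {}"
    and dc: "dedekind_complete (Linf (univ_completion M) (univ_extension M ` P))"
    and card: "Q \<lesssim> (UNIV :: nat set set)"
    and \<mu>: "\<mu> \<in> space (prob_algebra M)"
    and ac: "\<And>N. N \<in> sets M \<Longrightarrow> upper_prob P N = 0 \<Longrightarrow> emeasure \<mu> N = 0"
  obtains C where "countable C" "C \<subseteq> Q" "emeasure \<mu> (space M - (\<Union>q\<in>C. supp q)) = 0"
proof -
  let ?H = "univ_completion M" and ?m = "completion \<mu>"
  have "\<exists>A. J \<subseteq> Q \<longrightarrow> A \<in> sets ?H \<and> (\<forall>q\<in>J. space M - A \<in> null_sets (completion q)) \<and>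
      (\<forall>q\<in>Q - J. A \<in> null_sets (completion q))" for J
  proof (cases "J \<subseteq> Q")
    case True
    obtain A where "A \<in> sets ?H" "\<forall>q\<in>J. space M - A \<in> null_sets (completion q)"
      "\<forall>q\<in>Q - J. A \<in> null_sets (completion q)"
      by (rule bexE[OF selector_exists[OF ne dc True]], elim conjE)
    then show ?thesis by (intro exI impI conjI)
  qed simp
  from choice[OF allI[OF this]] obtain A where AJ: "\<forall>J. J \<subseteq> Q \<longrightarrow> A J \<in> sets ?H \<and>
      (\<forall>q\<in>J. space M - A J \<in> null_sets (completion q)) \<and> (\<forall>q\<in>Q - J. A J \<in> null_sets (completion q))"
    by (rule exE)
  have A: "A J \<in> sets ?H" if "J \<subseteq> Q" for J
    using AJ that by blast
  have A1: "space M - A J \<in> null_sets (completion q)" if "J \<subseteq> Q" "q \<in> J" for J q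
    using AJ that by blast
  have A0: "A J \<in> null_sets (completion q)" if "J \<subseteq> Q" "q \<in> Q" "q \<notin> J" for J q
    using AJ that by blast
  have Asp: "A J \<subseteq> space M" if "J \<subseteq> Q" for J
    using sets.sets_into_space[OF A[OF that]] by simp
  have MH: "sets M \<subseteq> sets ?H" by (rule sets_subset_univ_completion[OF \<mu>])
  have Hm: "sets ?H \<subseteq> sets ?m" by (rule sets_univ_completion_subset[OF \<mu>])
  \<comment> \<open>The criterion for all that follows: a universally measurable set that is null
    for every q is null for \<mu>.\<close>
  have null: "B \<in> null_sets ?m" if B: "B \<in> sets ?H" "\<And>q. q \<in> Q \<Longrightarrow> B \<in> null_sets (completion q)" for B
  proof (rule null_sets_completion_transfer[OF \<mu> Q_prob _ B])
    fix N assume "N \<in> sets M" "\<And>q. q \<in> Q \<Longrightarrow> emeasure q N = 0"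
    then show "emeasure \<mu> N = 0" using null_iff[of N] ac[of N] by simp
  qed
  have sub_null: "B \<in> null_sets (completion q)" if "B \<subseteq> B'" "B' \<in> null_sets (completion q)" for B B' q
    using that null_sets_completion_subset by blast
  define N where "N = measure_of Q (Pow Q) (\<lambda>J. emeasure ?m (A J))"
  have N: "space N = Q" "sets N = Pow Q"
    by (simp_all add: N_def space_measure_of_conv sigma_algebra.sigma_sets_eq[OF sigma_algebra_Pow])
  have emN: "emeasure N J = emeasure ?m (A J)" if J: "J \<subseteq> Q" for J
    unfolding N_def
  proof (rule emeasure_measure_of_sigma)
    show "positive (Pow Q) (\<lambda>J. emeasure ?m (A J))"
      using null[OF A[of "{}"]] A0[of "{}"] by (auto simp: positive_def)
    show "countably_additive (Pow Q) (\<lambda>J. emeasure ?m (A J))"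
    proof (rule countably_additiveI)
      fix J :: "nat \<Rightarrow> _" assume J: "range J \<subseteq> Pow Q" "disjoint_family J"
      then have Jn: "J n \<subseteq> Q" for n by auto
      then have UJ: "(\<Union>n. J n) \<subseteq> Q" by auto
      have Am: "A (J n) \<in> sets ?m" for n using A[OF Jn] Hm by auto
      \<comment> \<open>This fact and the next two say that A commutes with the union and preserves
        disjointness up to \<mu>-null sets. Each is checked for one q at a time, for which A J has
        full measure or measure 0 according to whether q is in J.\<close>
      have d1: "A (\<Union>n. J n) - (\<Union>n. A (J n)) \<in> null_sets ?m"
      proof (rule null)
        show "A (\<Union>n. J n) - (\<Union>n. A (J n)) \<in> sets ?H"
          using A[OF UJ] A[OF Jn] by auto
        fix q assume q: "q \<in> Q"
        show "A (\<Union>n. J n) - (\<Union>n. A (J n)) \<in> null_sets (completion q)"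
        proof (cases "\<exists>n. q \<in> J n")
          case True
          then obtain n where n: "q \<in> J n" ..
          show ?thesis
            by (rule sub_null[OF _ A1[OF Jn n]]) (use Asp[OF UJ] in auto)
        next
          case False
          then show ?thesis by (intro sub_null[OF _ A0[OF UJ q]]) auto
        qed
      qed
      have d2: "(\<Union>n. A (J n)) - A (\<Union>n. J n) \<in> null_sets ?m"
      proof (rule null)
        show "(\<Union>n. A (J n)) - A (\<Union>n. J n) \<in> sets ?H"
          using A[OF UJ] A[OF Jn] by auto
        fix q assume q: "q \<in> Q"
        show "(\<Union>n. A (J n)) - A (\<Union>n. J n) \<in> null_sets (completion q)"
        proof (cases "\<exists>n. q \<in> J n")
          case True
          then have qU: "q \<in> (\<Union>n. J n)" by auto
          show ?thesis
            by (rule sub_null[OF _ A1[OF UJ qU]]) (use Asp[OF Jn] in auto)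
        next
          case False
          then have "A (J n) \<in> null_sets (completion q)" for n
            using A0[OF Jn q] by blast
          then have "(\<Union>n. A (J n)) \<in> null_sets (completion q)"
            by (rule null_sets_UN)
          from sub_null[OF Diff_subset this] show ?thesis .
        qed
      qed
      have d3: "A (J n) \<inter> A (J m) \<in> null_sets ?m" if "m \<noteq> n" for m n
      proof (rule null)
        show "A (J n) \<inter> A (J m) \<in> sets ?H" using A[OF Jn] by auto
        fix q assume q: "q \<in> Q"
        have "q \<notin> J n \<or> q \<notin> J m" using J(2) that by (auto simp: disjoint_family_on_def)
        then show "A (J n) \<inter> A (J m) \<in> null_sets (completion q)"
          using sub_null[OF Int_lower1 A0[OF Jn q]] sub_null[OF Int_lower2 A0[OF Jn q]] by blast
      qed
      \<comment> \<open>The sets A (J n) are only almost disjoint; \<open>disjointed\<close> repairs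
        this by removing null sets.\<close>
      have dn: "emeasure ?m (disjointed (\<lambda>n. A (J n)) n) = emeasure ?m (A (J n))" for n
      proof -
        have "(\<Union>m\<in>{0..<n}. A (J n) \<inter> A (J m)) \<in> null_sets ?m"
          using d3 by (intro null_sets_UN') auto
        moreover have "disjointed (\<lambda>n. A (J n)) n = A (J n) - (\<Union>m\<in>{0..<n}. A (J n) \<inter> A (J m))"
          by (auto simp: disjointed_def)
        ultimately show ?thesis using emeasure_Diff_null_set Am by metis
      qed
      have "(\<Sum>n. emeasure ?m (A (J n))) = (\<Sum>n. emeasure ?m (disjointed (\<lambda>n. A (J n)) n))"
        by (simp add: dn)
      also have "\<dots> = emeasure ?m (\<Union>n. disjointed (\<lambda>n. A (J n)) n)"
        using Am by (intro suminf_emeasure disjoint_family_disjointed sets.range_disjointed_sets) auto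
      also have "\<dots> = emeasure ?m (\<Union>n. A (J n))"
        by (simp add: UN_disjointed_eq)
      also have "\<dots> = emeasure ?m (A (\<Union>n. J n))"
      proof (rule emeasure_eq_AE)
        show "AE x in ?m. x \<in> (\<Union>n. A (J n)) \<longleftrightarrow> x \<in> A (\<Union>n. J n)"
          using AE_not_in[OF d1] AE_not_in[OF d2] by eventually_elim blast
      qed (use Am A[OF UJ] Hm in auto)
      finally show "(\<Sum>n. emeasure ?m (A (J n))) = emeasure ?m (A (\<Union>n. J n))" .
    qed
  qed (rule sigma_algebra_Pow, rule PowI[OF J])
  interpret \<mu>: prob_space \<mu> using \<mu> by (rule prob_space_prob_algebraD)
  interpret m: prob_space ?m by (rule \<mu>.prob_space_completion)
  have "finite_measure N"
    by (rule finite_measureI) (simp add: N emN m.emeasure_eq_measure)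
  then obtain C where C: "countable C" "C \<subseteq> Q" "emeasure N (Q - C) = 0"
    using Ulam_continuum_hypothesis[OF CH, of N] N card by auto
  let ?D = "space M - (\<Union>q\<in>C. supp q)"
  have DM: "?D \<in> sets M"
    using C supp_sets by (intro sets.Diff sets.countable_UN') auto
  \<comment> \<open>For q in C the set \<open>?D\<close> avoids \<open>supp q\<close>; for q outside
    C the complement of A (Q - C) is null for q.\<close>
  have "?D - A (Q - C) \<in> null_sets ?m"
  proof (rule null)
    show "?D - A (Q - C) \<in> sets ?H" using DM MH A[of "Q - C"] by auto
    fix q assume q: "q \<in> Q"
    show "?D - A (Q - C) \<in> null_sets (completion q)"
    proof (cases "q \<in> C")
      case True
      have "space M - supp q \<in> null_sets q"
        using supp_sets[OF q] supp_compl[OF q] sets_prob_algebraD[of q M] Q_prob q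
        by (auto simp: null_sets_def)
      then have "space M - supp q \<in> null_sets (completion q)" by (rule null_sets_completionI)
      then show ?thesis by (rule sub_null[rotated]) (use True in auto)
    next
      case False
      then show ?thesis using q by (intro sub_null[OF _ A1[of "Q - C" q]]) auto
    qed
  qed
  moreover have "A (Q - C) \<in> null_sets ?m"
    using C emN[of "Q - C"] A[of "Q - C"] Hm by (auto simp: null_sets_def)
  ultimately have "(?D - A (Q - C)) \<union> A (Q - C) \<in> null_sets ?m" by (rule null_sets.Un)
  then have "?D \<in> null_sets ?m" by (rule sub_null[rotated]) auto
  then have "emeasure \<mu> ?D = 0"
    using DM sets_prob_algebraD[OF \<mu>] by (auto simp: null_sets_def)
  then show thesis using that C by blast
qed

text \<open>On \<open>supp q\<close> the measure m has a density with respect to q, because q-null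
  parts of \<open>supp q\<close> are null for \<open>P\<close> and hence for m. Where this density
  is positive, m-null sets are q-null and therefore null for \<open>P\<close>; the union of these
  parts over \<open>C\<close> is a support.\<close>

lemma is_support_of_countably_many:
  assumes fin: "finite_measure m" and sm: "sets m = sets M"
    and ac: "\<And>N. N \<in> sets M \<Longrightarrow> upper_prob P N = 0 \<Longrightarrow> emeasure m N = 0"
    and C: "countable C" "C \<subseteq> Q" and carry: "emeasure m (space M - (\<Union>q\<in>C. supp q)) = 0"
  obtains S where "is_support M P (emeasure m) S"
proof -
  have "\<exists>T\<in>sets M. T \<subseteq> supp q \<and> emeasure m (supp q - T) = 0 \<and>
      (\<forall>N\<in>sets M. emeasure m (N \<inter> T) = 0 \<longrightarrow> upper_prob P (N \<inter> T) = 0)" if q: "q \<in> Q" for q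
  proof -
    have qM: "q \<in> space (prob_algebra M)" using q Q_prob by blast
    interpret q: prob_space q using qM by (rule prob_space_prob_algebraD)
    note sq = sets_prob_algebraD[OF qM] and S = supp_sets[OF q]
    let ?mq = "density m (indicator (supp q))"
    have mq: "emeasure ?mq N = emeasure m (supp q \<inter> N)" if "N \<in> sets M" for N
      using that S sm by (intro emeasure_restricted) auto
    have "absolutely_continuous q ?mq"
      unfolding absolutely_continuous_def
    proof
      fix N assume N: "N \<in> null_sets q"
      then have NM: "N \<in> sets M" using sq by auto
      have "N \<inter> supp q \<in> null_sets q"
        using N S sq by (auto intro: null_set_Int2)
      then have "upper_prob P (N \<inter> supp q) = 0"
        using supp_null[OF q NM] by auto
      then show "N \<in> null_sets ?mq"
        using mq[OF NM] ac[of "N \<inter> supp q"] NM S sm by (auto simp: Int_commute null_sets_def)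
    qed
    moreover have "sets ?mq = sets q" using sm sq by simp
    ultimately obtain f where f: "f \<in> borel_measurable q" "density q f = ?mq"
      using q.Radon_Nikodym[of ?mq] by auto
    have em: "emeasure m (supp q \<inter> N) = (\<integral>\<^sup>+x. f x * indicator N x \<partial>q)" if "N \<in> sets M" for N
      using mq[OF that] f emeasure_density[OF f(1), of N] that sq by simp
    have fM[measurable]: "f \<in> borel_measurable M"
      using f(1) sq by (simp cong: measurable_cong_sets)
    have pos: "{x \<in> space M. f x > 0} \<in> sets M" "{x \<in> space M. f x = 0} \<in> sets M" by measurable
    show ?thesis
    proof (intro bexI conjI ballI impI)
      let ?T = "supp q \<inter> {x \<in> space M. f x > 0}"
      show "?T \<in> sets M" using S pos by auto
      show "?T \<subseteq> supp q" by auto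
      have "supp q - ?T = supp q \<inter> {x \<in> space M. f x = 0}"
        using sets.sets_into_space[OF S] by (auto simp: zero_less_iff_neq_zero)
      moreover have "(\<integral>\<^sup>+x. f x * indicator {x \<in> space M. f x = 0} x \<partial>q) = (\<integral>\<^sup>+x. 0 \<partial>q)"
        by (rule nn_integral_cong) (auto simp: indicator_def)
      ultimately show "emeasure m (supp q - ?T) = 0"
        using em[OF pos(2)] by simp
      fix N assume N: "N \<in> sets M" and 0: "emeasure m (N \<inter> ?T) = 0"
      let ?N = "N \<inter> ?T"
      have NM: "?N \<in> sets M" using N S pos by auto
      have "supp q \<inter> ?N = ?N" by auto
      then have "(\<integral>\<^sup>+x. f x * indicator ?N x \<partial>q) = 0" using em[OF NM] 0 by simp
      then have "AE x in q. f x * indicator ?N x = 0"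
        using f(1) NM sq by (subst (asm) nn_integral_0_iff_AE) auto
      then have "AE x in q. x \<notin> ?N"
        by eventually_elim (auto simp: indicator_def split: if_splits)
      then have "emeasure q ?N = 0"
        using NM sq by (subst (asm) AE_iff_measurable[of ?N])
          (auto dest: sets.sets_into_space simp: zero_less_iff_neq_zero)
      then have "upper_prob P (?N \<inter> supp q) = 0"
        using supp_null[OF q NM] by (simp add: Int_absorb2 Int_assoc Int_commute Int_left_commute)
      moreover have "?N \<inter> supp q = ?N" by auto
      ultimately show "upper_prob P ?N = 0" by simp
    qed
  qed
  then obtain T where T: "\<And>q. q \<in> Q \<Longrightarrow> T q \<in> sets M" "\<And>q. q \<in> Q \<Longrightarrow> T q \<subseteq> supp q"
      "\<And>q. q \<in> Q \<Longrightarrow> emeasure m (supp q - T q) = 0"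
      "\<And>q N. q \<in> Q \<Longrightarrow> N \<in> sets M \<Longrightarrow> emeasure m (N \<inter> T q) = 0 \<Longrightarrow> upper_prob P (N \<inter> T q) = 0"
    by metis
  let ?S = "\<Union>q\<in>C. T q"
  have SM: "?S \<in> sets M" using C T by (intro sets.countable_UN') auto
  have "is_support M P (emeasure m) ?S"
    unfolding is_support_def
  proof (intro conjI ballI impI SM)
    have "(space M - (\<Union>q\<in>C. supp q)) \<union> (\<Union>q\<in>C. supp q - T q) \<in> null_sets m"
    proof (rule null_sets.Un)
      show "space M - (\<Union>q\<in>C. supp q) \<in> null_sets m"
        using carry C supp_sets sm by (auto simp: null_sets_def intro!: sets.Diff sets.countable_UN')
      show "(\<Union>q\<in>C. supp q - T q) \<in> null_sets m"
        using C T supp_sets sm by (intro null_sets_UN') (auto simp: null_sets_def)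
    qed
    then have "space M - ?S \<in> null_sets m"
      by (rule null_sets_subset) (use SM sm in auto)
    then show "emeasure m (space M - ?S) = 0" by auto
    fix N assume N: "N \<in> sets M" and 0: "emeasure m (N \<inter> ?S) = 0"
    have "upper_prob P (N \<inter> T q) = 0" if q: "q \<in> C" for q
    proof (rule T(4))
      have "emeasure m (N \<inter> T q) \<le> emeasure m (N \<inter> ?S)"
        using q N SM sm by (intro emeasure_mono) auto
      then show "emeasure m (N \<inter> T q) = 0" using 0 by simp
    qed (use q C N in auto)
    then have "emeasure p (N \<inter> T q) = 0" if "p \<in> P" "q \<in> C" for p q
      using that by (auto simp: upper_prob_eq_0_iff)
    moreover have "sets p = sets M" if "p \<in> P" for p
      using that P sets_prob_algebraD by blast
    ultimately have "N \<inter> T q \<in> null_sets p" if "p \<in> P" "q \<in> C" for p q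
      using that C(2) T(1) N by (auto simp: null_sets_def)
    then have "(\<Union>q\<in>C. N \<inter> T q) \<in> null_sets p" if "p \<in> P" for p
      using that C(1) by (intro null_sets_UN') auto
    moreover have "N \<inter> ?S = (\<Union>q\<in>C. N \<inter> T q)" by blast
    ultimately have "emeasure p (N \<inter> ?S) = 0" if "p \<in> P" for p
      using that by (metis null_setsD1)
    then show "upper_prob P (N \<inter> ?S) = 0"
      unfolding upper_prob_eq_0_iff by blast
  qed
  then show thesis by (rule that)
qed

theorem ca_c_eq_sca_c:
  assumes CH: "continuum_hypothesis" and ne: "P \<noteq> {}"
    and dc: "dedekind_complete (Linf (univ_completion M) (univ_extension M ` P))"
    and card: "Q \<lesssim> (UNIV :: nat set set)"
  shows "ca_c M P = sca_c M P"
proof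
  show "sca_c M P \<subseteq> ca_c M P" by (auto simp: sca_c_def)
  show "ca_c M P \<subseteq> sca_c M P"
  proof
    fix \<nu> assume \<nu>: "\<nu> \<in> ca_c M P"
    then have ca: "\<nu> \<in> ca M" and dom: "dominated M {\<nu>} (measure ` P)" by (auto simp: ca_c_def)
    let ?m = "tv_measure M \<nu>"
    interpret m: finite_measure ?m using ca by (rule finite_measure_tv_measure)
    note em = emeasure_tv_measure[OF ca]
    have ac: "emeasure ?m N = 0" if N: "N \<in> sets M" "upper_prob P N = 0" for N
    proof -
      have "\<forall>p\<in>P. total_variation M (measure p) N = 0"
      proof
        fix p assume "p \<in> P"
        then show "total_variation M (measure p) N = 0"
          using N P total_variation_measure[of p M N] by (simp add: upper_prob_eq_0_iff subset_iff)
      qed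
      then have "total_variation M \<nu> N = 0"
        using dom N(1) unfolding dominated_def SUP_ennreal_eq_0_iff ball_simps by blast
      then show ?thesis using em N(1) by simp
    qed
    have "\<exists>S. is_support M P (emeasure ?m) S"
    proof (cases "emeasure ?m (space M) = 0")
      case True
      then have "is_support M P (emeasure ?m) {}"
        by (auto simp: is_support_def upper_prob_eq_0_iff)
      then show ?thesis by blast
    next
      case False
      \<comment> \<open>\<open>uniform_measure\<close> over the whole space is |\<nu>| divided by
        its total mass.\<close>
      let ?\<mu> = "uniform_measure ?m (space M)"
      have \<mu>: "?\<mu> \<in> space (prob_algebra M)"
        using False by (auto simp: space_prob_algebra intro!: prob_space_uniform_measure)
      have em\<mu>: "emeasure ?\<mu> N = emeasure ?m N / emeasure ?m (space M)" if "N \<in> sets M" for N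
        using that sets.Int_space_eq1[OF that] by simp
      obtain C where C: "countable C" "C \<subseteq> Q" "emeasure ?\<mu> (space M - (\<Union>q\<in>C. supp q)) = 0"
      proof (rule countably_many_supports_carry[OF CH ne dc card \<mu>])
        show "emeasure ?\<mu> N = 0" if "N \<in> sets M" "upper_prob P N = 0" for N
          using ac[OF that] em\<mu>[OF that(1)] by simp
      qed
      have D: "space M - (\<Union>q\<in>C. supp q) \<in> sets M"
        using C supp_sets by (intro sets.Diff sets.countable_UN') auto
      have "emeasure ?m (space M - (\<Union>q\<in>C. supp q)) = 0"
        using C(3) em\<mu>[OF D] by (simp add: ennreal_divide_eq_0_iff)
      from is_support_of_countably_many[OF m.finite_measure_axioms sets_tv_measure ac C(1,2) this]
      show ?thesis by blast
    qed
    then obtain S where "is_support M P (emeasure ?m) S" by blast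
    then have "is_support M P (total_variation M \<nu>) S"
      using em by (auto simp: is_support_def)
    then show "\<nu> \<in> sca_c M P" using \<nu> by (auto simp: sca_c_def)
  qed
qed

end

subsection \<open>Cantor schemes\<close>

lemma open_nat_fun_contains_nbhd:
  fixes U :: "(nat \<Rightarrow> nat) set"
  assumes "open U" "x \<in> U"
  obtains m where "{z. \<forall>i<m. z i = x i} \<subseteq> U"
proof -
  have "openin (product_topology (\<lambda>_. euclidean) UNIV) U"
    using assms(1) by (simp add: open_fun_def)
  then obtain V where V: "finite {i. V i \<noteq> UNIV}" "x \<in> (\<Pi>\<^sub>E i\<in>UNIV. V i)" "(\<Pi>\<^sub>E i\<in>UNIV. V i) \<subseteq> U"
    using assms(2) unfolding openin_product_topology_alt by (auto simp: Collect_conj_eq)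
  obtain m where m: "\<And>i. V i \<noteq> UNIV \<Longrightarrow> i < m"
    using finite_nat_set_iff_bounded[THEN iffD1, OF V(1)] by auto
  have sub: "{z. \<forall>i<m. z i = x i} \<subseteq> (\<Pi>\<^sub>E i\<in>UNIV. V i)"
  proof
    fix z assume z: "z \<in> {z. \<forall>i<m. z i = x i}"
    have "z i \<in> V i" for i
    proof (cases "V i = UNIV")
      case False
      then have "z i = x i" using m z by auto
      then show ?thesis using V(2) by (auto simp: PiE_def Pi_def)
    qed simp
    then show "z \<in> (\<Pi>\<^sub>E i\<in>UNIV. V i)" by auto
  qed
  show thesis by (rule that[OF subset_trans[OF sub V(3)]])
qed

abbreviation bits :: "(nat \<Rightarrow> bool) measure" where
  "bits \<equiv> Pi\<^sub>M UNIV (\<lambda>_. count_space UNIV)"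

abbreviation nats :: "(nat \<Rightarrow> nat) measure" where
  "nats \<equiv> Pi\<^sub>M UNIV (\<lambda>_. count_space UNIV)"

lemma measurable_prefix: "(\<lambda>c. map c [0..<n]) \<in> bits \<rightarrow>\<^sub>M count_space UNIV"
proof (unfold measurable_count_space_eq2_countable, safe)
  fix s :: "bool list"
  have "map c [0..<n] = s \<longleftrightarrow> length s = n \<and> (\<forall>i<n. c i = s ! i)" for c
    by (auto simp: list_eq_iff_nth_eq)
  then have "(\<lambda>c. map c [0..<n]) -` {s} \<inter> space bits =
      (if length s = n then {c \<in> space bits. \<forall>i<n. c i = s ! i} else {})"
    by auto
  also have "\<dots> \<in> sets bits" by simp
  finally show "(\<lambda>c. map c [0..<n]) -` {s} \<inter> space bits \<in> sets bits" .
qed auto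

lemma measurable_prefix_dependent:
  fixes g :: "(nat \<Rightarrow> bool) \<Rightarrow> nat \<Rightarrow> nat"
  assumes dep: "\<And>c c' k. (\<And>i. i \<le> k \<Longrightarrow> c i = c' i) \<Longrightarrow> g c k = g c' k"
  shows "g \<in> bits \<rightarrow>\<^sub>M nats"
proof (rule measurable_PiM_single')
  fix k :: nat
  \<comment> \<open>The value \<open>False\<close> is never consulted: the prefix has length k + 1,
    and coordinate k depends on the bits up to k only.\<close>
  let ?G = "\<lambda>s. g (\<lambda>i. if i < length s then s ! i else False) k"
  have "(\<lambda>c. g c k) = (\<lambda>c. ?G (map c [0..<Suc k]))"
    by (intro ext dep) (auto simp del: upt_Suc)
  also have "\<dots> \<in> bits \<rightarrow>\<^sub>M count_space UNIV"
    by (rule measurable_compose[OF measurable_prefix]) simp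
  finally show "(\<lambda>c. g c k) \<in> bits \<rightarrow>\<^sub>M count_space UNIV" .
qed auto

definition cyl :: "nat list \<Rightarrow> (nat \<Rightarrow> nat) set" where
  "cyl u = {x. \<forall>i<length u. x i = u ! i}"

lemma cyl_map: "cyl (map x [0..<n]) = {z. \<forall>i<n. z i = x i}"
  by (auto simp: cyl_def)

text \<open>The images under f, and not merely the cylinders, are kept apart; this makes f take
  different values along different branches.\<close>

definition splits :: "((nat \<Rightarrow> nat) \<Rightarrow> 'b) \<Rightarrow> (nat \<Rightarrow> nat) set \<Rightarrow> nat list \<Rightarrow> nat list \<Rightarrow> nat list \<Rightarrow> bool" where
  "splits f C u v w \<longleftrightarrow> uncountable (f ` (C \<inter> cyl v)) \<and> uncountable (f ` (C \<inter> cyl w)) \<and>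
    length u < length v \<and> length u < length w \<and> take (length u) v = u \<and> take (length u) w = u \<and>
    f ` (C \<inter> cyl v) \<inter> f ` (C \<inter> cyl w) = {}"

text \<open>Condensation points: there are only countably many cylinders, so discarding those with
  countable image loses countably many values. Two remaining points with different values have
  cylinders with disjoint images, and these images are uncountable.\<close>

lemma split_uncountable_image:
  fixes f :: "(nat \<Rightarrow> nat) \<Rightarrow> 'b"
  assumes sep: "\<forall>x\<in>C. \<forall>y\<in>C. f x \<noteq> f y \<longrightarrow>
      (\<exists>n. f ` (C \<inter> cyl (map x [0..<n])) \<inter> f ` (C \<inter> cyl (map y [0..<n])) = {})"
    and unc: "uncountable (f ` (C \<inter> cyl u))"
  shows "\<exists>v w. splits f C u v w"
proof -
  let ?big = "\<lambda>v. uncountable (f ` (C \<inter> cyl v))"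
  define K where "K = {x \<in> C \<inter> cyl u. \<forall>n. ?big (map x [0..<n])}"
  have "f ` (C \<inter> cyl u) - f ` K \<subseteq> (\<Union>v\<in>{v. \<not> ?big v}. f ` (C \<inter> cyl v))"
  proof
    fix b assume "b \<in> f ` (C \<inter> cyl u) - f ` K"
    then obtain x where x: "b = f x" "x \<in> C \<inter> cyl u" "x \<notin> K" by blast
    then obtain n where "\<not> ?big (map x [0..<n])" unfolding K_def by blast
    moreover have "b \<in> f ` (C \<inter> cyl (map x [0..<n]))" using x by (auto simp: cyl_map)
    ultimately show "b \<in> (\<Union>v\<in>{v. \<not> ?big v}. f ` (C \<inter> cyl v))" by blast
  qed
  moreover have "countable (\<Union>v\<in>{v. \<not> ?big v}. f ` (C \<inter> cyl v))"
    by (rule countable_UN) auto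
  ultimately have cnt: "countable (f ` (C \<inter> cyl u) - f ` K)"
    by (rule countable_subset)
  have K: "uncountable (f ` K)"
  proof
    assume "countable (f ` K)"
    from countable_Un[OF this cnt] have "countable (f ` (C \<inter> cyl u))"
      by (rule countable_subset[rotated]) blast
    then show False using unc by contradiction
  qed
  then have "K \<noteq> {}" by (metis countable_empty image_empty)
  then obtain x where x: "x \<in> K" by blast
  have "\<not> f ` K \<subseteq> {f x}"
    using K countable_subset[of "f ` K" "{f x}"] by auto
  then obtain y where y: "y \<in> K" "f x \<noteq> f y" by (metis image_subsetI singletonI)
  have xC: "x \<in> C \<inter> cyl u" "\<And>n. ?big (map x [0..<n])" and yC: "y \<in> C \<inter> cyl u" "\<And>n. ?big (map y [0..<n])"
    using x y(1) by (simp_all add: K_def)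
  obtain n where n: "f ` (C \<inter> cyl (map x [0..<n])) \<inter> f ` (C \<inter> cyl (map y [0..<n])) = {}"
    using sep xC(1) yC(1) y(2) by blast
  \<comment> \<open>The successor makes both cylinders strictly longer than u, so that branches grow
    into infinite sequences.\<close>
  let ?m = "max n (Suc (length u))"
  have mono: "cyl (map z [0..<?m]) \<subseteq> cyl (map z [0..<n])" for z by (auto simp: cyl_map)
  have "take (length u) (map z [0..<?m]) = u" if "z \<in> cyl u" for z
    using that by (auto simp: list_eq_iff_nth_eq cyl_def)
  moreover have "f ` (C \<inter> cyl (map x [0..<?m])) \<inter> f ` (C \<inter> cyl (map y [0..<?m])) = {}"
    using n image_mono[OF Int_mono[OF order_refl mono], of f C x] image_mono[OF Int_mono[OF order_refl mono], of f C y]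
    by blast
  ultimately show ?thesis
    unfolding splits_def using xC yC
    by (intro exI[of _ "map x [0..<?m]"] exI[of _ "map y [0..<?m]"]) auto
qed

text \<open>Separation is stated for images of cylinders, so the target carries no topology, which
  suits maps into a set of measures. Closedness of \<open>C\<close> puts the limits of branches into
  \<open>C\<close>; measurability holds because each coordinate is fixed by finitely many
  bits.\<close>

theorem cantor_scheme:
  fixes f :: "(nat \<Rightarrow> nat) \<Rightarrow> 'b" and C :: "(nat \<Rightarrow> nat) set"
  assumes C: "closed C"
    and sep: "\<forall>x\<in>C. \<forall>y\<in>C. f x \<noteq> f y \<longrightarrow>
      (\<exists>n. f ` (C \<inter> cyl (map x [0..<n])) \<inter> f ` (C \<inter> cyl (map y [0..<n])) = {})"
    and unc: "uncountable (f ` C)"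
  obtains g where "g \<in> bits \<rightarrow>\<^sub>M nats" "range g \<subseteq> C" "inj (\<lambda>c. f (g c))"
proof -
  define big where "big u \<longleftrightarrow> uncountable (f ` (C \<inter> cyl u))" for u
  have "\<exists>vw. big u \<longrightarrow> splits f C u (fst vw) (snd vw)" for u
  proof (cases "big u")
    case True
    from split_uncountable_image[OF sep this[unfolded big_def]] obtain v w where "splits f C u v w"
      by (elim exE)
    then show ?thesis by (intro exI[of _ "(v, w)"]) simp
  qed simp
  from choice[OF allI[OF this]]
  obtain sp where "\<forall>u. big u \<longrightarrow> splits f C u (fst (sp u)) (snd (sp u))" by (rule exE)
  then have sp: "big u \<longrightarrow> big (fst (sp u)) \<and> big (snd (sp u)) \<and>
    length u < length (fst (sp u)) \<and> length u < length (snd (sp u)) \<and>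
    take (length u) (fst (sp u)) = u \<and> take (length u) (snd (sp u)) = u \<and>
    f ` (C \<inter> cyl (fst (sp u))) \<inter> f ` (C \<inter> cyl (snd (sp u))) = {}" for u
    unfolding splits_def big_def by blast
  define h where "h c n = rec_nat [] (\<lambda>n u. (if c n then fst else snd) (sp u)) n" for c :: "nat \<Rightarrow> bool" and n
  have h0: "h c 0 = []" and hS: "h c (Suc n) = (if c n then fst else snd) (sp (h c n))" for c n
    by (simp_all add: h_def)
  have big: "big (h c n)" for c n
  proof (induction n)
    case 0
    show ?case using unc by (simp add: h0 big_def cyl_def)
  next
    case (Suc n)
    then show ?case using sp[of "h c n"] by (simp add: hS)
  qed
  have step: "length (h c n) < length (h c (Suc n)) \<and> take (length (h c n)) (h c (Suc n)) = h c n" for c n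
    using sp[of "h c n"] big[of c n] by (simp add: hS)
  have len: "n \<le> length (h c n)" for c n
  proof (induction n)
    case (Suc n)
    then show ?case using step[of c n] by simp
  qed simp
  have nth: "i < length (h c m) \<Longrightarrow> m \<le> n \<Longrightarrow> h c n ! i = h c m ! i \<and> i < length (h c n)" for c i m n
  proof (induction n)
    case 0
    then show ?case by simp
  next
    case (Suc n)
    show ?case
    proof (cases "m = Suc n")
      case False
      then have IH: "h c n ! i = h c m ! i" "i < length (h c n)" using Suc by auto
      have "h c (Suc n) ! i = take (length (h c n)) (h c (Suc n)) ! i" using IH(2) by simp
      then show ?thesis using IH step[of c n] by simp
    qed (use Suc in simp)
  qed
  \<comment> \<open>By \<open>len\<close> the string of stage k + 1 has an entry with index k, and
    it is fixed by the bits up to k.\<close>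
  define g where "g c k = h c (Suc k) ! k" for c k
  have g: "g c i = h c n ! i" if "i < length (h c n)" for c i n
  proof -
    have i: "i < length (h c (Suc i))" using len[of "Suc i" c] by simp
    show ?thesis
      using nth[OF i, of n] nth[OF that, of "Suc i"] unfolding g_def by (cases "Suc i \<le> n") auto
  qed
  have gcyl: "g c \<in> cyl (h c n)" for c n
    using g by (simp add: cyl_def)
  have gC: "g c \<in> C" for c
  proof (rule ccontr)
    assume "g c \<notin> C"
    then obtain m where m: "{z. \<forall>i<m. z i = g c i} \<subseteq> - C"
      using open_nat_fun_contains_nbhd[of "- C" "g c"] C by (auto simp: closed_def)
    have "C \<inter> cyl (h c m) \<noteq> {}" using big[of c m] by (auto simp: big_def)
    then obtain z where z: "z \<in> C" "z \<in> cyl (h c m)" by blast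
    have "z i = g c i" if "i < m" for i
    proof -
      have "i < length (h c m)" using that len[of m c] by simp
      then show ?thesis using z(2) g[of i c m] by (simp add: cyl_def)
    qed
    then show False using m z(1) by blast
  qed
  have hdep: "h c n = h c' n" if "\<And>i. i < n \<Longrightarrow> c i = c' i" for c c' n
    using that by (induction n) (simp_all add: h0 hS)
  have meas: "g \<in> bits \<rightarrow>\<^sub>M nats"
  proof (rule measurable_prefix_dependent)
    fix c c' :: "nat \<Rightarrow> bool" and k assume "\<And>i. i \<le> k \<Longrightarrow> c i = c' i"
    then have "h c (Suc k) = h c' (Suc k)" by (intro hdep) simp
    then show "g c k = g c' k" by (simp add: g_def)
  qed
  have inj: "inj (\<lambda>c. f (g c))"
  proof (rule injI, rule ccontr)
    fix c c' assume eq: "f (g c) = f (g c')" and "c \<noteq> c'"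
    define n where "n = (LEAST n. c n \<noteq> c' n)"
    have "\<exists>n. c n \<noteq> c' n" using \<open>c \<noteq> c'\<close> by auto
    then have n: "c n \<noteq> c' n" unfolding n_def by (rule LeastI_ex)
    have "c i = c' i" if "i < n" for i using not_less_Least[of i] that unfolding n_def by blast
    then have hn: "h c n = h c' n" by (rule hdep)
    have "f (g c) \<in> f ` (C \<inter> cyl (h c (Suc n)))" "f (g c') \<in> f ` (C \<inter> cyl (h c' (Suc n)))"
      using gC gcyl by blast+
    moreover have "f ` (C \<inter> cyl (h c (Suc n))) \<inter> f ` (C \<inter> cyl (h c' (Suc n))) = {}"
      using sp[of "h c n"] big[of c n] n hn by (auto simp: hS split: if_splits)
    ultimately show False using eq by auto
  qed
  show thesis using that[OF meas _ inj] gC by blast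
qed

section \<open>Measurable sets of sequences as projections of closed sets\<close>

definition projection_of_closed :: "(nat \<Rightarrow> nat) set \<Rightarrow> bool" where
  "projection_of_closed S \<longleftrightarrow> (\<exists>C :: ((nat \<Rightarrow> nat) \<times> (nat \<Rightarrow> nat)) set. closed C \<and> S = fst ` C)"

lemma closed_projection_of_closed:
  assumes "closed S" shows "projection_of_closed S"
proof -
  have "S = fst ` (S \<times> (UNIV :: (nat \<Rightarrow> nat) set))" by auto
  then show ?thesis
    unfolding projection_of_closed_def using closed_Times[OF assms closed_UNIV] by blast
qed

lemma continuous_reindex_snd:
  "continuous_on UNIV (\<lambda>p :: (nat \<Rightarrow> nat) \<times> (nat \<Rightarrow> nat). (fst p, \<lambda>i. snd p (\<phi> i)))"
proof (rule continuous_on_Pair[OF _ continuous_on_coordinatewise_then_product])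
  show "continuous_on UNIV (\<lambda>p :: (nat \<Rightarrow> nat) \<times> (nat \<Rightarrow> nat). fst p)"
    by (rule continuous_on_fst[OF continuous_on_id])
  show "continuous_on UNIV (\<lambda>p :: (nat \<Rightarrow> nat) \<times> (nat \<Rightarrow> nat). snd p (\<phi> i))" for i
    by (rule continuous_on_compose2[where g = "\<lambda>x. x (\<phi> i)" and t = UNIV and f = snd])
      (simp_all add: continuous_on_product_coordinates continuous_on_snd[OF continuous_on_id])
qed

text \<open>The first entry of the second component names a set of the union, the remaining entries
  are the witness for it.\<close>

lemma projection_of_closed_UN:
  assumes "\<And>n :: nat. projection_of_closed (S n)"
  shows "projection_of_closed (\<Union>n. S n)"
proof -
  have "\<forall>n. \<exists>C :: ((nat \<Rightarrow> nat) \<times> (nat \<Rightarrow> nat)) set. closed C \<and> S n = fst ` C"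
    using assms unfolding projection_of_closed_def by blast
  then obtain C :: "nat \<Rightarrow> ((nat \<Rightarrow> nat) \<times> (nat \<Rightarrow> nat)) set"
    where C: "\<And>n. closed (C n)" "\<And>n. S n = fst ` C n"
    by metis
  define D where "D = {p. (fst p, \<lambda>i. snd p (Suc i)) \<in> C (snd p 0)}"
  have "D = (\<Inter>n. {p. snd p 0 \<noteq> n} \<union> (\<lambda>p. (fst p, \<lambda>i. snd p (Suc i))) -` C n)"
    by (auto simp: D_def)
  moreover have "closed {p :: (nat \<Rightarrow> nat) \<times> (nat \<Rightarrow> nat). snd p 0 \<noteq> n}" for n
  proof -
    have "continuous_on UNIV (\<lambda>p :: (nat \<Rightarrow> nat) \<times> (nat \<Rightarrow> nat). snd p 0)"
      by (rule continuous_on_compose2[OF continuous_on_product_coordinates]) (auto intro: continuous_on_snd)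
    then have "closed ((\<lambda>p :: (nat \<Rightarrow> nat) \<times> (nat \<Rightarrow> nat). snd p 0) -` (- {n}))"
      by (intro closed_vimage) (auto simp: closed_def Topological_Spaces.open_discrete)
    moreover have "(\<lambda>p :: (nat \<Rightarrow> nat) \<times> (nat \<Rightarrow> nat). snd p 0) -` (- {n}) = {p. snd p 0 \<noteq> n}" by auto
    ultimately show ?thesis by simp
  qed
  ultimately have "closed D"
    using C(1) continuous_reindex_snd[of Suc]
    by (auto intro!: closed_INT closed_Un closed_vimage)
  moreover have "(\<Union>n. S n) = fst ` D"
  proof (intro equalityI subsetI)
    fix x assume "x \<in> (\<Union>n. S n)"
    then obtain n y where "(x, y) \<in> C n" using C(2) by fastforce
    then have "(x, case_nat n y) \<in> D" by (simp add: D_def)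
    then show "x \<in> fst ` D" by force
  next
    fix x assume "x \<in> fst ` D"
    then show "x \<in> (\<Union>n. S n)" using C(2) by (force simp: D_def)
  qed
  ultimately show ?thesis unfolding projection_of_closed_def by blast
qed

text \<open>One sequence carries the witnesses for all n at once, the n-th being read off at the
  positions \<open>prod_encode (n, i)\<close>.\<close>

lemma projection_of_closed_INT:
  assumes "\<And>n :: nat. projection_of_closed (S n)"
  shows "projection_of_closed (\<Inter>n. S n)"
proof -
  have "\<forall>n. \<exists>C :: ((nat \<Rightarrow> nat) \<times> (nat \<Rightarrow> nat)) set. closed C \<and> S n = fst ` C"
    using assms unfolding projection_of_closed_def by blast
  then obtain C :: "nat \<Rightarrow> ((nat \<Rightarrow> nat) \<times> (nat \<Rightarrow> nat)) set"
    where C: "\<And>n. closed (C n)" "\<And>n. S n = fst ` C n"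
    by metis
  define D where "D = (\<Inter>n. (\<lambda>p. (fst p, \<lambda>i. snd p (prod_encode (n, i)))) -` C n)"
  have "closed D"
    unfolding D_def using C(1) continuous_reindex_snd by (intro closed_INT ballI closed_vimage)
  moreover have "(\<Inter>n. S n) = fst ` D"
  proof (intro equalityI subsetI)
    fix x assume "x \<in> (\<Inter>n. S n)"
    then have "\<forall>n. \<exists>y. (x, y) \<in> C n" using C(2) by fastforce
    then obtain y where y: "\<And>n. (x, y n) \<in> C n" by metis
    have "(x, \<lambda>k. case prod_decode k of (n, i) \<Rightarrow> y n i) \<in> D"
      using y by (simp add: D_def)
    then show "x \<in> fst ` D" by force
  next
    fix x assume "x \<in> fst ` D"
    then show "x \<in> (\<Inter>n. S n)" using C(2) by (force simp: D_def)
  qed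
  ultimately show ?thesis unfolding projection_of_closed_def by blast
qed

text \<open>Projections of closed sets are in general not stable under complements, so the induction
  carries each set together with its complement; the generators are clopen.\<close>

lemma measurable_projection_of_closed:
  assumes "B \<in> sets nats"
  shows "projection_of_closed B"
proof -
  have "B \<in> sigma_sets UNIV {{f. f i \<in> A} | i A. True}"
    using assms unfolding sets_PiM_single by (simp add: space_PiM)
  then have "projection_of_closed B \<and> projection_of_closed (- B)"
  proof induction
    case (Basic a)
    then obtain i A where a: "a = (\<lambda>f. f i) -` A" by auto
    have "closed ((\<lambda>f :: nat \<Rightarrow> nat. f i) -` A)" for A
      by (intro closed_vimage continuous_on_product_coordinates) (simp add: closed_def Topological_Spaces.open_discrete)
    then show ?case
      unfolding a vimage_Compl[symmetric] by (blast intro: closed_projection_of_closed)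
  next
    case Empty
    then show ?case by (simp add: closed_projection_of_closed)
  next
    case (Compl a)
    then show ?case by (simp add: Compl_eq_Diff_UNIV[symmetric])
  next
    case (Union a)
    then show ?case by (auto simp: projection_of_closed_UN intro!: projection_of_closed_INT)
  qed
  then show ?thesis ..
qed

text \<open>A point and its witness are interleaved in one sequence, and the scheme is run on the
  map to the even entries; so branches differ in the point and not just in the witness.\<close>

theorem uncountable_measurable_contains_bits:
  assumes B: "B \<in> sets nats" and unc: "uncountable B"
  obtains g where "g \<in> bits \<rightarrow>\<^sub>M nats" "range g \<subseteq> B" "inj g"
proof -
  obtain C :: "((nat \<Rightarrow> nat) \<times> (nat \<Rightarrow> nat)) set" where C: "closed C" "B = fst ` C"
    using measurable_projection_of_closed[OF B] unfolding projection_of_closed_def by blast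
  let ?f = "\<lambda>(z :: nat \<Rightarrow> nat) i. z (2 * i)"
  define C' where "C' = (\<lambda>z :: nat \<Rightarrow> nat. (?f z, \<lambda>i. z (2 * i + 1))) -` C"
  have "closed C'"
    unfolding C'_def using C(1)
    by (intro closed_vimage continuous_on_Pair continuous_on_coordinatewise_then_product
        continuous_on_product_coordinates)
  have fC: "?f ` C' = B"
  proof (intro equalityI subsetI)
    fix x assume "x \<in> B"
    then obtain y where "(x, y) \<in> C" using C(2) by auto
    then have "(\<lambda>k. if even k then x (k div 2) else y (k div 2)) \<in> C'"
      by (simp add: C'_def)
    then show "x \<in> ?f ` C'" by (rule rev_image_eqI) simp
  qed (use C in \<open>auto simp: C'_def image_iff intro: rev_bexI\<close>)
  obtain g where g: "g \<in> bits \<rightarrow>\<^sub>M nats" "range g \<subseteq> C'" "inj (\<lambda>c. ?f (g c))"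
  proof (rule cantor_scheme[OF \<open>closed C'\<close>, of ?f], intro ballI impI)
    fix x y :: "nat \<Rightarrow> nat" assume "?f x \<noteq> ?f y"
    then obtain i where i: "x (2 * i) \<noteq> y (2 * i)" by auto
    show "\<exists>n. ?f ` (C' \<inter> cyl (map x [0..<n])) \<inter> ?f ` (C' \<inter> cyl (map y [0..<n])) = {}"
    proof (rule exI[of _ "Suc (2 * i)"], rule ccontr)
      assume "?f ` (C' \<inter> cyl (map x [0..<Suc (2 * i)])) \<inter> ?f ` (C' \<inter> cyl (map y [0..<Suc (2 * i)])) \<noteq> {}"
      then obtain z z' where "z \<in> cyl (map x [0..<Suc (2 * i)])" "z' \<in> cyl (map y [0..<Suc (2 * i)])" "?f z = ?f z'"
        by blast
      then show False using i fun_cong[of "?f z" "?f z'" i] unfolding cyl_map by auto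
    qed
  next
    show "uncountable (?f ` C')" using unc fC by simp
  next
    fix g assume "g \<in> bits \<rightarrow>\<^sub>M nats" "range g \<subseteq> C'" "inj (\<lambda>c. ?f (g c))"
    then show thesis by (rule that)
  qed
  show thesis
  proof (rule that)
    show "(\<lambda>c. ?f (g c)) \<in> bits \<rightarrow>\<^sub>M nats"
      by (rule measurable_PiM_single', rule measurable_compose[OF g(1)]) auto
    show "range (\<lambda>c. ?f (g c)) \<subseteq> B" using g(2) fC by auto
    show "inj (\<lambda>c. ?f (g c))" by (rule g(3))
  qed
qed

subsection \<open>Measures on bit sequences\<close>

text \<open>Left endpoint of the interval assigned to s: at each bit 1 the sibling interval to the
  left is passed over.\<close>

definition left_end :: "(bool list \<Rightarrow> real) \<Rightarrow> bool list \<Rightarrow> real" where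
  "left_end v s = (\<Sum>i<length s. if s ! i then v (take i s @ [False]) else 0)"

lemma left_end_Nil [simp]: "left_end v [] = 0"
  by (simp add: left_end_def)

lemma left_end_snoc [simp]:
  "left_end v (s @ [b]) = left_end v s + (if b then v (s @ [False]) else 0)"
  by (auto simp: left_end_def nth_append intro!: sum.cong)

text \<open>A weight \<open>v\<close> on finite bit strings with \<open>v s = v (s0) + v (s1)\<close> splits \<open>[0, 1)\<close> into nested
  half-open intervals of length \<open>v s\<close>; reading off the intervals containing \<open>u\<close> gives a bit sequence
  whose law, for uniform \<open>u\<close>, charges the cylinder of \<open>s\<close> with \<open>v s\<close>.\<close>

primrec prefix_of :: "(bool list \<Rightarrow> real) \<Rightarrow> real \<Rightarrow> nat \<Rightarrow> bool list" where
  "prefix_of v u 0 = []"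
| "prefix_of v u (Suc n) = prefix_of v u n @ [left_end v (prefix_of v u n) + v (prefix_of v u n @ [False]) \<le> u]"

definition bits_of :: "(bool list \<Rightarrow> real) \<Rightarrow> real \<Rightarrow> nat \<Rightarrow> bool" where
  "bits_of v u n = last (prefix_of v u (Suc n))"

lemma length_prefix_of [simp]: "length (prefix_of v u n) = n"
  by (induction n) auto

lemma map_bits_of: "map (bits_of v u) [0..<n] = prefix_of v u n"
  by (induction n) (auto simp: bits_of_def)

text \<open>The weights may vary together with u; this joint measurability later makes
  \<open>realize\<close> a measurable function of the weights.\<close>

lemma measurable_prefix_of:
  assumes v: "\<And>s. (\<lambda>x. v x s) \<in> borel_measurable N" and u: "u \<in> borel_measurable N"
  shows "(\<lambda>x. prefix_of (v x) (u x) n) \<in> N \<rightarrow>\<^sub>M count_space UNIV"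
proof (induction n)
  case 0
  show ?case by simp
next
  case (Suc n)
  have le: "(\<lambda>x. left_end (v x) s) \<in> borel_measurable N" for s
    unfolding left_end_def using v by (intro borel_measurable_sum) auto
  have "(\<lambda>x. s @ [left_end (v x) s + v x (s @ [False]) \<le> u x]) \<in> N \<rightarrow>\<^sub>M count_space UNIV" for s
  proof (rule measurable_compose[where g = "\<lambda>b. s @ [b]" and N = "count_space UNIV"])
    show "(\<lambda>x. left_end (v x) s + v x (s @ [False]) \<le> u x) \<in> N \<rightarrow>\<^sub>M count_space UNIV"
      using le[of s] v[of "s @ [False]"] u by measurable
  qed simp
  from measurable_compose_countable[OF this Suc] show ?case by simp
qed

lemma measurable_bits_of:
  assumes "\<And>s. (\<lambda>x. v x s) \<in> borel_measurable N" and "u \<in> borel_measurable N"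
  shows "(\<lambda>x. bits_of (v x) (u x)) \<in> N \<rightarrow>\<^sub>M bits"
proof (rule measurable_PiM_single')
  fix n
  show "(\<lambda>x. bits_of (v x) (u x) n) \<in> N \<rightarrow>\<^sub>M count_space UNIV"
    unfolding bits_of_def by (rule measurable_compose[OF measurable_prefix_of[OF assms]]) simp
qed auto

definition unit_uniform :: "real measure" where
  "unit_uniform = uniform_measure lborel {0..<1}"

lemma sets_unit_uniform [simp, measurable_cong]: "sets unit_uniform = sets borel"
  by (simp add: unit_uniform_def)

lemma space_unit_uniform [simp]: "space unit_uniform = UNIV"
  by (simp add: unit_uniform_def)

lemma prob_space_unit_uniform: "prob_space unit_uniform"
  unfolding unit_uniform_def by (rule prob_space_uniform_measure) auto

definition tree_measure :: "(bool list \<Rightarrow> real) \<Rightarrow> (nat \<Rightarrow> bool) measure" where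
  "tree_measure v = distr unit_uniform bits (bits_of v)"

lemma sets_tree_measure [simp, measurable_cong]: "sets (tree_measure v) = sets bits"
  by (simp add: tree_measure_def)

lemma space_tree_measure [simp]: "space (tree_measure v) = UNIV"
  by (simp add: tree_measure_def space_PiM)

lemma measurable_bits_of_const: "bits_of v \<in> unit_uniform \<rightarrow>\<^sub>M bits"
proof -
  have "(\<lambda>u. bits_of v (id u)) \<in> unit_uniform \<rightarrow>\<^sub>M bits"
    by (rule measurable_bits_of) auto
  then show ?thesis by simp
qed

lemma prob_space_tree_measure: "prob_space (tree_measure v)"
  unfolding tree_measure_def
  by (intro prob_space.prob_space_distr prob_space_unit_uniform measurable_bits_of_const)

definition bcyl :: "bool list \<Rightarrow> (nat \<Rightarrow> bool) set" where
  "bcyl s = {c. map c [0..<length s] = s}"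

lemma prefix_set_sets: "{c. map c [0..<n] \<in> A} \<in> sets bits"
  using measurable_sets[OF measurable_prefix, of A n] by (simp add: vimage_def space_PiM)

lemma bcyl_sets: "bcyl s \<in> sets bits"
  using prefix_set_sets[of "length s" "{s}"] by (simp add: bcyl_def)

definition consistent :: "(bool list \<Rightarrow> real) \<Rightarrow> bool" where
  "consistent v \<longleftrightarrow> v [] = 1 \<and> (\<forall>s. 0 \<le> v s \<and> v s = v (s @ [False]) + v (s @ [True]))"

lemma consistentD:
  assumes "consistent v"
  shows "v [] = 1" "0 \<le> v s" "v s = v (s @ [False]) + v (s @ [True])"
  using assms unfolding consistent_def by blast+

lemma prefix_of_eq_iff:
  assumes v: "consistent v" and u: "0 \<le> u" "u < 1"
  shows "prefix_of v u (length s) = s \<longleftrightarrow> left_end v s \<le> u \<and> u < left_end v s + v s"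
proof (induction s rule: rev_induct)
  case Nil
  then show ?case using consistentD(1)[OF v] u by simp
next
  case (snoc b s)
  have *: "v s = v (s @ [False]) + v (s @ [True])" "0 \<le> v (s @ [True])" "0 \<le> v (s @ [False])"
    using consistentD(2,3)[OF v] by blast+
  have "prefix_of v u (length (s @ [b])) = s @ [b] \<longleftrightarrow>
      prefix_of v u (length s) = s \<and> (left_end v s + v (s @ [False]) \<le> u \<longleftrightarrow> b)"
    by auto
  then show ?case unfolding snoc.IH using * by (cases b) auto
qed

lemma left_end_bounds:
  assumes v: "consistent v"
  shows "0 \<le> left_end v s \<and> left_end v s + v s \<le> 1"
proof (induction s rule: rev_induct)
  case Nil
  then show ?case using consistentD(1)[OF v] by simp
next
  case (snoc b s)
  have "v s = v (s @ [False]) + v (s @ [True])" "0 \<le> v (s @ [True])" "0 \<le> v (s @ [False])"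
    using consistentD(2,3)[OF v] by blast+
  then show ?case using snoc by (cases b) auto
qed

lemma emeasure_tree_measure_bcyl:
  assumes v: "consistent v"
  shows "emeasure (tree_measure v) (bcyl s) = v s"
proof -
  have v0: "0 \<le> v s" using v by (rule consistentD(2))
  have B: "{u. prefix_of v u (length s) = s} \<in> sets lborel"
    using measurable_sets[OF measurable_bits_of_const bcyl_sets[of s], of v]
    by (simp add: bcyl_def map_bits_of vimage_def)
  have "emeasure (tree_measure v) (bcyl s) = emeasure unit_uniform {u. prefix_of v u (length s) = s}"
    unfolding tree_measure_def
    by (subst emeasure_distr[OF measurable_bits_of_const bcyl_sets])
      (simp add: bcyl_def map_bits_of vimage_def)
  also have "\<dots> = emeasure lborel ({0..<1} \<inter> {u. prefix_of v u (length s) = s}) / emeasure lborel {0..<1::real}"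
    unfolding unit_uniform_def using B by (intro emeasure_uniform_measure) auto
  also have "{0..<1} \<inter> {u. prefix_of v u (length s) = s} = {left_end v s ..< left_end v s + v s}"
    using left_end_bounds[OF v, of s] prefix_of_eq_iff[OF v, of _ s] by force
  finally show ?thesis using v0 by (simp add: divide_ennreal_def)
qed

lemma emeasure_prefix_set:
  assumes P: "sets P = sets bits"
  shows "emeasure P {c. map c [0..<n] \<in> A} = (\<Sum>s\<in>{s \<in> A. length s = n}. emeasure P (bcyl s))"
proof -
  have fin: "finite {s \<in> A. length s = n}"
    by (rule finite_subset[OF _ finite_lists_length_eq[of "UNIV :: bool set" n]]) auto
  have "{c. map c [0..<n] \<in> A} = (\<Union>s\<in>{s \<in> A. length s = n}. bcyl s)"
    by (auto simp: bcyl_def)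
  then show ?thesis
    using fin P bcyl_sets
    by (auto intro!: sum_emeasure[symmetric] simp: disjoint_family_on_def bcyl_def)
qed

lemma bits_measure_eqI:
  assumes P: "finite_measure P" "sets P = sets bits" and Q: "sets Q = sets bits"
    and eq: "\<And>s. emeasure P (bcyl s) = emeasure Q (bcyl s)"
  shows "P = Q"
proof (rule measure_eqI_PiM_infinite[OF P(2) Q])
  fix J :: "nat set" and F :: "nat \<Rightarrow> bool set" assume J: "finite J"
  obtain n where n: "\<And>j. j \<in> J \<Longrightarrow> j < n"
    using finite_nat_set_iff_bounded[THEN iffD1, OF J] by auto
  have "prod_emb UNIV (\<lambda>_. count_space UNIV) J (Pi\<^sub>E J F) = {c. map c [0..<n] \<in> {s. \<forall>j\<in>J. s ! j \<in> F j}}"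
    using n by (auto simp: prod_emb_def PiE_iff)
  then show "emeasure P (prod_emb UNIV (\<lambda>_. count_space UNIV) J (Pi\<^sub>E J F)) =
      emeasure Q (prod_emb UNIV (\<lambda>_. count_space UNIV) J (Pi\<^sub>E J F))"
    by (simp only: emeasure_prefix_set[OF P(2)] emeasure_prefix_set[OF Q] eq)
next
  show "finite_measure P" by (rule P(1))
qed

definition coin :: "(nat \<Rightarrow> bool) measure" where
  "coin = tree_measure (\<lambda>s. (1 / 2) ^ length s)"

lemma sets_coin [simp, measurable_cong]: "sets coin = sets bits"
  by (simp add: coin_def)

lemma space_coin [simp]: "space coin = UNIV"
  by (simp add: coin_def)

lemma prob_space_coin: "prob_space coin"
  unfolding coin_def by (rule prob_space_tree_measure)

lemma coin_countable_null:
  assumes "countable D"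
  shows "D \<in> null_sets coin"
proof -
  have single: "{c} \<in> null_sets coin" for c
  proof -
    have "{c} = (\<Inter>n. bcyl (map c [0..<n]))"
    proof (intro equalityI subsetI)
      fix d assume d: "d \<in> (\<Inter>n. bcyl (map c [0..<n]))"
      have "d i = c i" for i
      proof -
        have "d \<in> bcyl (map c [0..<Suc i])" using d by blast
        then show ?thesis by (simp add: bcyl_def)
      qed
      then show "d \<in> {c}" by auto
    qed (auto simp: bcyl_def)
    then have sets: "{c} \<in> sets bits"
      using bcyl_sets by auto
    have "emeasure coin {c} \<le> ennreal ((1 / 2) ^ n)" for n
    proof -
      have "emeasure coin {c} \<le> emeasure coin (bcyl (map c [0..<n]))"
      proof (rule emeasure_mono)
        show "bcyl (map c [0..<n]) \<in> sets coin" using bcyl_sets by simp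
      qed (simp add: bcyl_def)
      also have "\<dots> = ennreal ((1 / 2) ^ n)"
        unfolding coin_def by (subst emeasure_tree_measure_bcyl) (auto simp: consistent_def)
      finally show ?thesis .
    qed
    moreover have "(\<lambda>n. ennreal ((1 / 2) ^ n)) \<longlonglongrightarrow> ennreal 0"
      by (intro tendsto_ennrealI LIMSEQ_realpow_zero) auto
    ultimately have "emeasure coin {c} \<le> ennreal 0"
      by (intro LIMSEQ_le_const) auto
    then show ?thesis using sets by (auto simp: null_sets_def)
  qed
  have "(\<Union>c\<in>D. {c}) \<in> null_sets coin"
    using single by (intro null_sets_UN' assms)
  then show ?thesis by simp
qed

subsection \<open>Coding the measures on a Polish space\<close>

text \<open>Index \<open>prod_encode (k, i)\<close> will stand for the ball with centre
  \<open>ctr i\<close> and radius \<open>\<rho> k\<close>. The radii are left open below 1/(k+1), so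
  that they can be chosen to make spheres null for prescribed measures.\<close>

locale coded_polish = Metric_space S d for S :: "'a set" and d :: "'a \<Rightarrow> 'a \<Rightarrow> real" +
  fixes M :: "'a measure" and ctr :: "nat \<Rightarrow> 'a" and \<rho> :: "nat \<Rightarrow> real"
  assumes complete: mcomplete
    and ctr: "\<And>i. ctr i \<in> S" and dense: "\<And>y e. y \<in> S \<Longrightarrow> 0 < e \<Longrightarrow> \<exists>i. d (ctr i) y < e"
    and rho_pos: "\<And>k. 0 < \<rho> k" and rho_less: "\<And>k. \<rho> k < 1 / real (Suc k)"
    and space_M: "space M = S" and sets_M: "sets M = borel_sets mtopology"
begin

definition cn :: "nat \<Rightarrow> 'a" where "cn n = ctr (snd (prod_decode n))"
definition rn :: "nat \<Rightarrow> real" where "rn n = \<rho> (fst (prod_decode n))"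
definition bl :: "nat \<Rightarrow> 'a set" where "bl n = {y \<in> S. d (cn n) y < rn n}"
definition cbl :: "nat \<Rightarrow> 'a set" where "cbl n = {y \<in> S. d (cn n) y \<le> rn n}"

lemma cn_in: "cn n \<in> S" by (simp add: cn_def ctr)

lemma openin_sets: "openin mtopology U \<Longrightarrow> U \<in> sets M"
  by (auto simp: sets_M borel_sets_def intro: sigma_sets.Basic)

lemma openin_bl: "openin mtopology (bl n)"
proof -
  have "bl n = mball (cn n) (rn n)" using cn_in by (auto simp: bl_def)
  then show ?thesis by simp
qed

lemma bl_sets: "bl n \<in> sets M"
  by (rule openin_sets[OF openin_bl])

lemma rho_small: "0 < e \<Longrightarrow> \<exists>K. \<forall>k\<ge>K. \<rho> k < e"
proof -
  assume "0 < e"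
  then obtain K where K: "inverse (real (Suc K)) < e" using reals_Archimedean by blast
  have "\<rho> k < e" if "K \<le> k" for k
  proof -
    have "1 / real (Suc k) \<le> 1 / real (Suc K)" using that by (simp add: field_simps)
    then show ?thesis using rho_less[of k] K by (simp add: inverse_eq_divide)
  qed
  then show ?thesis by blast
qed

text \<open>Uniform in the centre: at a fine scale every closed ball that reaches y stays inside U.
  Hence whichever ball a code selects at that scale witnesses that the decoded point is in
  U.\<close>

lemma open_eq_UN_cbl:
  assumes U: "openin mtopology U" and y: "y \<in> U"
  shows "\<exists>K. \<forall>k\<ge>K. \<forall>i. d (ctr i) y \<le> \<rho> k \<longrightarrow> cbl (prod_encode (k, i)) \<subseteq> U"
proof -
  obtain e where e: "0 < e" "mball y e \<subseteq> U" using U y unfolding openin_mtopology by blast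
  have yS: "y \<in> S" using U y openin_subset by fastforce
  obtain K where K: "\<And>k. K \<le> k \<Longrightarrow> \<rho> k < e / 2" using rho_small[of "e / 2"] e by auto
  have "cbl (prod_encode (k, i)) \<subseteq> U" if k: "K \<le> k" and i: "d (ctr i) y \<le> \<rho> k" for k i
  proof
    fix z assume "z \<in> cbl (prod_encode (k, i))"
    then have z: "z \<in> S" "d (ctr i) z \<le> \<rho> k" by (auto simp: cbl_def cn_def rn_def)
    have "d y z \<le> d y (ctr i) + d (ctr i) z" using yS z ctr by (intro triangle)
    also have "\<dots> < e" using i z(2) K[OF k] commute[of y "ctr i"] by simp
    finally show "z \<in> U" using e(2) yS z(1) by auto
  qed
  then show ?thesis by blast
qed

lemma bl_subset_cbl: "bl n \<subseteq> cbl n" by (auto simp: bl_def cbl_def)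

lemma open_eq_UN_bl:
  assumes U: "openin mtopology U"
  shows "U = (\<Union>n\<in>{n. bl n \<subseteq> U}. bl n)"
proof (intro equalityI subsetI)
  fix y assume y: "y \<in> U"
  have yS: "y \<in> S" using U y openin_subset by fastforce
  obtain K where K: "\<And>k i. K \<le> k \<Longrightarrow> d (ctr i) y \<le> \<rho> k \<Longrightarrow> cbl (prod_encode (k, i)) \<subseteq> U"
    using open_eq_UN_cbl[OF U y] by blast
  obtain i where i: "d (ctr i) y < \<rho> K" using dense[OF yS rho_pos] by blast
  have "y \<in> bl (prod_encode (K, i))" using i yS by (simp add: bl_def cn_def rn_def)
  moreover have "bl (prod_encode (K, i)) \<subseteq> U"
    using K[of K i] i bl_subset_cbl by (meson less_imp_le order_refl subset_trans)
  ultimately show "y \<in> (\<Union>n\<in>{n. bl n \<subseteq> U}. bl n)" by blast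
qed auto

definition code :: "'a \<Rightarrow> nat \<Rightarrow> bool" where "code y n \<longleftrightarrow> y \<in> bl n"

lemma measurable_code: "code \<in> M \<rightarrow>\<^sub>M bits"
proof (rule measurable_PiM_single')
  show "(\<lambda>y. code y n) \<in> M \<rightarrow>\<^sub>M count_space UNIV" for n
    unfolding code_def using bl_sets[of n] by measurable
qed auto

text \<open>Asks something of the selected balls only. Codes of points satisfy both clauses; so do
  almost all sequences under a tight limit of laws of codes, although such sequences need not be
  codes themselves.\<close>

definition good :: "(nat \<Rightarrow> bool) \<Rightarrow> bool" where
  "good c \<longleftrightarrow> (\<forall>k. \<exists>i. c (prod_encode (k, i))) \<and> (\<forall>m n. c m \<and> c n \<longrightarrow> bl m \<inter> bl n \<noteq> {})"

definition decode :: "(nat \<Rightarrow> bool) \<Rightarrow> 'a" where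
  "decode c = (if good c then SOME y. y \<in> S \<and> (\<forall>n. c n \<longrightarrow> y \<in> cbl n) else ctr 0)"

text \<open>Selected balls meet, so their centres are closer than the sum of their radii. One
  selected centre per scale gives a Cauchy sequence, and its limit lies in the closed versions of
  all selected balls.\<close>

lemma good_limit:
  assumes c: "good c"
  shows "\<exists>y. y \<in> S \<and> (\<forall>n. c n \<longrightarrow> y \<in> cbl n)"
proof -
  obtain i where i: "\<And>k. c (prod_encode (k, i k))" using c unfolding good_def by metis
  have meet: "d (cn m) (cn n) < rn m + rn n" if mn: "c m" "c n" for m n
  proof -
    obtain z where z: "z \<in> bl m" "z \<in> bl n" using c mn unfolding good_def by blast
    have "d (cn m) (cn n) \<le> d (cn m) z + d z (cn n)"
      using z cn_in by (intro triangle) (auto simp: bl_def)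
    then show ?thesis using z commute[of z "cn n"] by (auto simp: bl_def)
  qed
  define \<sigma> where "\<sigma> k = ctr (i k)" for k
  have near: "d (cn n) (\<sigma> k) < rn n + \<rho> k" if "c n" for n k
    using meet[OF that i[of k]] by (simp add: \<sigma>_def cn_def rn_def)
  have "MCauchy \<sigma>"
    unfolding MCauchy_def
  proof (intro conjI allI impI)
    show "range \<sigma> \<subseteq> S" using ctr by (auto simp: \<sigma>_def)
    fix e :: real assume "0 < e"
    then obtain K where K: "\<And>k. K \<le> k \<Longrightarrow> \<rho> k < e / 2" using rho_small[of "e / 2"] by auto
    have "d (\<sigma> k) (\<sigma> l) < e" if "K \<le> k" "K \<le> l" for k l
      using near[OF i[of k], of l] K[OF that(1)] K[OF that(2)] by (simp add: \<sigma>_def cn_def rn_def)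
    then show "\<exists>N. \<forall>n n'. N \<le> n \<longrightarrow> N \<le> n' \<longrightarrow> d (\<sigma> n) (\<sigma> n') < e" by blast
  qed
  then obtain y where "limitin mtopology \<sigma> y sequentially"
    using complete unfolding mcomplete_def by blast
  then have y: "y \<in> S" and lim: "\<And>e. 0 < e \<Longrightarrow> \<forall>\<^sub>F k in sequentially. \<sigma> k \<in> S \<and> d (\<sigma> k) y < e"
    by (auto simp: limitin_metric)
  have "y \<in> cbl n" if "c n" for n
  proof -
    have "d (cn n) y \<le> rn n + e" if e: "0 < e" for e
    proof -
      obtain K where K: "\<And>k. K \<le> k \<Longrightarrow> \<rho> k < e / 2" using rho_small[of "e / 2"] e by auto
      have "\<forall>\<^sub>F k in sequentially. K \<le> k \<and> \<sigma> k \<in> S \<and> d (\<sigma> k) y < e / 2"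
        using eventually_conj[OF eventually_ge_at_top[of K] lim[of "e / 2"]] e by simp
      then obtain k where k: "K \<le> k" "\<sigma> k \<in> S" "d (\<sigma> k) y < e / 2"
        using eventually_happens'[OF sequentially_bot] by blast
      have "d (cn n) y \<le> d (cn n) (\<sigma> k) + d (\<sigma> k) y"
        using y k cn_in by (intro triangle)
      then show ?thesis using near[OF \<open>c n\<close>, of k] k(3) K[OF k(1)] by simp
    qed
    then have "d (cn n) y \<le> rn n" by (rule field_le_epsilon)
    then show ?thesis using y by (simp add: cbl_def)
  qed
  then show ?thesis using y by blast
qed

lemma decode_good:
  assumes "good c"
  shows "decode c \<in> S" and "c n \<Longrightarrow> decode c \<in> cbl n"
proof -
  define P where "P y \<longleftrightarrow> y \<in> S \<and> (\<forall>n. c n \<longrightarrow> y \<in> cbl n)" for y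
  have "P (SOME y. P y)" using good_limit[OF assms] unfolding P_def by (rule someI_ex)
  moreover have "decode c = (SOME y. P y)" using assms by (simp add: decode_def P_def)
  ultimately have "decode c \<in> S \<and> (\<forall>n. c n \<longrightarrow> decode c \<in> cbl n)"
    unfolding P_def[symmetric] by simp
  then show "decode c \<in> S" and "c n \<Longrightarrow> decode c \<in> cbl n" by blast+
qed

lemma decode_in: "decode c \<in> S"
proof (cases "good c")
  case True
  then show ?thesis by (rule decode_good(1))
next
  case False
  then show ?thesis by (simp add: decode_def ctr)
qed

text \<open>Turns an open set into a countable union of coordinate conditions, both for the
  measurability of \<open>decode\<close> and for the lower bounds on limits of measures.\<close>

lemma decode_in_open_iff:
  assumes c: "good c" and U: "openin mtopology U"
  shows "decode c \<in> U \<longleftrightarrow> (\<exists>n. c n \<and> cbl n \<subseteq> U)"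
proof
  assume "decode c \<in> U"
  then obtain K where K: "\<And>i. d (ctr i) (decode c) \<le> \<rho> K \<Longrightarrow> cbl (prod_encode (K, i)) \<subseteq> U"
    using open_eq_UN_cbl[OF U] by blast
  obtain i where i: "c (prod_encode (K, i))" using c unfolding good_def by blast
  have "d (ctr i) (decode c) \<le> \<rho> K"
    using decode_good(2)[OF c i] by (simp add: cbl_def cn_def rn_def)
  then show "\<exists>n. c n \<and> cbl n \<subseteq> U" using i K by blast
next
  assume "\<exists>n. c n \<and> cbl n \<subseteq> U"
  then show "decode c \<in> U" using decode_good(2)[OF c] by blast
qed

lemma good_sets: "{c. good c} \<in> sets bits"
proof -
  have "{c \<in> space bits. good c} \<in> sets bits"
    unfolding good_def by measurable
  then show ?thesis by (simp add: space_PiM)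
qed

lemma measurable_decode: "decode \<in> bits \<rightarrow>\<^sub>M M"
proof -
  have "decode \<in> bits \<rightarrow>\<^sub>M sigma S {U. openin mtopology U}"
  proof (rule measurable_measure_of)
    show "{U. openin mtopology U} \<subseteq> Pow S" using openin_subset by fastforce
    show "decode \<in> space bits \<rightarrow> S" using decode_in by auto
    fix U assume "U \<in> {U. openin mtopology U}"
    then have U: "openin mtopology U" by simp
    have "decode -` U \<inter> space bits =
        ({c. good c} \<inter> {c. \<exists>n\<in>{n. cbl n \<subseteq> U}. c n}) \<union> ((- {c. good c}) \<inter> {c. ctr 0 \<in> U})"
    proof (rule Set.set_eqI)
      fix c
      show "c \<in> decode -` U \<inter> space bits \<longleftrightarrow>
          c \<in> ({c. good c} \<inter> {c. \<exists>n\<in>{n. cbl n \<subseteq> U}. c n}) \<union> ((- {c. good c}) \<inter> {c. ctr 0 \<in> U})"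
      proof (cases "good c")
        case True
        then show ?thesis using decode_in_open_iff[OF True U] by (auto simp: space_PiM)
      next
        case False
        then show ?thesis by (simp add: space_PiM decode_def)
      qed
    qed
    moreover have "{c \<in> space bits. \<exists>n\<in>{n. cbl n \<subseteq> U}. c n} \<in> sets bits" by measurable
    then have "{c. \<exists>n\<in>{n. cbl n \<subseteq> U}. c n} \<in> sets bits" by (simp add: space_PiM)
    moreover have "- {c. good c} \<in> sets bits"
      using sets.compl_sets[OF good_sets] by (simp add: space_PiM Compl_eq_Diff_UNIV)
    moreover have "{c. ctr 0 \<in> U} \<in> sets bits"
      using sets.top[of bits] by (cases "ctr 0 \<in> U") (auto simp: space_PiM)
    ultimately show "decode -` U \<inter> space bits \<in> sets bits"
      using good_sets by auto
  qed
  moreover have "sets (sigma S {U. openin mtopology U}) = sets M"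
    unfolding sets_M borel_sets_def using openin_subset by (subst sets_measure_of) fastforce+
  ultimately show ?thesis by (simp cong: measurable_cong_sets)
qed

lemma decode_code:
  assumes y: "y \<in> S"
  shows "decode (code y) = y"
proof -
  have c: "good (code y)"
    unfolding good_def code_def
  proof (intro conjI allI impI)
    fix k
    obtain i where "d (ctr i) y < \<rho> k" using dense[OF y rho_pos] by blast
    then show "\<exists>i. y \<in> bl (prod_encode (k, i))" using y by (auto simp: bl_def cn_def rn_def)
  qed auto
  have "d y (decode (code y)) \<le> e" if e: "0 < e" for e
  proof -
    obtain k where k: "\<rho> k < e / 2" using rho_small[of "e / 2"] e by auto
    obtain i where i: "d (ctr i) y < \<rho> k" using dense[OF y rho_pos] by blast
    then have "code y (prod_encode (k, i))" using y by (simp add: code_def bl_def cn_def rn_def)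
    then have "d (ctr i) (decode (code y)) \<le> \<rho> k"
      using decode_good(2)[OF c, of "prod_encode (k, i)"] by (simp add: cbl_def cn_def rn_def)
    moreover have "d y (decode (code y)) \<le> d y (ctr i) + d (ctr i) (decode (code y))"
      using y ctr decode_in by (intro triangle)
    ultimately show ?thesis using i k commute[of y "ctr i"] by simp
  qed
  then have "d y (decode (code y)) \<le> 0" by (rule dense_ge)
  then show ?thesis using y decode_in[of "code y"] by (metis nonneg order_antisym zero)
qed

section \<open>Measures described by the law of the code\<close>

definition atom :: "bool list \<Rightarrow> 'a set" where
  "atom s = {y \<in> S. map (code y) [0..<length s] = s}"

lemma atom_eq: "atom s = code -` bcyl s \<inter> space M"
  by (auto simp: atom_def bcyl_def space_M)

lemma atom_sets: "atom s \<in> sets M"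
  unfolding atom_eq by (rule measurable_sets[OF measurable_code bcyl_sets])

definition weights :: "'a measure \<Rightarrow> bool list \<Rightarrow> real" where
  "weights p s = measure p (atom s)"

lemma measurable_weights: "(\<lambda>p. weights p s) \<in> borel_measurable (prob_algebra M)"
  unfolding weights_def by (rule measurable_measure_prob_algebra[OF atom_sets])

lemma measurable_code': "p \<in> space (prob_algebra M) \<Longrightarrow> code \<in> p \<rightarrow>\<^sub>M bits"
  using measurable_code by (simp add: space_prob_algebra cong: measurable_cong_sets)

lemma consistent_weights:
  assumes p: "p \<in> space (prob_algebra M)"
  shows "consistent (weights p)"
  unfolding consistent_def
proof (intro conjI allI)
  interpret prob_space p using p by (rule prob_space_prob_algebraD)
  note sp = sets_prob_algebraD[OF p] and spc = space_prob_algebraD[OF p]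
  have "atom [] = space p" by (auto simp: atom_def spc space_M)
  then show "weights p [] = 1" by (simp add: weights_def prob_space)
  fix s
  show "0 \<le> weights p s" by (simp add: weights_def)
  have "atom s = atom (s @ [False]) \<union> atom (s @ [True])" by (auto simp: atom_def)
  moreover have "atom (s @ [False]) \<inter> atom (s @ [True]) = {}" by (auto simp: atom_def)
  ultimately show "weights p s = weights p (s @ [False]) + weights p (s @ [True])"
    unfolding weights_def using atom_sets sp by (metis finite_measure_Union)
qed

lemma tree_measure_weights:
  assumes p: "p \<in> space (prob_algebra M)"
  shows "tree_measure (weights p) = distr p bits code"
proof (rule bits_measure_eqI)
  interpret prob_space p using p by (rule prob_space_prob_algebraD)
  show "finite_measure (tree_measure (weights p))"
    using prob_space_tree_measure prob_space.finite_measure by blast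
  fix s
  have "emeasure (tree_measure (weights p)) (bcyl s) = weights p s"
    by (rule emeasure_tree_measure_bcyl[OF consistent_weights[OF p]])
  also have "\<dots> = emeasure p (atom s)" by (simp add: weights_def emeasure_eq_measure)
  also have "\<dots> = emeasure (distr p bits code) (bcyl s)"
    using measurable_code'[OF p] bcyl_sets space_prob_algebraD[OF p]
    by (simp add: emeasure_distr atom_eq)
  finally show "emeasure (tree_measure (weights p)) (bcyl s) = emeasure (distr p bits code) (bcyl s)" .
qed auto

text \<open>The source space is the same for all weights and only the map depends on v;
  measurability in v thus reduces to the joint measurability of \<open>bits_of\<close>.\<close>

definition realize :: "(bool list \<Rightarrow> real) \<Rightarrow> 'a measure" where
  "realize v = distr unit_uniform M (\<lambda>u. decode (bits_of v u))"

lemma realize_eq: "realize v = distr (tree_measure v) M decode"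
  unfolding realize_def tree_measure_def
  by (subst distr_distr[OF measurable_decode measurable_bits_of_const]) (simp add: comp_def)

lemma realize_weights:
  assumes p: "p \<in> space (prob_algebra M)"
  shows "realize (weights p) = p"
proof -
  have "realize (weights p) = distr p M (decode \<circ> code)"
    unfolding realize_eq tree_measure_weights[OF p]
    by (rule distr_distr[OF measurable_decode measurable_code'[OF p]])
  also have "\<dots> = distr p M (\<lambda>y. y)"
    using decode_code space_prob_algebraD[OF p] by (intro distr_cong) (auto simp: space_M)
  also have "\<dots> = p" using sets_prob_algebraD[OF p] by (intro distr_id2) simp
  finally show ?thesis .
qed

lemma measurable_realize:
  assumes v: "\<And>s. (\<lambda>w. v w s) \<in> borel_measurable N"
  shows "(\<lambda>w. realize (v w)) \<in> N \<rightarrow>\<^sub>M prob_algebra M"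
  unfolding realize_def
proof (rule measurable_distr_prob_space2[where M = unit_uniform])
  show "(\<lambda>w. unit_uniform) \<in> N \<rightarrow>\<^sub>M prob_algebra unit_uniform"
    by (rule measurable_const) (simp add: space_prob_algebra prob_space_unit_uniform)
  have "(\<lambda>z. bits_of (v (fst z)) (snd z)) \<in> N \<Otimes>\<^sub>M unit_uniform \<rightarrow>\<^sub>M bits"
  proof (rule measurable_bits_of)
    show "(\<lambda>z. v (fst z) s) \<in> borel_measurable (N \<Otimes>\<^sub>M unit_uniform)" for s
      by (rule measurable_compose[OF measurable_fst v])
    have "snd \<in> N \<Otimes>\<^sub>M unit_uniform \<rightarrow>\<^sub>M unit_uniform" by (rule measurable_snd)
    then show "snd \<in> borel_measurable (N \<Otimes>\<^sub>M unit_uniform)"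
      by (simp cong: measurable_cong_sets)
  qed
  from measurable_compose[OF this measurable_decode]
  show "(\<lambda>(w, u). decode (bits_of (v w) u)) \<in> N \<Otimes>\<^sub>M unit_uniform \<rightarrow>\<^sub>M M"
    by (simp add: case_prod_beta')
qed

lemma realize_in: "realize v \<in> space (prob_algebra M)"
proof -
  have "(\<lambda>w :: unit. realize v) \<in> count_space UNIV \<rightarrow>\<^sub>M prob_algebra M"
    by (rule measurable_realize) simp
  from measurable_space[OF this, of "()"] show ?thesis by simp
qed

text \<open>Truncating the weights to dyadic integers turns a measure into a point of \<open>nat \<Rightarrow> nat\<close>.\<close>

definition encode :: "'a measure \<Rightarrow> nat \<Rightarrow> nat" where
  "encode p n = nat \<lfloor>2 ^ snd (prod_decode n) * weights p (from_nat (fst (prod_decode n)))\<rfloor>"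

definition undo :: "(nat \<Rightarrow> nat) \<Rightarrow> bool list \<Rightarrow> real" where
  "undo w s = lim (\<lambda>j. real (w (prod_encode (to_nat s, j))) / 2 ^ j)"

lemma undo_encode: "undo (encode p) = weights p"
proof
  fix s
  let ?a = "weights p s"
  have a0: "0 \<le> ?a" by (simp add: weights_def)
  have enc: "real (encode p (prod_encode (to_nat s, j))) = of_int \<lfloor>2 ^ j * ?a\<rfloor>" for j
    using a0 by (simp add: encode_def)
  have "(\<lambda>j. real (encode p (prod_encode (to_nat s, j))) / 2 ^ j) \<longlonglongrightarrow> ?a"
  \<comment> \<open>Truncation at level j errs by at most (1/2)^j.\<close>
  proof (rule tendsto_sandwich[of "\<lambda>j. ?a - (1 / 2) ^ j" _ _ "\<lambda>_. ?a"])
    have "(\<lambda>j. ?a - (1 / 2) ^ j) \<longlonglongrightarrow> ?a - 0"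
      by (intro tendsto_diff tendsto_const LIMSEQ_realpow_zero) auto
    then show "(\<lambda>j. ?a - (1 / 2) ^ j) \<longlonglongrightarrow> ?a" by simp
    show "\<forall>\<^sub>F j in sequentially. ?a - (1 / 2) ^ j \<le> real (encode p (prod_encode (to_nat s, j))) / 2 ^ j"
    proof (rule always_eventually, rule allI)
      fix j
      have "2 ^ j * ?a - 1 \<le> of_int \<lfloor>2 ^ j * ?a\<rfloor>" by linarith
      then have "(2 ^ j * ?a - 1) / 2 ^ j \<le> of_int \<lfloor>2 ^ j * ?a\<rfloor> / 2 ^ j"
        by (rule divide_right_mono) simp
      then show "?a - (1 / 2) ^ j \<le> real (encode p (prod_encode (to_nat s, j))) / 2 ^ j"
        unfolding enc by (simp add: diff_divide_distrib power_one_over)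
    qed
    show "\<forall>\<^sub>F j in sequentially. real (encode p (prod_encode (to_nat s, j))) / 2 ^ j \<le> ?a"
    proof (rule always_eventually, rule allI)
      fix j
      have "of_int \<lfloor>2 ^ j * ?a\<rfloor> \<le> 2 ^ j * ?a" by linarith
      then show "real (encode p (prod_encode (to_nat s, j))) / 2 ^ j \<le> ?a"
        unfolding enc by (simp add: field_simps)
    qed
  qed simp
  then show "undo (encode p) s = ?a" unfolding undo_def by (rule limI)
qed

lemma measurable_undo: "(\<lambda>w. undo w s) \<in> borel_measurable nats"
proof -
  have "(\<lambda>w. real (w n) / 2 ^ j) \<in> borel_measurable nats" for n j
  proof -
    have "(\<lambda>w. w n) \<in> nats \<rightarrow>\<^sub>M count_space UNIV" by (rule measurable_component_singleton) simp
    then have "(\<lambda>w. real (w n)) \<in> borel_measurable nats" by (rule measurable_compose) simp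
    then show ?thesis by simp
  qed
  then show ?thesis unfolding undo_def by (rule borel_measurable_lim_metric)
qed

lemma measurable_encode: "encode \<in> prob_algebra M \<rightarrow>\<^sub>M nats"
proof (rule measurable_PiM_single')
  fix n
  have "(\<lambda>p. \<lfloor>2 ^ snd (prod_decode n) * weights p (from_nat (fst (prod_decode n)))\<rfloor>)
      \<in> prob_algebra M \<rightarrow>\<^sub>M count_space UNIV"
    using measurable_weights by measurable
  from measurable_compose[OF this, of nat "count_space UNIV"]
  show "(\<lambda>p. encode p n) \<in> prob_algebra M \<rightarrow>\<^sub>M count_space UNIV"
    unfolding encode_def by simp
qed auto

lemma realize_encode: "p \<in> space (prob_algebra M) \<Longrightarrow> realize (undo (encode p)) = p"
  by (simp add: undo_encode realize_weights)

lemma inj_on_encode: "inj_on encode (space (prob_algebra M))"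
  by (rule inj_on_inverseI[of _ "\<lambda>w. realize (undo w)"]) (rule realize_encode)

lemma measurable_realize_undo: "(\<lambda>w. realize (undo w)) \<in> nats \<rightarrow>\<^sub>M prob_algebra M"
  by (rule measurable_realize[OF measurable_undo])

text \<open>In (2) this bounds the cardinality of the alternative \<open>Q\<close>, as Ulam's
  theorem requires.\<close>

lemma prob_algebra_lepoll: "space (prob_algebra M) \<lesssim> (UNIV :: nat set set)"
proof -
  let ?h = "\<lambda>w :: nat \<Rightarrow> nat. {prod_encode (n, w n) | n. True}"
  have "inj ?h"
  proof (rule injI, rule ext)
    fix w w' :: "nat \<Rightarrow> nat" and n assume "?h w = ?h w'"
    then have "prod_encode (n, w n) \<in> ?h w'" by blast
    then show "w n = w' n" by auto
  qed
  then have "inj_on (?h \<circ> encode) (space (prob_algebra M))"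
    using inj_on_encode by (intro comp_inj_on) (auto intro: inj_on_subset)
  then show ?thesis unfolding lepoll_def by blast
qed

text \<open>The codes of members of \<open>R\<close> form a measurable set because
  \<open>encode\<close> has a measurable left inverse: a sequence is such a code when it decodes
  into \<open>R\<close> and is the code of what it decodes to.\<close>

theorem uncountable_measurable_family_contains_bits:
  assumes R: "R \<in> sets (prob_algebra M)" and unc: "uncountable R"
  obtains g where "g \<in> bits \<rightarrow>\<^sub>M prob_algebra M" "range g \<subseteq> R" "inj g"
proof -
  have Rs: "R \<subseteq> space (prob_algebra M)" by (rule sets.sets_into_space[OF R])
  let ?f = "\<lambda>w. realize (undo w)"
  define B where "B = ?f -` R \<inter> space nats \<inter> {w. encode (?f w) = w}"
  have "{w \<in> space nats. \<forall>n. encode (?f w) n = w n} \<in> sets nats"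
  proof -
    have "(\<lambda>w. encode (?f w)) \<in> nats \<rightarrow>\<^sub>M nats"
      by (rule measurable_compose[OF measurable_realize_undo measurable_encode])
    then have m[measurable]: "(\<lambda>w. encode (?f w) n) \<in> nats \<rightarrow>\<^sub>M count_space UNIV" for n
      by (rule measurable_compose[OF _ measurable_component_singleton]) simp
    show ?thesis by measurable
  qed
  moreover have "{w \<in> space nats. \<forall>n. encode (?f w) n = w n} = {w. encode (?f w) = w}"
    by (auto simp: space_PiM fun_eq_iff)
  ultimately have B: "B \<in> sets nats"
    unfolding B_def using measurable_sets[OF measurable_realize_undo R] by auto
  have "B = encode ` R"
  proof (intro equalityI subsetI)
    fix w assume "w \<in> encode ` R"
    then obtain p where p: "p \<in> R" "w = encode p" by blast
    then have "?f w = p" using realize_encode Rs by blast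
    then show "w \<in> B" using p by (simp add: B_def space_PiM)
  qed (auto simp: B_def image_iff intro: rev_bexI)
  then have uB: "uncountable B"
    using unc inj_on_subset[OF inj_on_encode Rs] by (simp add: countable_image_inj_eq)
  obtain g where g: "g \<in> bits \<rightarrow>\<^sub>M nats" "range g \<subseteq> B" "inj g"
    using uncountable_measurable_contains_bits[OF B uB] .
  show thesis
  proof (rule that[of "\<lambda>c. ?f (g c)"])
    show "(\<lambda>c. ?f (g c)) \<in> bits \<rightarrow>\<^sub>M prob_algebra M"
      by (rule measurable_compose[OF g(1) measurable_realize_undo])
    show "range (\<lambda>c. ?f (g c)) \<subseteq> R" using g(2) by (auto simp: B_def)
    show "inj (\<lambda>c. ?f (g c))"
    proof (rule injI)
      fix c c' assume eq: "?f (g c) = ?f (g c')"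
      have "g c \<in> B" "g c' \<in> B" using g(2) by blast+
      then have "g c = encode (?f (g c))" "g c' = encode (?f (g c'))" by (simp_all add: B_def)
      then have "g c = g c'" using eq by simp
      then show "c = c'" using g(3) by (rule injD[rotated])
    qed
  qed
qed

end

subsection \<open>The weak topology\<close>

lemma baire_space_eq_euclidean: "baire_space = euclidean"
proof -
  have "discrete_topology (UNIV :: nat set) = euclidean"
    by (rule topology_eq[THEN iffD2]) (simp add: Topological_Spaces.open_discrete)
  then show ?thesis by (simp add: baire_space_def euclidean_product_topology)
qed

lemma sets_nats_eq_borel: "sets nats = sets (borel :: (nat \<Rightarrow> nat) measure)"
proof -
  have "sets (borel :: nat measure) = sets (count_space UNIV)"
    by (auto intro: borel_open simp: Topological_Spaces.open_discrete)
  then have "sets nats = sets (Pi\<^sub>M UNIV (\<lambda>_ :: nat. borel :: nat measure))"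
    by (intro sets_PiM_cong) auto
  then show ?thesis by (simp add: sets_PiM_equal_borel)
qed

text \<open>The sum is a staircase with steps of height \<delta>. The first alternative tracks it
  exactly while it is still below z, which carries the induction through the step where z is
  passed.\<close>

lemma step_sum_bounds:
  fixes z \<delta> :: real
  assumes "0 < \<delta>" "0 \<le> z"
  defines "c N \<equiv> (\<Sum>k\<in>{1..N}. if real k * \<delta> < z then \<delta> else 0)"
  shows "(real N * \<delta> < z \<longrightarrow> c N = real N * \<delta>) \<and> (z \<le> real N * \<delta> \<longrightarrow> z - \<delta> \<le> c N \<and> c N \<le> z)"
proof (induction N)
  case 0
  then show ?case using assms by (auto simp: c_def)
next
  case (Suc N)
  have S: "c (Suc N) = c N + (if real (Suc N) * \<delta> < z then \<delta> else 0)"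
    by (simp add: c_def)
  have d: "real (Suc N) * \<delta> = real N * \<delta> + \<delta>" by (simp add: algebra_simps)
  show ?case
    using Suc assms(1) unfolding S d by (cases "real N * \<delta> < z") auto
qed

context coded_polish
begin

abbreviation "\<Delta> \<equiv> space (prob_algebra M)"
abbreviation "weak \<equiv> weak_topology mtopology M"

lemma measurable_continuous:
  assumes "continuous_map mtopology euclideanreal f"
  shows "f \<in> borel_measurable M"
proof (rule borel_measurableI)
  fix U :: "real set" assume "open U"
  then have "openin mtopology {y \<in> topspace mtopology. f y \<in> U}"
    using assms by (intro openin_continuous_map_preimage) auto
  then show "f -` U \<inter> space M \<in> sets M"
    by (auto dest!: openin_sets simp: space_M Int_def vimage_def conj_commute)
qed

lemma integrable_continuous:
  assumes f: "continuous_map mtopology euclideanreal f" and b: "\<And>y. y \<in> S \<Longrightarrow> \<bar>f y\<bar> \<le> b"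
    and p: "p \<in> \<Delta>"
  shows "integrable p f"
proof -
  interpret prob_space p using p by (rule prob_space_prob_algebraD)
  have "f \<in> borel_measurable p"
    using measurable_continuous[OF f] sets_prob_algebraD[OF p] by (simp cong: measurable_cong_sets)
  then show ?thesis
    using b space_prob_algebraD[OF p] space_M by (intro integrable_const_bound[of _ b]) auto
qed

lemma openin_weak_integral:
  assumes "continuous_map mtopology euclideanreal f" and "\<And>y. y \<in> S \<Longrightarrow> \<bar>f y\<bar> \<le> b" and "open U"
  shows "openin weak {p \<in> \<Delta>. (\<integral>y. f y \<partial>p) \<in> U}"
proof -
  have "bounded (f ` topspace mtopology)"
    using assms(2) unfolding bounded_iff by (intro exI[of _ b]) auto
  then show ?thesis
    unfolding weak_topology_def using assms by (intro topology_generated_by_Basis) auto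
qed

lemma topspace_weak: "topspace weak = \<Delta>"
proof
  show "topspace weak \<subseteq> \<Delta>" by (auto simp: weak_topology_def)
  have "openin weak {p \<in> \<Delta>. (\<integral>y. (0::real) \<partial>p) \<in> UNIV}"
    by (rule openin_weak_integral[of _ 0]) auto
  then show "\<Delta> \<subseteq> topspace weak" using openin_subset by fastforce
qed

text \<open>Bounded continuous functions that tend from below to the indicator of the open set where
  g is positive; they link integrals to masses.\<close>

definition plateau :: "('a \<Rightarrow> real) \<Rightarrow> nat \<Rightarrow> 'a \<Rightarrow> real" where
  "plateau g m y = min 1 (real m * max 0 (g y))"

lemma continuous_plateau:
  assumes "continuous_map mtopology euclideanreal g"
  shows "continuous_map mtopology euclideanreal (plateau g m)"
  unfolding plateau_def using assms by (intro continuous_intros) auto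

lemma plateau_bounded: "\<bar>plateau g m y\<bar> \<le> 1"
  by (auto simp: plateau_def min_def)

lemma plateau_le_indicator: "plateau g m y \<le> indicator {y. 0 < g y} y"
  by (auto simp: plateau_def indicator_def)

lemma plateau_tendsto: "(\<lambda>m. plateau g m y) \<longlonglongrightarrow> indicator {y. 0 < g y} y"
proof (cases "0 < g y")
  case True
  obtain N where N: "1 / g y < real N" using reals_Archimedean2 by blast
  have "plateau g m y = 1" if "N \<le> m" for m
  proof -
    have "1 / g y < real m" using N that by simp
    then have "1 \<le> real m * g y" using True by (simp add: field_simps)
    then show ?thesis using True by (simp add: plateau_def)
  qed
  then have "\<forall>\<^sub>F m in sequentially. plateau g m y = 1"
    by (auto simp: eventually_sequentially)
  then show ?thesis using True by (simp add: tendsto_eventually)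
next
  case False
  then show ?thesis by (simp add: plateau_def)
qed

lemma cozero_sets:
  assumes "continuous_map mtopology euclideanreal g"
  shows "{y \<in> S. 0 < g y} \<in> sets M"
  using measurable_continuous[OF assms] unfolding space_M[symmetric] by measurable

lemma
  assumes g: "continuous_map mtopology euclideanreal g" and p: "p \<in> \<Delta>"
  shows plateau_integral_tendsto: "(\<lambda>m. \<integral>y. plateau g m y \<partial>p) \<longlonglongrightarrow> measure p {y \<in> S. 0 < g y}"
    and plateau_integral_le: "(\<integral>y. plateau g m y \<partial>p) \<le> measure p {y \<in> S. 0 < g y}"
proof -
  interpret prob_space p using p by (rule prob_space_prob_algebraD)
  note sp = sets_prob_algebraD[OF p] and spc = space_prob_algebraD[OF p]
  have U: "{y \<in> S. 0 < g y} \<in> sets p" using cozero_sets[OF g] sp by simp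
  have meas: "plateau g m \<in> borel_measurable p" for m
    using measurable_continuous[OF continuous_plateau[OF g]] sp by (simp cong: measurable_cong_sets)
  have ind: "(\<integral>y. indicator {y \<in> S. 0 < g y} y \<partial>p) = measure p {y \<in> S. 0 < g y}"
    using U by simp
  have iU: "integrable p (indicator {y \<in> S. 0 < g y} :: 'a \<Rightarrow> real)"
    using U by (simp add: less_top[symmetric])
  have eqi: "indicator {y. 0 < g y} y = (indicator {y \<in> S. 0 < g y} y :: real)" if "y \<in> space p" for y
    using that spc space_M by (simp add: indicator_def)
  have "(\<lambda>m. \<integral>y. plateau g m y \<partial>p) \<longlonglongrightarrow> (\<integral>y. indicator {y \<in> S. 0 < g y} y \<partial>p)"
  proof (rule integral_dominated_convergence[where w = "\<lambda>_. 1"])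
    show "AE y in p. (\<lambda>m. plateau g m y) \<longlonglongrightarrow> indicator {y \<in> S. 0 < g y} y"
      using plateau_tendsto[of g] eqi by (intro AE_I2) metis
    show "AE y in p. norm (plateau g m y) \<le> 1" for m
      using plateau_bounded by (intro AE_I2) simp
  qed (use iU meas in auto)
  then show "(\<lambda>m. \<integral>y. plateau g m y \<partial>p) \<longlonglongrightarrow> measure p {y \<in> S. 0 < g y}"
    unfolding ind .
  have "(\<integral>y. plateau g m y \<partial>p) \<le> (\<integral>y. indicator {y \<in> S. 0 < g y} y \<partial>p)"
  proof (rule integral_mono)
    show "integrable p (plateau g m)"
      by (rule integrable_continuous[OF continuous_plateau[OF g] plateau_bounded p])
    show "plateau g m y \<le> indicator {y \<in> S. 0 < g y} y" if "y \<in> space p" for y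
      using plateau_le_indicator[of g m y] eqi[OF that] by simp
  qed (rule iU)
  then show "(\<integral>y. plateau g m y \<partial>p) \<le> measure p {y \<in> S. 0 < g y}" unfolding ind .
qed

text \<open>Plateau integrals stay below the mass and tend to it, so the mass exceeds r when one of
  these integrals does.\<close>

lemma openin_weak_cozero:
  assumes g: "continuous_map mtopology euclideanreal g"
  shows "openin weak {p \<in> \<Delta>. r < measure p {y \<in> S. 0 < g y}}"
proof -
  have "{p \<in> \<Delta>. r < measure p {y \<in> S. 0 < g y}} = (\<Union>m. {p \<in> \<Delta>. (\<integral>y. plateau g m y \<partial>p) \<in> {r<..}})"
  proof (intro equalityI subsetI)
    fix p assume "p \<in> {p \<in> \<Delta>. r < measure p {y \<in> S. 0 < g y}}"
    then have p: "p \<in> \<Delta>" and r: "r < measure p {y \<in> S. 0 < g y}" by auto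
    have "\<forall>\<^sub>F m in sequentially. r < (\<integral>y. plateau g m y \<partial>p)"
      by (rule order_tendstoD(1)[OF plateau_integral_tendsto[OF g p] r])
    then obtain m where "r < (\<integral>y. plateau g m y \<partial>p)"
      using eventually_happens'[OF sequentially_bot] by blast
    then show "p \<in> (\<Union>m. {p \<in> \<Delta>. (\<integral>y. plateau g m y \<partial>p) \<in> {r<..}})" using p by auto
  next
    fix p assume "p \<in> (\<Union>m. {p \<in> \<Delta>. (\<integral>y. plateau g m y \<partial>p) \<in> {r<..}})"
    then obtain m where p: "p \<in> \<Delta>" and m: "r < (\<integral>y. plateau g m y \<partial>p)" by auto
    then show "p \<in> {p \<in> \<Delta>. r < measure p {y \<in> S. 0 < g y}}"
      using plateau_integral_le[OF g p, of m] by simp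
  qed
  then show ?thesis
    using openin_weak_integral[OF continuous_plateau[OF g] plateau_bounded open_greaterThan]
    by (simp only: openin_clauses(3)[of "range _"]) (auto intro!: openin_Union)
qed

lemma continuous_dist:
  assumes a: "a \<in> S"
  shows "continuous_map mtopology euclideanreal (d a)"
proof -
  have "\<exists>U. openin mtopology U \<and> y \<in> U \<and> (\<forall>z\<in>U. \<bar>d a z - d a y\<bar> < e)" if y: "y \<in> S" and e: "0 < e" for y e
  proof (intro exI conjI ballI)
    show "openin mtopology (mball y e)" by simp
    show "y \<in> mball y e" using y e by simp
    fix z assume "z \<in> mball y e"
    then have z: "z \<in> S" "d y z < e" by auto
    then show "\<bar>d a z - d a y\<bar> < e"
      using triangle[OF a y z(1)] triangle[OF a z(1) y] commute[of z y] by (simp add: abs_less_iff)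
  qed
  then have "continuous_map mtopology (Met_TC.mtopology :: real topology) (d a)"
    unfolding Met_TC.continuous_map_to_metric by (auto simp: dist_real_def abs_minus_commute)
  then show ?thesis by simp
qed

definition bump :: "nat set \<Rightarrow> 'a \<Rightarrow> real" where
  "bump F y = (\<Sum>n\<in>F. max 0 (rn n - d (cn n) y))"

lemma continuous_bump: "finite F \<Longrightarrow> continuous_map mtopology euclideanreal (bump F)"
  unfolding bump_def
  by (intro continuous_map_sum continuous_map_real_max continuous_map_diff)
    (auto intro: continuous_dist cn_in)

lemma bump_pos:
  assumes "finite F"
  shows "{y \<in> S. 0 < bump F y} = (\<Union>n\<in>F. bl n)"
proof (intro equalityI subsetI)
  fix y assume "y \<in> {y \<in> S. 0 < bump F y}"
  then have y: "y \<in> S" "bump F y \<noteq> 0" by auto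
  then obtain n where "n \<in> F" and "max 0 (rn n - d (cn n) y) \<noteq> 0"
    unfolding bump_def by (meson sum.neutral)
  then have "y \<in> bl n" using y by (auto simp: bl_def max_def split: if_splits)
  then show "y \<in> (\<Union>n\<in>F. bl n)" using \<open>n \<in> F\<close> by blast
next
  fix y assume "y \<in> (\<Union>n\<in>F. bl n)"
  then obtain n where n: "n \<in> F" "y \<in> bl n" by blast
  then have "0 < bump F y"
    unfolding bump_def using assms by (intro sum_pos2[of F n]) (auto simp: bl_def)
  then show "y \<in> {y \<in> S. 0 < bump F y}" using n by (auto simp: bl_def)
qed

lemma openin_weak_UN_bl:
  "finite F \<Longrightarrow> openin weak {p \<in> \<Delta>. r < measure p (\<Union>n\<in>F. bl n)}"
  using openin_weak_cozero[OF continuous_bump, of F r] bump_pos[of F] by simp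

lemma UN_bl_sets: "(\<Union>n\<in>F. bl n) \<in> sets M"
  using bl_sets by (intro sets.countable_UN') auto

lemma measure_open_tendsto:
  assumes U: "openin mtopology U" and p: "p \<in> \<Delta>"
  shows "(\<lambda>N. measure p (\<Union>n\<in>{n. n < N \<and> bl n \<subseteq> U}. bl n)) \<longlonglongrightarrow> measure p U"
proof -
  interpret prob_space p using p by (rule prob_space_prob_algebraD)
  let ?A = "\<lambda>N. \<Union>n\<in>{n. n < N \<and> bl n \<subseteq> U}. bl n"
  have "(\<lambda>N. measure p (?A N)) \<longlonglongrightarrow> measure p (\<Union>N. ?A N)"
  proof (rule finite_Lim_measure_incseq)
    show "range ?A \<subseteq> events" using UN_bl_sets sets_prob_algebraD[OF p] by auto
    show "incseq ?A" unfolding incseq_def by (intro allI impI UN_mono) auto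
  qed
  moreover have "(\<Union>N. ?A N) = U"
    by (subst (2) open_eq_UN_bl[OF U]) blast
  ultimately show ?thesis by simp
qed

lemma sets_M_sigma: "sets M = sigma_sets S {U. openin mtopology U}"
  by (simp add: sets_M borel_sets_def)

lemma Int_stable_openin: "Int_stable {U. openin mtopology U}"
  by (auto simp: Int_stable_def)

text \<open>Finite unions of balls exhaust every open set from below, so their masses determine
  those of open sets by limits; the open sets are a generator stable under intersection.\<close>

lemma measurable_family:
  assumes K: "\<And>a. a \<in> space N \<Longrightarrow> K a \<in> \<Delta>"
    and meas: "\<And>F. finite F \<Longrightarrow> (\<lambda>a. measure (K a) (\<Union>n\<in>F. bl n)) \<in> borel_measurable N"
  shows "K \<in> N \<rightarrow>\<^sub>M prob_algebra M"
proof (rule measurable_prob_algebra_generated[OF sets_M_sigma Int_stable_openin])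
  show "{U. openin mtopology U} \<subseteq> Pow S" using openin_subset by fastforce
  fix U assume "U \<in> {U. openin mtopology U}"
  then have U: "openin mtopology U" by simp
  have "(\<lambda>a. measure (K a) U) \<in> borel_measurable N"
  proof (rule borel_measurable_LIMSEQ_real)
    show "(\<lambda>N. measure (K a) (\<Union>n\<in>{n. n < N \<and> bl n \<subseteq> U}. bl n)) \<longlonglongrightarrow> measure (K a) U"
      if "a \<in> space N" for a
      by (rule measure_open_tendsto[OF U K[OF that]])
  qed (rule meas, simp)
  then have m: "(\<lambda>a. ennreal (measure (K a) U)) \<in> borel_measurable N" by simp
  have e: "ennreal (measure (K a) U) = emeasure (K a) U" if "a \<in> space N" for a
  proof -
    interpret prob_space "K a" using K[OF that] by (rule prob_space_prob_algebraD)
    show ?thesis by (simp add: emeasure_eq_measure)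
  qed
  show "(\<lambda>a. emeasure (K a) U) \<in> borel_measurable N"
    using m measurable_cong[of N "\<lambda>a. ennreal (measure (K a) U)" "\<lambda>a. emeasure (K a) U", OF e] by blast
qed (use prob_space_prob_algebraD[OF K] sets_prob_algebraD[OF K] in auto)

text \<open>Masses of finite unions of balls are limits of plateau integrals. Its use is
  contrapositive: two different measures are told apart by a single bounded continuous
  function.\<close>

lemma prob_eqI:
  assumes p: "p \<in> \<Delta>" and q: "q \<in> \<Delta>"
    and eq: "\<And>f. continuous_map mtopology euclideanreal f \<Longrightarrow> (\<And>y. \<bar>f y\<bar> \<le> 1) \<Longrightarrow> (\<integral>y. f y \<partial>p) = (\<integral>y. f y \<partial>q)"
  shows "p = q"
proof -
  interpret p: prob_space p using p by (rule prob_space_prob_algebraD)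
  interpret q: prob_space q using q by (rule prob_space_prob_algebraD)
  have F: "measure p (\<Union>n\<in>F. bl n) = measure q (\<Union>n\<in>F. bl n)" if "finite F" for F
  proof -
    note c = continuous_bump[OF that]
    have "(\<integral>y. plateau (bump F) m y \<partial>p) = (\<integral>y. plateau (bump F) m y \<partial>q)" for m
      by (rule eq[OF continuous_plateau[OF c] plateau_bounded])
    then have "(\<lambda>m. \<integral>y. plateau (bump F) m y \<partial>p) \<longlonglongrightarrow> measure q {y \<in> S. 0 < bump F y}"
      using plateau_integral_tendsto[OF c q] by simp
    from LIMSEQ_unique[OF this plateau_integral_tendsto[OF c p]] show ?thesis
      using bump_pos[OF that] by simp
  qed
  have U: "emeasure p U = emeasure q U" if "openin mtopology U" for U
  proof -
    have "(\<lambda>N. measure p (\<Union>n\<in>{n. n < N \<and> bl n \<subseteq> U}. bl n)) \<longlonglongrightarrow> measure q U"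
      using measure_open_tendsto[OF that q] F by simp
    from LIMSEQ_unique[OF this measure_open_tendsto[OF that p]] show ?thesis
      by (simp add: p.emeasure_eq_measure q.emeasure_eq_measure)
  qed
  show ?thesis
  proof (rule measure_eqI_generator_eq[OF Int_stable_openin, where A = "\<lambda>_. S" and \<Omega> = S])
    show "{U. openin mtopology U} \<subseteq> Pow S" using openin_subset by fastforce
    show "sets p = sigma_sets S {U. openin mtopology U}" "sets q = sigma_sets S {U. openin mtopology U}"
      using p q sets_M_sigma by (auto dest: sets_prob_algebraD)
    show "range (\<lambda>_. S) \<subseteq> {U. openin mtopology U}" by auto
  qed (use U in auto)
qed

text \<open>An analytic family need not be measurable, so its parametrisation takes the place of the
  coding. Different measures differ in the integral of some bounded continuous function, and
  disjoint open sets around the two integrals pull back to cylinders with disjoint images.\<close>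

theorem uncountable_analytic_contains_bits:
  assumes R: "analytic_in weak R" and unc: "uncountable R"
  obtains g where "g \<in> bits \<rightarrow>\<^sub>M prob_algebra M" "range g \<subseteq> R" "inj g"
proof -
  obtain f :: "(nat \<Rightarrow> nat) \<Rightarrow> 'a measure" where f: "continuous_map euclidean weak f" and fR: "f ` UNIV = R"
  proof -
    have "R \<noteq> {}" using unc by auto
    then have "\<exists>f :: (nat \<Rightarrow> nat) \<Rightarrow> 'a measure. continuous_map euclidean weak f \<and> f ` UNIV = R"
      using R unfolding analytic_in_def baire_space_eq_euclidean topspace_euclidean by simp
    then show thesis using that by (elim exE conjE)
  qed
  have f\<Delta>: "f w \<in> \<Delta>" for w
    using continuous_map_funspace[OF f] by (auto simp: topspace_weak)
  have pre: "open {w. f w \<in> W}" if "openin weak W" for W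
    using openin_continuous_map_preimage[OF f that] by simp
  obtain g where g: "g \<in> bits \<rightarrow>\<^sub>M nats" "inj (\<lambda>c. f (g c))"
  proof (rule cantor_scheme[OF closed_UNIV, of f], intro ballI impI)
    fix x y assume "f x \<noteq> f y"
    then obtain h where h: "continuous_map mtopology euclideanreal h" "\<And>y. \<bar>h y\<bar> \<le> 1"
      and ne: "(\<integral>z. h z \<partial>f x) \<noteq> (\<integral>z. h z \<partial>f y)"
      using prob_eqI[OF f\<Delta> f\<Delta>, of x y] by blast
    obtain U V where UV: "open U" "open V" "(\<integral>z. h z \<partial>f x) \<in> U" "(\<integral>z. h z \<partial>f y) \<in> V" "U \<inter> V = {}"
      using hausdorff[OF ne] by blast
    have o: "open {w. f w \<in> {p \<in> \<Delta>. (\<integral>z. h z \<partial>p) \<in> W}}" if "open W" for W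
      by (rule pre[OF openin_weak_integral[OF h that]])
    obtain m where m: "{z. \<forall>i<m. z i = x i} \<subseteq> {w. f w \<in> {p \<in> \<Delta>. (\<integral>z. h z \<partial>p) \<in> U}}"
      using open_nat_fun_contains_nbhd[OF o[OF UV(1)], of x] UV(3) f\<Delta> by blast
    obtain m' where m': "{z. \<forall>i<m'. z i = y i} \<subseteq> {w. f w \<in> {p \<in> \<Delta>. (\<integral>z. h z \<partial>p) \<in> V}}"
      using open_nat_fun_contains_nbhd[OF o[OF UV(2)], of y] UV(4) f\<Delta> by blast
    let ?n = "max m m'"
    have "f a \<noteq> f b" if "a \<in> cyl (map x [0..<?n])" "b \<in> cyl (map y [0..<?n])" for a b
    proof -
      have "a \<in> {z. \<forall>i<m. z i = x i}" "b \<in> {z. \<forall>i<m'. z i = y i}"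
        using that by (auto simp: cyl_map)
      then have "(\<integral>z. h z \<partial>f a) \<in> U" "(\<integral>z. h z \<partial>f b) \<in> V" using m m' by blast+
      then show ?thesis using UV(5) by auto
    qed
    then have "f ` (UNIV \<inter> cyl (map x [0..<?n])) \<inter> f ` (UNIV \<inter> cyl (map y [0..<?n])) = {}"
      by auto
    then show "\<exists>n. f ` (UNIV \<inter> cyl (map x [0..<n])) \<inter> f ` (UNIV \<inter> cyl (map y [0..<n])) = {}" ..
  next
    show "uncountable (range f)" using unc fR by simp
  next
    fix g assume "g \<in> bits \<rightarrow>\<^sub>M nats" "range g \<subseteq> (UNIV :: (nat \<Rightarrow> nat) set)" "inj (\<lambda>c. f (g c))"
    then show thesis using that by blast
  qed
  \<comment> \<open>Continuity of the parametrisation makes the masses of finite unions of balls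
    lower semicontinuous, hence measurable.\<close>
  have "f \<in> nats \<rightarrow>\<^sub>M prob_algebra M"
  proof (rule measurable_family)
    show "f w \<in> \<Delta>" for w by (rule f\<Delta>)
    fix F :: "nat set" assume F: "finite F"
    show "(\<lambda>w. measure (f w) (\<Union>n\<in>F. bl n)) \<in> borel_measurable nats"
      unfolding borel_measurable_iff_greater
    proof
      fix r
      have "open {w. f w \<in> {p \<in> \<Delta>. r < measure p (\<Union>n\<in>F. bl n)}}"
        by (rule pre[OF openin_weak_UN_bl[OF F]])
      then have "{w. r < measure (f w) (\<Union>n\<in>F. bl n)} \<in> sets nats"
        using f\<Delta> by (simp add: sets_nats_eq_borel)
      then show "{w \<in> space nats. r < measure (f w) (\<Union>n\<in>F. bl n)} \<in> sets nats"
        by (simp add: space_PiM)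
    qed
  qed
  from measurable_compose[OF g(1) this] show thesis
    using that g(2) fR by blast
qed

section \<open>Basic neighbourhoods for the weak topology, reduced to countably many\<close>

definition nbhd :: "('a set \<times> real) set \<Rightarrow> 'a measure set" where
  "nbhd K = {q \<in> \<Delta>. \<forall>(U, r)\<in>K. r < measure q U}"

text \<open>Portmanteau in neighbourhood form: f + B is within \<delta> of a staircase built from
  indicators of the open sets \<open>U k\<close>, so lower bounds on finitely many masses bound the
  integral from below.\<close>

lemma integral_greater_nbhd:
  assumes f: "continuous_map mtopology euclideanreal f" and b: "\<And>y. y \<in> S \<Longrightarrow> \<bar>f y\<bar> \<le> b"
    and p: "p \<in> \<Delta>" and a: "a < (\<integral>y. f y \<partial>p)"
  obtains K where "finite K" "\<And>U r. (U, r) \<in> K \<Longrightarrow> openin mtopology U" "p \<in> nbhd K"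
    "\<And>q. q \<in> nbhd K \<Longrightarrow> a < (\<integral>y. f y \<partial>q)"
proof -
  define B where "B = max b 1"
  have B: "0 < B" "\<And>y. y \<in> S \<Longrightarrow> \<bar>f y\<bar> \<le> B" using b by (fastforce simp: B_def)+
  \<comment> \<open>The gap is divided into three: one third pays for the staircase, one for the
    loss in the masses, and the last keeps the inequality strict.\<close>
  define \<epsilon> where "\<epsilon> = ((\<integral>y. f y \<partial>p) - a) / 3"
  have \<epsilon>: "0 < \<epsilon>" using a by (simp add: \<epsilon>_def)
  obtain N where N: "2 * B / \<epsilon> < real N" using reals_Archimedean2 by blast
  have "0 < 2 * B / \<epsilon>" using B \<epsilon> by simp
  then have N0: "0 < real N" using N by linarith
  define \<delta> where "\<delta> = 2 * B / real N"
  have \<delta>: "0 < \<delta>" "\<delta> < \<epsilon>" "real N * \<delta> = 2 * B"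
    using B N N0 \<epsilon> by (auto simp: \<delta>_def field_simps)
  define U where "U k = {y \<in> S. 0 < f y + B - real k * \<delta>}" for k
  have cU: "continuous_map mtopology euclideanreal (\<lambda>y. f y + B - real k * \<delta>)" for k
    using f by (intro continuous_intros) auto
  have U: "openin mtopology (U k)" for k
  proof -
    have "openin mtopology {y \<in> topspace mtopology. f y + B - real k * \<delta> \<in> {0<..}}"
      by (rule openin_continuous_map_preimage[OF cU]) auto
    then show ?thesis by (simp add: U_def)
  qed
  define s where "s y = (\<Sum>k\<in>{1..N}. \<delta> * indicator (U k) y)" for y
  have s: "s y \<le> f y + B \<and> f y + B - \<delta> \<le> s y" if y: "y \<in> S" for y
  proof -
    have z: "0 \<le> f y + B" "f y + B \<le> real N * \<delta>" using B(2)[OF y] \<delta>(3) by auto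
    have "s y = (\<Sum>k\<in>{1..N}. if real k * \<delta> < f y + B then \<delta> else 0)"
      unfolding s_def using y by (intro sum.cong) (auto simp: U_def indicator_def)
    then show ?thesis using step_sum_bounds[OF \<delta>(1) z(1), of N] z(2) by simp
  qed
  have int: "(\<integral>y. f y \<partial>q) \<le> \<delta> * (\<Sum>k\<in>{1..N}. measure q (U k)) + \<delta> - B \<and>
      \<delta> * (\<Sum>k\<in>{1..N}. measure q (U k)) - B \<le> (\<integral>y. f y \<partial>q)" if q: "q \<in> \<Delta>" for q
  proof -
    interpret q: prob_space q using q by (rule prob_space_prob_algebraD)
    have Uq: "U k \<in> sets q" for k using openin_sets[OF U] sets_prob_algebraD[OF q] by simp
    have iU: "integrable q (indicator (U k) :: 'a \<Rightarrow> real)" for k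
      using Uq by (simp add: less_top[symmetric])
    have int_s: "integrable q s"
      unfolding s_def using iU by (intro Bochner_Integration.integrable_sum integrable_mult_right) auto
    have int_f: "integrable q f" by (rule integrable_continuous[OF f B(2) q])
    have "(\<integral>y. s y \<partial>q) = (\<Sum>k\<in>{1..N}. \<integral>y. \<delta> * indicator (U k) y \<partial>q)"
      unfolding s_def using iU by (intro Bochner_Integration.integral_sum integrable_mult_right) auto
    also have "\<dots> = \<delta> * (\<Sum>k\<in>{1..N}. measure q (U k))"
      using Uq by (simp add: sum_distrib_left)
    finally have sq: "(\<integral>y. s y \<partial>q) = \<delta> * (\<Sum>k\<in>{1..N}. measure q (U k))" .
    have "(\<integral>y. f y \<partial>q) \<le> (\<integral>y. s y + (\<delta> - B) \<partial>q)"
      using s int_s int_f space_prob_algebraD[OF q] space_M by (intro integral_mono) force+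
    also have "\<dots> = (\<integral>y. s y \<partial>q) + (\<delta> - B)" using int_s by (simp add: q.prob_space)
    finally have 1: "(\<integral>y. f y \<partial>q) \<le> (\<integral>y. s y \<partial>q) + (\<delta> - B)" .
    have "(\<integral>y. s y \<partial>q) - B = (\<integral>y. s y - B \<partial>q)" using int_s by (simp add: q.prob_space)
    also have "\<dots> \<le> (\<integral>y. f y \<partial>q)"
      using s int_s int_f space_prob_algebraD[OF q] space_M by (intro integral_mono) force+
    finally show ?thesis using 1 sq by simp
  qed
  \<comment> \<open>Each of the N masses may drop by \<eta> and enters with weight \<delta>; as N
    times \<delta> is 2 B, the total loss is \<epsilon>.\<close>
  define \<eta> where "\<eta> = \<epsilon> / (2 * B)"
  have \<eta>: "0 < \<eta>" using \<epsilon> B by (simp add: \<eta>_def)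
  define K where "K = (\<lambda>k. (U k, measure p (U k) - \<eta>)) ` {1..N}"
  show thesis
  proof (rule that[of K])
    show "finite K" by (simp add: K_def)
    show "openin mtopology V" if "(V, r) \<in> K" for V r using that U by (auto simp: K_def)
    show "p \<in> nbhd K" using p \<eta> by (auto simp: nbhd_def K_def)
    fix q assume q: "q \<in> nbhd K"
    then have q\<Delta>: "q \<in> \<Delta>" by (simp add: nbhd_def)
    have "(\<Sum>k\<in>{1..N}. measure p (U k) - \<eta>) \<le> (\<Sum>k\<in>{1..N}. measure q (U k))"
      using q by (intro sum_mono) (auto simp: nbhd_def K_def intro: less_imp_le)
    then have "(\<Sum>k\<in>{1..N}. measure p (U k)) - real N * \<eta> \<le> (\<Sum>k\<in>{1..N}. measure q (U k))"
      by (simp add: sum_subtractf)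
    then have "\<delta> * ((\<Sum>k\<in>{1..N}. measure p (U k)) - real N * \<eta>) \<le> \<delta> * (\<Sum>k\<in>{1..N}. measure q (U k))"
      using \<delta>(1) by (intro mult_left_mono) auto
    moreover have "\<delta> * (real N * \<eta>) = \<epsilon>"
      using \<delta>(3) B by (simp add: \<eta>_def mult.commute mult.left_commute) (simp add: field_simps)
    ultimately have "\<delta> * (\<Sum>k\<in>{1..N}. measure p (U k)) - \<epsilon> \<le> \<delta> * (\<Sum>k\<in>{1..N}. measure q (U k))"
      by (simp add: right_diff_distrib)
    then have "(\<integral>y. f y \<partial>p) - \<delta> - \<epsilon> \<le> (\<integral>y. f y \<partial>q)"
      using int[OF p] int[OF q\<Delta>] by linarith
    moreover have "(\<integral>y. f y \<partial>p) = a + 3 * \<epsilon>" by (simp add: \<epsilon>_def field_simps)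
    ultimately show "a < (\<integral>y. f y \<partial>q)" using \<delta>(2) \<epsilon> by linarith
  qed
qed

lemma nbhd_Un: "nbhd (K \<union> L) = nbhd K \<inter> nbhd L"
  by (auto simp: nbhd_def)

text \<open>At a generator, the lower bounds for f and for -f together confine the integral to a
  ball around its value at p; the generated topology is then treated by induction.\<close>

lemma weak_open_contains_nbhd:
  assumes W: "openin weak W" and p: "p \<in> W"
  shows "\<exists>K. finite K \<and> (\<forall>(U, r)\<in>K. openin mtopology U) \<and> p \<in> nbhd K \<and> nbhd K \<subseteq> W"
proof -
  have "generate_topology_on {{\<mu> \<in> \<Delta>. (\<integral>x. f x \<partial>\<mu>) \<in> U} | f U.
     continuous_map mtopology euclideanreal f \<and> bounded (f ` topspace mtopology) \<and> open U} W"
    using W unfolding weak_topology_def by (rule openin_topology_generated_by)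
  then show ?thesis using p
  proof (induction arbitrary: p)
    case Empty
    then show ?case by simp
  next
    case (Int V W)
    obtain K where "finite K" "\<forall>(U, r)\<in>K. openin mtopology U" "p \<in> nbhd K" "nbhd K \<subseteq> V"
      using Int.IH(1)[of p] Int.prems by blast
    moreover obtain L where "finite L" "\<forall>(U, r)\<in>L. openin mtopology U" "p \<in> nbhd L" "nbhd L \<subseteq> W"
      using Int.IH(2)[of p] Int.prems by blast
    ultimately show ?case by (intro exI[of _ "K \<union> L"]) (auto simp: nbhd_Un)
  next
    case (UN \<W>)
    then obtain V where "V \<in> \<W>" "p \<in> V" by blast
    with UN.IH[of V p] show ?case by blast
  next
    case (Basis s)
    then obtain f U where s: "s = {\<mu> \<in> \<Delta>. (\<integral>x. f x \<partial>\<mu>) \<in> U}"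
      and f: "continuous_map mtopology euclideanreal f" "bounded (f ` topspace mtopology)" and "open U"
      by blast
    have p: "p \<in> \<Delta>" "(\<integral>x. f x \<partial>p) \<in> U" using Basis s by auto
    obtain b where b: "\<And>y. y \<in> S \<Longrightarrow> \<bar>f y\<bar> \<le> b" using f(2) by (auto simp: bounded_iff)
    obtain e where e: "0 < e" "ball (\<integral>x. f x \<partial>p) e \<subseteq> U" using \<open>open U\<close> p(2) open_contains_ball by blast
    obtain K where K: "finite K" "\<And>U r. (U, r) \<in> K \<Longrightarrow> openin mtopology U" "p \<in> nbhd K"
      "\<And>q. q \<in> nbhd K \<Longrightarrow> (\<integral>x. f x \<partial>p) - e < (\<integral>x. f x \<partial>q)"
      using integral_greater_nbhd[OF f(1) b p(1), of "(\<integral>x. f x \<partial>p) - e"] e(1) by auto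
    have f': "continuous_map mtopology euclideanreal (\<lambda>x. - f x)" using f(1) by simp
    obtain L where L: "finite L" "\<And>U r. (U, r) \<in> L \<Longrightarrow> openin mtopology U" "p \<in> nbhd L"
      "\<And>q. q \<in> nbhd L \<Longrightarrow> - (\<integral>x. f x \<partial>p) - e < (\<integral>x. - f x \<partial>q)"
      using integral_greater_nbhd[OF f' _ p(1), of b "- (\<integral>x. f x \<partial>p) - e"] b e(1) by auto
    have "nbhd (K \<union> L) \<subseteq> s"
    proof
      fix q assume q: "q \<in> nbhd (K \<union> L)"
      then have "(\<integral>x. f x \<partial>q) \<in> ball (\<integral>x. f x \<partial>p) e"
        using K(4)[of q] L(4)[of q] by (auto simp: nbhd_Un dist_real_def)
      then show "q \<in> s" using e(2) q by (auto simp: s nbhd_def)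
    qed
    then show ?case using K L by (intro exI[of _ "K \<union> L"]) (auto simp: nbhd_Un)
  qed
qed

text \<open>Finite unions of balls and rational bounds, in lists, so that there are only countably
  many of these sets; weakly open sets become countable unions of measurable ones.\<close>

definition cnbhd :: "(nat list \<times> rat) list \<Rightarrow> 'a measure set" where
  "cnbhd L = {q \<in> \<Delta>. \<forall>(F, r)\<in>set L. of_rat r < measure q (\<Union>n\<in>set F. bl n)}"

lemma cnbhd_sets: "cnbhd L \<in> sets (prob_algebra M)"
proof -
  have [measurable]: "(\<lambda>q. measure q (\<Union>n\<in>set F. bl n)) \<in> borel_measurable (prob_algebra M)" for F
    by (rule measurable_measure_prob_algebra[OF UN_bl_sets])
  show ?thesis
    unfolding cnbhd_def case_prod_beta' by measurable
qed

lemma nbhd_contains_cnbhd: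
  assumes "finite K" "\<forall>(U, r)\<in>K. openin mtopology U" "p \<in> nbhd K"
  shows "\<exists>L. p \<in> cnbhd L \<and> cnbhd L \<subseteq> nbhd K"
  using assms
proof (induction K)
  case empty
  then show ?case by (intro exI[of _ "[]"]) (auto simp: cnbhd_def nbhd_def)
next
  case (insert k K)
  obtain U r where k: "k = (U, r)" by (cases k)
  have "p \<in> nbhd K" using insert.prems by (auto simp: nbhd_def)
  then obtain L where L: "p \<in> cnbhd L" "cnbhd L \<subseteq> nbhd K" using insert by auto
  have U: "openin mtopology U" and p: "p \<in> \<Delta>" and r: "r < measure p U"
    using insert.prems by (auto simp: k nbhd_def)
  obtain r' where r': "r < of_rat r'" "of_rat r' < measure p U" using of_rat_dense[OF r] by blast
  have "\<forall>\<^sub>F N in sequentially. of_rat r' < measure p (\<Union>n\<in>{n. n < N \<and> bl n \<subseteq> U}. bl n)"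
    by (rule order_tendstoD(1)[OF measure_open_tendsto[OF U p] r'(2)])
  then obtain N where N: "of_rat r' < measure p (\<Union>n\<in>{n. n < N \<and> bl n \<subseteq> U}. bl n)"
    using eventually_happens'[OF sequentially_bot] by blast
  obtain F where F: "set F = {n. n < N \<and> bl n \<subseteq> U}"
    using finite_list[of "{n. n < N \<and> bl n \<subseteq> U}"] by auto
  have "p \<in> cnbhd ((F, r') # L)" using L(1) N F by (auto simp: cnbhd_def)
  moreover have "cnbhd ((F, r') # L) \<subseteq> nbhd (insert k K)"
  proof
    fix q assume q: "q \<in> cnbhd ((F, r') # L)"
    then have q\<Delta>: "q \<in> \<Delta>" and qF: "of_rat r' < measure q (\<Union>n\<in>set F. bl n)" and qL: "q \<in> cnbhd L"
      by (auto simp: cnbhd_def)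
    interpret q: prob_space q using q\<Delta> by (rule prob_space_prob_algebraD)
    have "measure q (\<Union>n\<in>set F. bl n) \<le> measure q U"
      using F openin_sets[OF U] sets_prob_algebraD[OF q\<Delta>] by (intro q.finite_measure_mono) auto
    then have "r < measure q U" using qF r'(1) by linarith
    then show "q \<in> nbhd (insert k K)" using qL L(2) by (auto simp: nbhd_def k)
  qed
  ultimately show ?case by blast
qed

lemma openin_weak_sets:
  assumes "openin weak W"
  shows "W \<in> sets (prob_algebra M)"
proof -
  have "W = (\<Union>L\<in>{L. cnbhd L \<subseteq> W}. cnbhd L)"
  proof (intro equalityI subsetI)
    fix p assume p: "p \<in> W"
    obtain K where "finite K" "\<forall>(U, r)\<in>K. openin mtopology U" "p \<in> nbhd K" "nbhd K \<subseteq> W"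
      using weak_open_contains_nbhd[OF assms p] by blast
    then show "p \<in> (\<Union>L\<in>{L. cnbhd L \<subseteq> W}. cnbhd L)"
      using nbhd_contains_cnbhd[of K p] by blast
  qed auto
  moreover have "(\<Union>L\<in>{L. cnbhd L \<subseteq> W}. cnbhd L) \<in> sets (prob_algebra M)"
    using cnbhd_sets by (intro sets.countable_UN') auto
  ultimately show ?thesis by simp
qed

lemma borel_sets_weak_subset: "borel_sets weak \<subseteq> sets (prob_algebra M)"
  unfolding borel_sets_def topspace_weak
  using openin_weak_sets by (intro sets.sigma_sets_subset) auto

lemma closedin_weak_sets: "closedin weak R \<Longrightarrow> R \<in> sets (prob_algebra M)"
proof -
  assume R: "closedin weak R"
  then have "\<Delta> - R \<in> sets (prob_algebra M)"
    using openin_weak_sets[of "\<Delta> - R"] by (simp add: closedin_def topspace_weak)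
  then have "\<Delta> - (\<Delta> - R) \<in> sets (prob_algebra M)" by (rule sets.compl_sets)
  moreover have "R \<subseteq> \<Delta>" using R by (simp add: closedin_def topspace_weak)
  ultimately show ?thesis by (simp add: double_diff)
qed

end

subsection \<open>Perfect families\<close>

lemma tendsto_fun_component:
  fixes f :: "'b \<Rightarrow> 'c \<Rightarrow> real"
  assumes "(f \<longlongrightarrow> l) F"
  shows "((\<lambda>x. f x i) \<longlongrightarrow> l i) F"
  using continuous_on_tendsto_compose[where f = "\<lambda>x. x i" and s = UNIV,
      OF continuous_on_product_coordinates assms] by simp

lemma measure_tree_prefix_set:
  assumes "consistent v"
  shows "measure (tree_measure v) {c. map c [0..<n] \<in> A} = (\<Sum>s\<in>{s \<in> A. length s = n}. v s)"
proof -
  interpret prob_space "tree_measure v" by (rule prob_space_tree_measure)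
  have "ennreal (measure (tree_measure v) {c. map c [0..<n] \<in> A}) = (\<Sum>s\<in>{s \<in> A. length s = n}. ennreal (v s))"
    using emeasure_prefix_set[OF sets_tree_measure, of v n A]
    by (simp add: emeasure_eq_measure[symmetric] emeasure_tree_measure_bcyl[OF assms])
  also have "\<dots> = ennreal (\<Sum>s\<in>{s \<in> A. length s = n}. v s)"
    using consistentD(2)[OF assms] by (intro sum_ennreal) auto
  finally show ?thesis
    using consistentD(2)[OF assms] by (subst (asm) ennreal_inj) (auto intro: sum_nonneg)
qed

context coded_polish
begin

section \<open>Tightness read off from the weights\<close>

definition cover :: "nat \<Rightarrow> nat \<Rightarrow> bool list set" where
  "cover k n = {s. length s = n \<and> (\<exists>i. prod_encode (k, i) < n \<and> s ! prod_encode (k, i))}"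

text \<open>No mass of \<open>v\<close> escapes through infinitely many balls of radius \<open>\<rho> k\<close>, for any \<open>k\<close>.\<close>

definition balls_tight :: "(bool list \<Rightarrow> real) \<Rightarrow> bool" where
  "balls_tight v \<longleftrightarrow> (\<forall>k m. \<exists>n. 1 - 1 / real (Suc m) < (\<Sum>s\<in>cover k n. v s))"

text \<open>For each k and m the condition asks for some n with a strict inequality for a finite sum
  of coordinates, and this is open in the product topology.\<close>

lemma gdelta_tight: "gdelta_in euclidean {v. balls_tight v}"
proof -
  have "open {v. 1 - 1 / real (Suc m) < (\<Sum>s\<in>cover k n. v s)}" for k m n
    by (intro open_Collect_less continuous_on_const continuous_on_sum continuous_on_product_coordinates)
  then have "open (\<Union>n. {v. 1 - 1 / real (Suc m) < (\<Sum>s\<in>cover k n. v s)})" for k m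
    by blast
  then have "gdelta_in euclidean (\<Inter>(range (\<lambda>(k, m). \<Union>n. {v. 1 - 1 / real (Suc m) < (\<Sum>s\<in>cover k n. v s)})))"
    by (intro gdelta_in_Inter) (auto intro: open_imp_gdelta_in)
  moreover have "\<Inter>(range (\<lambda>(k, m). \<Union>n. {v. 1 - 1 / real (Suc m) < (\<Sum>s\<in>cover k n. v s)})) = {v. balls_tight v}"
    by (auto simp: balls_tight_def)
  ultimately show ?thesis by simp
qed

lemma sum_cover:
  assumes "consistent v"
  shows "(\<Sum>s\<in>cover k n. v s) = measure (tree_measure v) {c. \<exists>i. prod_encode (k, i) < n \<and> c (prod_encode (k, i))}"
proof -
  let ?A = "{s :: bool list. \<exists>i. prod_encode (k, i) < n \<and> s ! prod_encode (k, i)}"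
  have "{c. map c [0..<n] \<in> ?A} = {c. \<exists>i. prod_encode (k, i) < n \<and> c (prod_encode (k, i))}"
    by auto
  moreover have "{s \<in> ?A. length s = n} = cover k n" by (auto simp: cover_def)
  ultimately show ?thesis using measure_tree_prefix_set[OF assms, of n ?A] by simp
qed

text \<open>Identifies tightness with the first clause of \<open>good\<close> holding almost surely
  at each scale.\<close>

lemma tight_iff:
  assumes "consistent v"
  shows "balls_tight v \<longleftrightarrow> (\<forall>k. measure (tree_measure v) {c. \<exists>i. c (prod_encode (k, i))} = 1)"
proof -
  interpret prob_space "tree_measure v" by (rule prob_space_tree_measure)
  let ?C = "\<lambda>k n. {c :: nat \<Rightarrow> bool. \<exists>i. prod_encode (k, i) < n \<and> c (prod_encode (k, i))}"
  have C_sets: "?C k n \<in> events" for k n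
  proof -
    have "{c \<in> space bits. \<exists>i. prod_encode (k, i) < n \<and> c (prod_encode (k, i))} \<in> sets bits" by measurable
    then show ?thesis by (simp add: space_PiM)
  qed
  have lim: "(\<lambda>n. prob (?C k n)) \<longlonglongrightarrow> prob {c. \<exists>i. c (prod_encode (k, i))}" for k
  proof -
    have "(\<lambda>n. prob (?C k n)) \<longlonglongrightarrow> prob (\<Union>n. ?C k n)"
    proof (rule finite_Lim_measure_incseq)
      show "incseq (?C k)" unfolding incseq_def by (auto intro: less_le_trans)
    qed (use C_sets in auto)
    moreover have "(\<Union>n. ?C k n) = {c. \<exists>i. c (prod_encode (k, i))}" by auto
    ultimately show ?thesis by simp
  qed
  have mono: "prob (?C k n) \<le> prob {c. \<exists>i. c (prod_encode (k, i))}" for k n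
  proof -
    have "{c \<in> space bits. \<exists>i. c (prod_encode (k, i))} \<in> sets bits" by measurable
    then have "{c. \<exists>i. c (prod_encode (k, i))} \<in> events" by (simp add: space_PiM)
    then show ?thesis by (intro finite_measure_mono) auto
  qed
  show ?thesis
    unfolding balls_tight_def sum_cover[OF assms]
  proof (intro iffI allI)
    fix k assume t: "\<forall>k m. \<exists>n. 1 - 1 / real (Suc m) < prob (?C k n)"
    have "1 - e \<le> prob {c. \<exists>i. c (prod_encode (k, i))}" if e: "0 < e" for e
    proof -
      obtain m where "inverse (real (Suc m)) < e" using reals_Archimedean[OF e] by blast
      moreover obtain n where "1 - 1 / real (Suc m) < prob (?C k n)" using t by blast
      ultimately show ?thesis using mono[of k n] by (simp add: inverse_eq_divide)
    qed
    then have "1 \<le> prob {c. \<exists>i. c (prod_encode (k, i))} + e" if "0 < e" for e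
      using that by (simp add: diff_le_eq)
    then have "1 \<le> prob {c. \<exists>i. c (prod_encode (k, i))}" by (rule field_le_epsilon)
    then show "prob {c. \<exists>i. c (prod_encode (k, i))} = 1" using prob_le_1 by (simp add: antisym)
  next
    fix k m assume one: "\<forall>k. prob {c. \<exists>i. c (prod_encode (k, i))} = 1"
    have "1 - 1 / real (Suc m) < prob {c. \<exists>i. c (prod_encode (k, i))}" using one by simp
    from order_tendstoD(1)[OF lim this] show "\<exists>n. 1 - 1 / real (Suc m) < prob (?C k n)"
      using eventually_happens'[OF sequentially_bot] by blast
  qed
qed

lemma code_covered: "y \<in> S \<Longrightarrow> \<exists>i. code y (prod_encode (k, i))"
  using dense[OF _ rho_pos[of k], of y] by (auto simp: code_def bl_def cn_def rn_def)

lemma tight_weights: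
  assumes p: "p \<in> \<Delta>"
  shows "balls_tight (weights p)"
  unfolding tight_iff[OF consistent_weights[OF p]] tree_measure_weights[OF p]
proof
  fix k
  interpret prob_space p using p by (rule prob_space_prob_algebraD)
  have "{c \<in> space bits. \<exists>i. c (prod_encode (k, i))} \<in> sets bits" by measurable
  then have "measure (distr p bits code) {c. \<exists>i. c (prod_encode (k, i))} =
      prob (code -` {c. \<exists>i. c (prod_encode (k, i))} \<inter> space p)"
    using measurable_code'[OF p] by (intro measure_distr) (simp_all add: space_PiM)
  also have "code -` {c. \<exists>i. c (prod_encode (k, i))} \<inter> space p = space p"
    using code_covered space_prob_algebraD[OF p] space_M by auto
  finally show "measure (distr p bits code) {c. \<exists>i. c (prod_encode (k, i))} = 1"
    by (simp add: prob_space)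
qed

lemma consistent_limit:
  assumes "\<And>j. consistent (v j)" "\<And>s. (\<lambda>j. v j s) \<longlonglongrightarrow> w s"
  shows "consistent w"
  unfolding consistent_def
proof (intro conjI allI)
  have "(\<lambda>j. 1) \<longlonglongrightarrow> w []" using assms(2)[of "[]"] consistentD(1)[OF assms(1)] by simp
  then show "w [] = 1" using LIMSEQ_unique tendsto_const by blast
  fix s
  show "0 \<le> w s"
    by (rule LIMSEQ_le_const[OF assms(2)]) (use consistentD(2)[OF assms(1)] in blast)
  have "(\<lambda>j. v j (s @ [False]) + v j (s @ [True])) \<longlonglongrightarrow> w (s @ [False]) + w (s @ [True])"
    by (intro tendsto_add assms(2))
  moreover have "(\<lambda>j. v j (s @ [False]) + v j (s @ [True])) = (\<lambda>j. v j s)"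
    using consistentD(3)[OF assms(1)] by (intro ext) (rule sym, blast)
  ultimately show "w s = w (s @ [False]) + w (s @ [True])"
    using LIMSEQ_unique[OF assms(2)[of s]] by simp
qed

lemma measure_prefix_weights:
  assumes p: "p \<in> \<Delta>"
  shows "measure p {y \<in> S. map (code y) [0..<n] \<in> A} = (\<Sum>s\<in>{s \<in> A. length s = n}. weights p s)"
proof -
  have "measure (tree_measure (weights p)) {c. map c [0..<n] \<in> A} =
      measure p (code -` {c. map c [0..<n] \<in> A} \<inter> space p)"
    unfolding tree_measure_weights[OF p]
    by (rule measure_distr[OF measurable_code'[OF p] prefix_set_sets])
  also have "code -` {c. map c [0..<n] \<in> A} \<inter> space p = {y \<in> S. map (code y) [0..<n] \<in> A}"
    using space_prob_algebraD[OF p] space_M by auto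
  finally show ?thesis
    using measure_tree_prefix_set[OF consistent_weights[OF p]] by simp
qed

section \<open>Limits of measures whose weights converge\<close>

context
  fixes r :: "nat \<Rightarrow> 'a measure" and v :: "bool list \<Rightarrow> real"
  assumes r: "\<And>j. r j \<in> \<Delta>" and lim: "\<And>s. (\<lambda>j. weights (r j) s) \<longlonglongrightarrow> v s" and tight: "balls_tight v"
begin

lemma limit_consistent: "consistent v"
  by (rule consistent_limit[OF consistent_weights[OF r] lim])

lemma limit_prefix_tendsto:
  "(\<lambda>j. measure (r j) {y \<in> S. map (code y) [0..<n] \<in> A}) \<longlonglongrightarrow>
    measure (tree_measure v) {c. map c [0..<n] \<in> A}"
  unfolding measure_prefix_weights[OF r] measure_tree_prefix_set[OF limit_consistent]
  by (intro tendsto_sum lim)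

text \<open>The first clause of \<open>good\<close> is tightness. For the second, no code of a point
  selects two disjoint balls; this concerns a finite prefix, so its probability 0 passes to the
  limit.\<close>

lemma AE_limit_good: "AE c in tree_measure v. good c"
proof -
  interpret prob_space "tree_measure v" by (rule prob_space_tree_measure)
  have 1: "AE c in tree_measure v. \<exists>i. c (prod_encode (k, i))" for k
  proof -
    have "{c \<in> space bits. \<exists>i. c (prod_encode (k, i))} \<in> sets bits" by measurable
    then have "{c. \<exists>i. c (prod_encode (k, i))} \<in> events" by (simp add: space_PiM)
    moreover have "prob {c. \<exists>i. c (prod_encode (k, i))} = 1"
      using tight tight_iff[OF limit_consistent] by blast
    ultimately show ?thesis using prob_eq_1 by auto
  qed
  have 2: "AE c in tree_measure v. c m \<and> c n \<longrightarrow> bl m \<inter> bl n \<noteq> {}" for m n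
  proof (cases "bl m \<inter> bl n = {}")
    case True
    let ?N = "Suc (max m n)" and ?A = "{s :: bool list. s ! m \<and> s ! n}"
    have "{y \<in> S. map (code y) [0..<?N] \<in> ?A} = {}"
      using True by (auto simp: code_def simp del: upt_Suc)
    note limit_prefix_tendsto[of ?N ?A, unfolded this measure_empty]
    then have "measure (tree_measure v) {c. map c [0..<?N] \<in> ?A} = 0"
      by (rule LIMSEQ_unique[OF _ tendsto_const])
    then have "{c. map c [0..<?N] \<in> ?A} \<in> null_sets (tree_measure v)"
      using prefix_set_sets[of ?N ?A] by (auto simp: null_sets_def emeasure_eq_measure)
    from AE_not_in[OF this] show ?thesis
      by eventually_elim (auto simp del: upt_Suc)
  qed auto
  show ?thesis
    unfolding good_def AE_conj_iff AE_all_countable using 1 2 by blast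
qed

text \<open>Portmanteau for open sets. A good sequence is decoded into U when it selects a closed
  ball inside U; finitely many indices already give mass above a. The resulting prefix event has
  convergent probabilities, and points whose codes satisfy it lie in U.\<close>

lemma limit_open_eventually:
  assumes U: "openin mtopology U" and a: "a < measure (realize v) U"
  shows "\<forall>\<^sub>F j in sequentially. a < measure (r j) U"
proof -
  interpret prob_space "tree_measure v" by (rule prob_space_tree_measure)
  let ?C = "\<lambda>N. {c :: nat \<Rightarrow> bool. \<exists>n<N. c n \<and> cbl n \<subseteq> U}"
  have C_sets: "?C N \<in> events" for N
  proof -
    have "{c \<in> space bits. \<exists>n<N. c n \<and> cbl n \<subseteq> U} \<in> sets bits" by measurable
    then show ?thesis by (simp add: space_PiM)
  qed
  have dm: "decode \<in> tree_measure v \<rightarrow>\<^sub>M M"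
    using measurable_decode by (simp cong: measurable_cong_sets)
  have "measure (realize v) U = prob (decode -` U \<inter> space (tree_measure v))"
    unfolding realize_eq by (rule measure_distr[OF dm openin_sets[OF U]])
  also have "\<dots> = prob (\<Union>N. ?C N)"
  proof (rule finite_measure_eq_AE)
    show "AE c in tree_measure v. c \<in> decode -` U \<inter> space (tree_measure v) \<longleftrightarrow> c \<in> (\<Union>N. ?C N)"
      using AE_limit_good by eventually_elim (auto simp: decode_in_open_iff[OF _ U])
  qed (use C_sets measurable_sets[OF dm openin_sets[OF U]] in auto)
  finally have eq: "measure (realize v) U = prob (\<Union>N. ?C N)" .
  have "(\<lambda>N. prob (?C N)) \<longlonglongrightarrow> prob (\<Union>N. ?C N)"
  proof (rule finite_Lim_measure_incseq)
    show "incseq ?C" unfolding incseq_def by (auto intro: less_le_trans)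
  qed (use C_sets in auto)
  from order_tendstoD(1)[OF this a[unfolded eq]] obtain N where N: "a < prob (?C N)"
    using eventually_happens'[OF sequentially_bot] by blast
  let ?A = "{s :: bool list. \<exists>n<N. s ! n \<and> cbl n \<subseteq> U}"
  have "?C N = {c. map c [0..<N] \<in> ?A}" by auto
  then have "a < prob {c. map c [0..<N] \<in> ?A}" using N by simp
  from order_tendstoD(1)[OF limit_prefix_tendsto this]
  have "\<forall>\<^sub>F j in sequentially. a < measure (r j) {y \<in> S. map (code y) [0..<N] \<in> ?A}" .
  then show ?thesis
  proof eventually_elim
    case (elim j)
    interpret rj: prob_space "r j" using r by (rule prob_space_prob_algebraD)
    have "{y \<in> S. map (code y) [0..<N] \<in> ?A} \<subseteq> U"
    proof
      fix y assume "y \<in> {y \<in> S. map (code y) [0..<N] \<in> ?A}"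
      then obtain n where "y \<in> bl n" "cbl n \<subseteq> U" by (auto simp: code_def)
      then show "y \<in> U" using bl_subset_cbl by blast
    qed
    then have "measure (r j) {y \<in> S. map (code y) [0..<N] \<in> ?A} \<le> measure (r j) U"
      using openin_sets[OF U] sets_prob_algebraD[OF r] by (intro rj.finite_measure_mono) auto
    then show ?case using elim by linarith
  qed
qed

text \<open>Otherwise \<open>realize v\<close> has a basic neighbourhood outside \<open>R\<close>,
  whose finitely many lower bounds eventually hold along \<open>r j\<close>.\<close>

lemma limit_in_closed:
  assumes R: "closedin weak R" and rR: "\<And>j. r j \<in> R"
  shows "realize v \<in> R"
proof (rule ccontr)
  assume "realize v \<notin> R"
  then have W: "realize v \<in> \<Delta> - R" using realize_in by blast
  have "openin weak (\<Delta> - R)" using R by (simp add: closedin_def topspace_weak)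
  from weak_open_contains_nbhd[OF this W] obtain K where K: "finite K" "\<forall>(U, a)\<in>K. openin mtopology U"
      "realize v \<in> nbhd K" "nbhd K \<subseteq> \<Delta> - R"
    by (elim exE conjE)
  have "\<forall>\<^sub>F j in sequentially. \<forall>k\<in>K. snd k < measure (r j) (fst k)"
  proof (rule eventually_ball_finite[OF K(1)], rule ballI)
    fix k assume "k \<in> K"
    then show "\<forall>\<^sub>F j in sequentially. snd k < measure (r j) (fst k)"
      using K(2,3) by (intro limit_open_eventually) (auto simp: nbhd_def)
  qed
  then obtain j where "\<forall>k\<in>K. snd k < measure (r j) (fst k)"
    using eventually_happens'[OF sequentially_bot] by blast
  then have "r j \<in> nbhd K" using r by (auto simp: nbhd_def)
  then show False using K(4) rR by blast
qed

end

text \<open>Positive, within S, on the part of \<open>atom s\<close> that avoids the spheres;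
  \<open>out\<close> does the same for the complement. A product asks for all strict inequalities at
  once, a sum for one violation.\<close>

definition inn :: "bool list \<Rightarrow> 'a \<Rightarrow> real" where
  "inn s y = (\<Prod>j<length s. max 0 (if s ! j then rn j - d (cn j) y else d (cn j) y - rn j))"

definition out :: "bool list \<Rightarrow> 'a \<Rightarrow> real" where
  "out s y = (\<Sum>j<length s. max 0 (if s ! j then d (cn j) y - rn j else rn j - d (cn j) y))"

lemma continuous_inn: "continuous_map mtopology euclideanreal (inn s)"
proof -
  have "continuous_map mtopology euclideanreal
      (\<lambda>y. max 0 (if s ! j then rn j - d (cn j) y else d (cn j) y - rn j))" for j
    using continuous_dist[OF cn_in, of j]
    by (cases "s ! j") (auto intro!: continuous_map_real_max continuous_map_diff)
  then show ?thesis unfolding inn_def by (intro continuous_map_prod) auto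
qed

lemma continuous_out: "continuous_map mtopology euclideanreal (out s)"
proof -
  have "continuous_map mtopology euclideanreal
      (\<lambda>y. max 0 (if s ! j then d (cn j) y - rn j else rn j - d (cn j) y))" for j
    using continuous_dist[OF cn_in, of j]
    by (cases "s ! j") (auto intro!: continuous_map_real_max continuous_map_diff)
  then show ?thesis unfolding out_def by (intro continuous_map_sum) auto
qed

lemma inn_pos_iff: "0 < inn s y \<longleftrightarrow> (\<forall>j<length s. if s ! j then d (cn j) y < rn j else rn j < d (cn j) y)"
proof
  assume "0 < inn s y"
  then have nz: "inn s y \<noteq> 0" by simp
  show "\<forall>j<length s. if s ! j then d (cn j) y < rn j else rn j < d (cn j) y"
  proof (intro allI impI)
    fix j assume "j < length s"
    then have "max 0 (if s ! j then rn j - d (cn j) y else d (cn j) y - rn j) \<noteq> 0"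
      using nz unfolding inn_def by (simp add: prod_zero_iff)
    then show "if s ! j then d (cn j) y < rn j else rn j < d (cn j) y"
      by (cases "s ! j") (auto simp: max_def split: if_splits)
  qed
next
  assume a: "\<forall>j<length s. if s ! j then d (cn j) y < rn j else rn j < d (cn j) y"
  show "0 < inn s y"
    unfolding inn_def
  proof (rule prod_pos)
    fix j assume "j \<in> {..<length s}"
    then have "if s ! j then d (cn j) y < rn j else rn j < d (cn j) y" using a by simp
    then show "0 < max 0 (if s ! j then rn j - d (cn j) y else d (cn j) y - rn j)"
      by (cases "s ! j") auto
  qed
qed

lemma out_pos_iff: "0 < out s y \<longleftrightarrow> (\<exists>j<length s. if s ! j then rn j < d (cn j) y else d (cn j) y < rn j)"
proof
  assume "0 < out s y"
  then have "out s y \<noteq> 0" by simp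
  then obtain j where "j < length s" "max 0 (if s ! j then d (cn j) y - rn j else rn j - d (cn j) y) \<noteq> 0"
    unfolding out_def by (meson lessThan_iff sum.neutral)
  then show "\<exists>j<length s. if s ! j then rn j < d (cn j) y else d (cn j) y < rn j"
    by (intro exI[of _ j]) (auto simp: max_def split: if_splits)
next
  assume "\<exists>j<length s. if s ! j then rn j < d (cn j) y else d (cn j) y < rn j"
  then obtain j where j: "j < length s" "if s ! j then rn j < d (cn j) y else d (cn j) y < rn j" by blast
  show "0 < out s y"
    unfolding out_def using j by (intro sum_pos2[of _ j]) (auto split: if_splits)
qed

lemma atom_iff: "y \<in> atom s \<longleftrightarrow> y \<in> S \<and> (\<forall>j<length s. s ! j \<longleftrightarrow> d (cn j) y < rn j)"
proof -
  have "map (code y) [0..<length s] = s \<longleftrightarrow> (\<forall>j<length s. code y j = s ! j)"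
    by (subst list_eq_iff_nth_eq) simp
  moreover have "y \<in> S \<Longrightarrow> code y j \<longleftrightarrow> d (cn j) y < rn j" for j
    by (simp add: code_def bl_def)
  ultimately show ?thesis unfolding atom_def by auto
qed

definition sphere_at :: "nat \<Rightarrow> 'a set" where
  "sphere_at n = {y \<in> S. d (cn n) y = rn n}"

lemma sphere_sets: "sphere_at n \<in> sets M"
proof -
  have [measurable]: "d (cn n) \<in> borel_measurable M"
    by (rule measurable_continuous[OF continuous_dist[OF cn_in]])
  have "{y \<in> space M. d (cn n) y = rn n} \<in> sets M" by measurable
  then show ?thesis by (simp add: sphere_at_def space_M)
qed

text \<open>Off the null spheres the atom and its complement both agree with open sets, so lower
  bounds on masses of open sets control \<open>weights p s\<close> from both sides.\<close>

lemma null_spheres_weights: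
  assumes p: "p \<in> \<Delta>" and null: "\<And>n. measure p (sphere_at n) = 0"
  shows "measure p {y \<in> S. 0 < inn s y} = weights p s"
    and "measure p {y \<in> S. 0 < out s y} = 1 - weights p s"
proof -
  interpret prob_space p using p by (rule prob_space_prob_algebraD)
  note sp = sets_prob_algebraD[OF p] and spc = space_prob_algebraD[OF p]
  have sph: "(\<Union>n. sphere_at n) \<in> null_sets p"
    using null sphere_sets sp by (intro null_sets_UN) (auto simp: null_sets_def emeasure_eq_measure)
  have ae: "AE y in p. y \<in> S \<and> y \<notin> (\<Union>n. sphere_at n)"
    using AE_not_in[OF sph] AE_space spc space_M by (auto elim: eventually_elim2)
  show "measure p {y \<in> S. 0 < inn s y} = weights p s"
    unfolding weights_def
  proof (rule finite_measure_eq_AE)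
    show "AE y in p. y \<in> {y \<in> S. 0 < inn s y} \<longleftrightarrow> y \<in> atom s"
      using ae
    proof eventually_elim
      case (elim y)
      then have "d (cn j) y \<noteq> rn j" for j by (auto simp: sphere_at_def)
      then have "(if s ! j then d (cn j) y < rn j else rn j < d (cn j) y) \<longleftrightarrow> (s ! j \<longleftrightarrow> d (cn j) y < rn j)" for j
        using less_linear[of "d (cn j) y" "rn j"] by (cases "s ! j") auto
      then show ?case using elim by (simp add: inn_pos_iff atom_iff)
    qed
  qed (use cozero_sets[OF continuous_inn] atom_sets sp in auto)
  have "measure p {y \<in> S. 0 < out s y} = measure p (space p - atom s)"
  proof (rule finite_measure_eq_AE)
    show "AE y in p. y \<in> {y \<in> S. 0 < out s y} \<longleftrightarrow> y \<in> space p - atom s"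
      using ae
    proof eventually_elim
      case (elim y)
      then have "d (cn j) y \<noteq> rn j" for j by (auto simp: sphere_at_def)
      then have "(if s ! j then rn j < d (cn j) y else d (cn j) y < rn j) \<longleftrightarrow> \<not> (s ! j \<longleftrightarrow> d (cn j) y < rn j)" for j
        using less_linear[of "d (cn j) y" "rn j"] by (cases "s ! j") auto
      then show ?case using elim spc space_M by (simp add: out_pos_iff atom_iff)
    qed
  qed (use cozero_sets[OF continuous_out] atom_sets sp in auto)
  then show "measure p {y \<in> S. 0 < out s y} = 1 - weights p s"
    using prob_compl[of "atom s"] atom_sets sp by (simp add: weights_def)
qed

lemma weights_inj:
  assumes "p \<in> \<Delta>" "q \<in> \<Delta>" "weights p = weights q" shows "p = q"
  using assms realize_weights by metis

text \<open>The weights embed \<open>R\<close> in a product of real lines. The image consists of the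
  tight points of its own closure, hence is a G_delta. It has no isolated points because null
  spheres make the coordinates weakly continuous on \<open>R\<close>. A nonempty completely
  metrizable space without isolated points has at least the cardinality of the continuum.\<close>

theorem perfect_null_spheres_uncountable:
  assumes R: "perfect_in weak R" "R \<noteq> {}"
    and null: "\<And>q n. q \<in> R \<Longrightarrow> measure q (sphere_at n) = 0"
  shows "uncountable R"
proof -
  have cR: "closedin weak R" and iso: "\<And>q. q \<in> R \<Longrightarrow> weak closure_of (R - {q}) = R"
    using R(1) by (auto simp: perfect_in_def)
  have R\<Delta>: "R \<subseteq> \<Delta>" using closedin_subset[OF cR] by (simp add: topspace_weak)
  let ?E = "weights ` R"
  have "?E = closure ?E \<inter> {v. balls_tight v}"
  proof (intro equalityI subsetI)
    fix v assume "v \<in> ?E"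
    then show "v \<in> closure ?E \<inter> {v. balls_tight v}"
      using closure_subset[of ?E] tight_weights R\<Delta> by auto
  next
    fix v assume "v \<in> closure ?E \<inter> {v. balls_tight v}"
    then have "v \<in> closure ?E" and tight: "balls_tight v" by auto
    then obtain x where x: "\<And>n. x n \<in> ?E" "x \<longlonglongrightarrow> v"
      unfolding closure_sequential by blast
    have "\<forall>n. \<exists>q. q \<in> R \<and> x n = weights q" using x(1) by blast
    then obtain r where r: "\<And>n. r n \<in> R" "\<And>n. x n = weights (r n)" by metis
    have r\<Delta>: "r n \<in> \<Delta>" for n using r(1) R\<Delta> by blast
    have lim: "(\<lambda>j. weights (r j) s) \<longlonglongrightarrow> v s" for s
      using tendsto_fun_component[OF x(2), of s] r(2) by simp
    let ?p = "realize v"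
    have pR: "?p \<in> R" by (rule limit_in_closed[OF r\<Delta> lim tight cR r(1)])
    then have p\<Delta>: "?p \<in> \<Delta>" using R\<Delta> by blast
    \<comment> \<open>The limit measure gives an open set no more than the limit of its
      masses.\<close>
    have ge: "b \<le> l" if "openin mtopology U" "\<And>j. measure (r j) U = f j" "f \<longlonglongrightarrow> l" "measure ?p U = b"
      for U f b and l :: real
    proof (rule dense_le)
      show "c \<le> l" if c: "c < b" for c
      proof -
        have "\<forall>\<^sub>F j in sequentially. c \<le> f j"
          using limit_open_eventually[OF r\<Delta> lim tight \<open>openin mtopology U\<close>, of c] c
            \<open>measure ?p U = b\<close> \<open>\<And>j. measure (r j) U = f j\<close>
          by (auto elim: eventually_mono)
        then show ?thesis
          using \<open>f \<longlonglongrightarrow> l\<close> by (intro tendsto_lowerbound[OF _ _ sequentially_bot])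
      qed
    qed
    \<comment> \<open>Used for the atom and for its complement, the one-sided bound becomes an
      equality; the limit measure lies in \<open>R\<close>, so its spheres are null as well.\<close>
    have "weights ?p s \<le> v s" for s
    proof (rule ge)
      show "openin mtopology {y \<in> S. 0 < inn s y}"
        using openin_continuous_map_preimage[OF continuous_inn, of "{0<..}" s] by simp
    qed (use null_spheres_weights(1)[OF r\<Delta> null[OF r(1)]] null_spheres_weights(1)[OF p\<Delta> null[OF pR]] lim in auto)
    moreover have "1 - weights ?p s \<le> 1 - v s" for s
    proof (rule ge)
      show "openin mtopology {y \<in> S. 0 < out s y}"
        using openin_continuous_map_preimage[OF continuous_out, of "{0<..}" s] by simp
      show "(\<lambda>j. 1 - weights (r j) s) \<longlonglongrightarrow> 1 - v s" by (intro tendsto_intros lim)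
    qed (use null_spheres_weights(2)[OF r\<Delta> null[OF r(1)]] null_spheres_weights(2)[OF p\<Delta> null[OF pR]] in auto)
    ultimately have "v = weights ?p" by (intro ext) (simp add: antisym)
    then show "v \<in> ?E" using pR by blast
  qed
  moreover have "gdelta_in euclidean (closure ?E \<inter> {v. balls_tight v})"
    by (intro gdelta_in_Int gdelta_tight closed_imp_gdelta_in metrizable_space_euclidean) simp
  ultimately have "gdelta_in euclidean ?E" by simp
  then have cE: "completely_metrizable_space (subtopology euclidean ?E)"
    by (rule completely_metrizable_space_gdelta_in[OF completely_metrizable_space_euclidean])
  have "w \<in> euclidean derived_set_of ?E" if w: "w \<in> ?E" for w
    unfolding in_derived_set_of
  proof (intro conjI allI impI)
    show "w \<in> topspace euclidean" by simp
    fix T assume T: "w \<in> T \<and> openin euclidean T"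
    obtain q where q: "q \<in> R" "w = weights q" using w by blast
    have "openin (product_topology (\<lambda>_. euclidean) UNIV) T"
      using T by (simp add: open_fun_def)
    then obtain V where V: "finite {i. V i \<noteq> UNIV}" "\<And>i. open (V i)" "w \<in> (\<Pi>\<^sub>E i\<in>UNIV. V i)" "(\<Pi>\<^sub>E i\<in>UNIV. V i) \<subseteq> T"
      using T unfolding openin_product_topology_alt by auto
    have "\<exists>W. openin weak W \<and> q \<in> W \<and> (\<forall>q'\<in>W \<inter> R. weights q' s \<in> V s)" for s
    proof -
      have "weights q s \<in> V s" using V(3) q(2) by auto
      then obtain e where e: "0 < e" "ball (weights q s) e \<subseteq> V s"
        using V(2) open_contains_ball by blast
      \<comment> \<open>Two lower bounds on open sets, which on \<open>R\<close> confine the weight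
        of s to the ball of radius e.\<close>
      let ?W = "{p \<in> \<Delta>. weights q s - e < measure p {y \<in> S. 0 < inn s y}} \<inter>
        {p \<in> \<Delta>. 1 - weights q s - e < measure p {y \<in> S. 0 < out s y}}"
      have "openin weak ?W"
        by (intro openin_Int openin_weak_cozero continuous_inn continuous_out)
      moreover have nq: "measure q' {y \<in> S. 0 < inn s y} = weights q' s"
          "measure q' {y \<in> S. 0 < out s y} = 1 - weights q' s" if "q' \<in> R" for q'
        using null_spheres_weights[OF _ null[OF that]] that R\<Delta> by blast+
      moreover have "q \<in> ?W" using q(1) R\<Delta> nq[OF q(1)] e(1) by auto
      moreover have "weights q' s \<in> V s" if "q' \<in> ?W \<inter> R" for q'
      proof -
        have "weights q' s \<in> ball (weights q s) e"
          using that nq[of q'] by (auto simp: dist_real_def)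
        then show ?thesis using e(2) by blast
      qed
      ultimately show ?thesis by blast
    qed
    then obtain W where W: "\<And>s. openin weak (W s)" "\<And>s. q \<in> W s"
        "\<And>s q'. q' \<in> W s \<Longrightarrow> q' \<in> R \<Longrightarrow> weights q' s \<in> V s"
      by (metis IntI)
    let ?I = "{i. V i \<noteq> UNIV}"
    \<comment> \<open>Intersecting with \<Delta> covers the case that V restricts no
      coordinate.\<close>
    have oW: "openin weak (\<Delta> \<inter> (\<Inter>s\<in>?I. W s))"
    proof (cases "?I = {}")
      case True
      then show ?thesis using openin_topspace[of weak] by (simp add: topspace_weak)
    next
      case False
      have "openin weak \<Delta>" using openin_topspace[of weak] by (simp add: topspace_weak)
      moreover have "openin weak (\<Inter>s\<in>?I. W s)"
        using V(1) W(1) False by (intro openin_Inter) auto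
      ultimately show ?thesis by (rule openin_Int)
    qed
    have "q \<in> weak closure_of (R - {q})" using iso[OF q(1)] q(1) by simp
    moreover have "q \<in> \<Delta> \<inter> (\<Inter>s\<in>?I. W s)" using W(2) q(1) R\<Delta> by auto
    ultimately have "\<exists>q'. q' \<in> R - {q} \<and> q' \<in> \<Delta> \<inter> (\<Inter>s\<in>?I. W s)"
      using oW unfolding in_closure_of by (elim conjE allE) (rule mp, assumption, rule conjI)
    then obtain q' where q': "q' \<in> R" "q' \<noteq> q" "q' \<in> \<Delta> \<inter> (\<Inter>s\<in>?I. W s)"
      by (elim exE conjE DiffE) simp
    have "weights q' s \<in> V s" for s
      using W(3)[OF _ q'(1)] q'(3) by (cases "V s = UNIV") auto
    then have "weights q' \<in> T" using V(4) by auto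
    moreover have "weights q' \<noteq> w" using weights_inj[of q' q] q q' R\<Delta> by blast
    ultimately show "\<exists>y. y \<noteq> w \<and> y \<in> ?E \<and> y \<in> T" using q'(1) by blast
  qed
  then have "subtopology euclidean ?E derived_set_of ?E = ?E"
    unfolding derived_set_of_subtopology by auto
  then have "(UNIV :: real set) \<lesssim> ?E"
    using Urysohn.lepoll_perfect_set[of "subtopology euclidean ?E" ?E] cE R(2) by simp
  then have "uncountable ?E"
    using uncountable_UNIV_real countable_lepoll by blast
  then show ?thesis by (meson countable_image)
qed

end

subsection \<open>Dedekind completeness fails\<close>

text \<open>The mixture of the \<open>g c\<close> vanishes on null sets of \<open>P\<close>, so
  countably many supports, indexed by \<open>C\<close>, carry it and therefore almost every
  \<open>g c\<close>. By injectivity \<open>g c\<close> is outside \<open>C\<close> for all but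
  countably many c, and then it charges none of these supports.\<close>

lemma (in supported_alt) no_injective_bits_family:
  assumes CH: "continuum_hypothesis" and ne: "P \<noteq> {}"
    and dc: "dedekind_complete (Linf (univ_completion M) (univ_extension M ` P))"
    and card: "Q \<lesssim> (UNIV :: nat set set)"
    and g: "g \<in> bits \<rightarrow>\<^sub>M prob_algebra M" "range g \<subseteq> Q" "inj g"
  shows False
proof -
  interpret coin: prob_space coin by (rule prob_space_coin)
  have coin: "coin \<in> space (prob_algebra bits)"
    by (simp add: space_prob_algebra prob_space_coin)
  let ?\<mu> = "coin \<bind> g"
  have gQ: "g c \<in> Q" for c using g(2) by blast
  have em: "emeasure ?\<mu> N = (\<integral>\<^sup>+c. emeasure (g c) N \<partial>coin)" if "N \<in> sets M" for N
    by (rule emeasure_bind_prob_algebra[OF coin g(1) that])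
  have meas: "(\<lambda>c. emeasure (g c) N) \<in> borel_measurable coin" if N: "N \<in> sets M" for N
  proof -
    have "(\<lambda>c. emeasure (g c) N) \<in> borel_measurable bits"
      by (rule measurable_compose[OF measurable_prob_algebraD[OF g(1)]
            measurable_emeasure_subprob_algebra[OF N]])
    then show ?thesis by (simp cong: measurable_cong_sets)
  qed
  have "(\<lambda>_ :: unit. ?\<mu>) \<in> count_space UNIV \<rightarrow>\<^sub>M prob_algebra M"
    by (rule measurable_bind_prob_space[OF _ g(1)]) (simp add: coin)
  from measurable_space[OF this, of "()"] have \<mu>: "?\<mu> \<in> space (prob_algebra M)" by simp
  have ac: "emeasure ?\<mu> N = 0" if N: "N \<in> sets M" "upper_prob P N = 0" for N
    using em[OF N(1)] null_iff[OF N(1)] N(2) gQ by simp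
  obtain C where C: "countable C" "C \<subseteq> Q" "emeasure ?\<mu> (space M - (\<Union>q\<in>C. supp q)) = 0"
    using countably_many_supports_carry[OF CH ne dc card \<mu> ac] .
  let ?D = "space M - (\<Union>q\<in>C. supp q)"
  have DM: "?D \<in> sets M"
    using C supp_sets by (intro sets.Diff sets.countable_UN') auto
  have "AE c in coin. emeasure (g c) ?D = 0"
    using C(3) em[OF DM] meas[OF DM] by (simp add: nn_integral_0_iff_AE)
  moreover have "AE c in coin. g c \<notin> C"
  proof -
    have "countable (g -` C)"
    proof (rule countable_image_inj_on)
      show "countable (g ` (g -` C))" by (rule countable_subset[OF _ C(1)]) auto
      show "inj_on g (g -` C)" using g(3) by (rule inj_on_subset) simp
    qed
    then have "g -` C \<in> null_sets coin" by (rule coin_countable_null)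
    from AE_not_in[OF this] show ?thesis by simp
  qed
  ultimately have "AE c in coin. False"
  proof eventually_elim
    case (elim c)
    let ?q = "g c"
    have qM: "?q \<in> space (prob_algebra M)" using gQ Q_prob by blast
    interpret q: prob_space ?q using qM by (rule prob_space_prob_algebraD)
    note sq = sets_prob_algebraD[OF qM]
    have "supp q' \<in> null_sets ?q" if q': "q' \<in> C" for q'
    proof -
      have *: "q' \<in> Q" "?q \<noteq> q'" using q' C(2) elim by auto
      have "supp ?q \<inter> supp q' \<in> null_sets ?q"
        using supp_disjoint[OF gQ *] null_iff[of "supp ?q \<inter> supp q'"] supp_sets[OF gQ] supp_sets[OF *(1)] gQ sq
        by (auto simp: null_sets_def)
      moreover have "space M - supp ?q \<in> null_sets ?q"
        using supp_compl[OF gQ] supp_sets[OF gQ] sq by (auto simp: null_sets_def)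
      ultimately have U: "(supp ?q \<inter> supp q') \<union> (space M - supp ?q) \<in> null_sets ?q"
        by (rule null_sets.Un)
      show ?thesis
        by (rule null_sets_subset[OF U])
          (use supp_sets[OF *(1)] sq sets.sets_into_space[OF supp_sets[OF *(1)]] in auto)
    qed
    then have "(\<Union>q'\<in>C. supp q') \<in> null_sets ?q"
      using C(1) by (intro null_sets_UN')
    moreover have "?D \<in> null_sets ?q" using elim DM sq by (auto simp: null_sets_def)
    ultimately have "(\<Union>q'\<in>C. supp q') \<union> ?D \<in> null_sets ?q" by (rule null_sets.Un)
    then have "space ?q \<in> null_sets ?q"
      by (rule null_sets_subset) (use space_prob_algebraD[OF qM] sq in auto)
    then show False using q.emeasure_space_1 by auto
  qed
  then show False by simp
qed

text \<open>For one measure and one centre only countably many radii give a sphere of positive mass.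
  With countably many measures and centres the bad radii are countable, and every interval (0,
  1/(k+1)) contains another.\<close>

lemma coded_polish_exists:
  fixes d :: "'a \<Rightarrow> 'a \<Rightarrow> real"
  assumes "Metric_space S d" and complete: "Metric_space.mcomplete S d"
    and sep: "separable_space (Metric_space.mtopology S d)" and ne: "S \<noteq> {}"
    and M: "space M = S" "sets M = borel_sets (Metric_space.mtopology S d)"
    and R: "countable R" "R \<subseteq> space (prob_algebra M)"
  obtains ctr \<rho> where "coded_polish S d M ctr \<rho>"
    and "\<And>q n. q \<in> R \<Longrightarrow> measure q (coded_polish.sphere_at S d ctr \<rho> n) = 0"
proof -
  interpret Metric_space S d by fact
  obtain C where C: "countable C" "C \<subseteq> S" "mtopology closure_of C = S"
    using sep unfolding separable_space_def by auto
  have "C \<noteq> {}" using C(3) ne by auto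
  define ctr where "ctr = from_nat_into C"
  have ctr: "ctr i \<in> S" for i using from_nat_into[OF \<open>C \<noteq> {}\<close>] C(2) by (auto simp: ctr_def)
  have dense: "\<exists>i. d (ctr i) y < e" if y: "y \<in> S" and e: "0 < e" for y e
  proof -
    have "y \<in> mtopology closure_of C" using y C(3) by simp
    then obtain z where "z \<in> C" "z \<in> mball y e"
      using y e unfolding in_closure_of by (metis centre_in_mball_iff openin_mball)
    moreover from this obtain i where "ctr i = z"
      using from_nat_into_surj[OF C(1)] by (auto simp: ctr_def)
    ultimately show ?thesis using commute[of y z] by auto
  qed
  have coded: "coded_polish S d M ctr \<rho>" if "\<And>k. 0 < \<rho> k" "\<And>k. \<rho> k < 1 / real (Suc k)" for \<rho>
    using complete ctr dense that M by unfold_locales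
  \<comment> \<open>Provisional radii, to have the measurability of distances at hand before the
    final radii are chosen.\<close>
  interpret c0: coded_polish S d M ctr "\<lambda>k. 1 / real (Suc (Suc k))"
    by (rule coded) (auto simp: field_simps)
  have sph: "{y \<in> S. d (ctr i) y = t} \<in> sets M" for i t
  proof -
    have [measurable]: "d (ctr i) \<in> borel_measurable M"
      by (rule c0.measurable_continuous[OF c0.continuous_dist[OF ctr]])
    have "{y \<in> space M. d (ctr i) y = t} \<in> sets M" by measurable
    then show ?thesis by (simp add: M)
  qed
  let ?bad = "\<Union>q\<in>R. \<Union>i. {t \<in> UNIV. emeasure q {y \<in> S. d (ctr i) y = t} \<noteq> 0}"
  have "countable {t \<in> UNIV. emeasure q {y \<in> S. d (ctr i) y = t} \<noteq> 0}" if q: "q \<in> R" for q i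
  proof (rule finite_measure_disjoint_countable_support)
    have q\<Delta>: "q \<in> space (prob_algebra M)" using q R(2) by blast
    show "finite_measure q" using prob_space_prob_algebraD[OF q\<Delta>] prob_space.finite_measure by blast
    show "{y \<in> S. d (ctr i) y = t} \<in> sets q" for t using sph sets_prob_algebraD[OF q\<Delta>] by simp
    show "disjoint_family_on (\<lambda>t. {y \<in> S. d (ctr i) y = t}) UNIV" by (auto simp: disjoint_family_on_def)
  qed
  then have bad: "countable ?bad" using R(1) by (intro countable_UN) auto
  have "\<exists>t. 0 < t \<and> t < 1 / real (Suc k) \<and> t \<notin> ?bad" for k
  proof -
    have "uncountable {0 <..< 1 / real (Suc k)}" by (rule uncountable_open_interval[THEN iffD2]) simp
    then have "\<not> {0 <..< 1 / real (Suc k)} \<subseteq> ?bad" using bad countable_subset by blast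
    then show ?thesis by auto
  qed
  from choice[OF allI[OF this]]
  obtain \<rho> where "\<forall>k. 0 < \<rho> k \<and> \<rho> k < 1 / real (Suc k) \<and> \<rho> k \<notin> ?bad" by (rule exE)
  then have \<rho>: "\<And>k. 0 < \<rho> k" "\<And>k. \<rho> k < 1 / real (Suc k)" "\<And>k. \<rho> k \<notin> ?bad" by simp_all
  interpret c: coded_polish S d M ctr \<rho> by (rule coded[OF \<rho>(1,2)])
  have "measure q (c.sphere_at n) = 0" if q: "q \<in> R" for q n
  proof -
    have "emeasure q {y \<in> S. d (ctr (snd (prod_decode n))) y = \<rho> (fst (prod_decode n))} = 0"
      using \<rho>(3)[of "fst (prod_decode n)"] q by blast
    then show ?thesis by (simp add: c.sphere_at_def c.cn_def c.rn_def measure_def)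
  qed
  then show thesis using that c.coded_polish_axioms by blast
qed

text \<open>Two codings occur: one with arbitrary radii, which produces the map on bits, and, under
  the assumption that a perfect \<open>R\<close> is countable, one with radii adapted to
  \<open>R\<close>.\<close>

theorem polish_family_contains_bits:
  assumes X: "polish X" "space M = topspace X" "sets M = borel_sets X" "space M \<noteq> {}"
    and R: "R \<subseteq> space (prob_algebra M)"
      "(R \<noteq> {} \<and> perfect_in (weak_topology X M) R) \<or>
       (uncountable R \<and> analytic_in (weak_topology X M) R) \<or>
       (uncountable R \<and> R \<in> borel_sets (weak_topology X M))"
  obtains g where "g \<in> bits \<rightarrow>\<^sub>M prob_algebra M" "range g \<subseteq> R" "inj g"
    "space (prob_algebra M) \<lesssim> (UNIV :: nat set set)"
proof -
  obtain S d where "Metric_space S d" and complete: "Metric_space.mcomplete S d"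
    and Xd: "X = Metric_space.mtopology S d"
    using X(1) unfolding polish_def completely_metrizable_space_def by blast
  interpret Metric_space S d by fact
  have S: "space M = S" using X(2) Xd by simp
  note coding = coded_polish_exists[OF \<open>Metric_space S d\<close> complete X(1)[unfolded polish_def Xd, THEN conjunct2]
      X(4)[unfolded S] S X(3)[unfolded Xd]]
  obtain ctr \<rho> where "coded_polish S d M ctr \<rho>"
    using coding[of "{}"] by auto
  then interpret c: coded_polish S d M ctr \<rho> .
  have card: "space (prob_algebra M) \<lesssim> (UNIV :: nat set set)" by (rule c.prob_algebra_lepoll)
  have perfect: "uncountable R \<and> R \<in> sets (prob_algebra M)" if p: "R \<noteq> {}" "perfect_in (weak_topology X M) R"
  proof
    show "uncountable R"
    proof
      assume "countable R"
      obtain ctr' \<rho>' where "coded_polish S d M ctr' \<rho>'"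
        and null: "\<And>q n. q \<in> R \<Longrightarrow> measure q (coded_polish.sphere_at S d ctr' \<rho>' n) = 0"
        using coding[OF \<open>countable R\<close> R(1)] by blast
      interpret c': coded_polish S d M ctr' \<rho>' by fact
      have "uncountable R"
        by (rule c'.perfect_null_spheres_uncountable[OF p(2)[unfolded Xd] p(1) null])
      then show False using \<open>countable R\<close> by blast
    qed
    show "R \<in> sets (prob_algebra M)"
      using p(2) c.closedin_weak_sets unfolding perfect_in_def Xd by blast
  qed
  show thesis
  proof (cases "uncountable R \<and> analytic_in (weak_topology X M) R")
    case True
    then obtain g where "g \<in> bits \<rightarrow>\<^sub>M prob_algebra M" "range g \<subseteq> R" "inj g"
      using c.uncountable_analytic_contains_bits unfolding Xd by metis
    then show ?thesis using that card by blast
  next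
    case False
    \<comment> \<open>In the remaining alternatives \<open>R\<close> is measurable: weakly closed in
      the perfect case, weakly Borel in the other.\<close>
    then have "uncountable R" "R \<in> sets (prob_algebra M)"
      using R(2) perfect c.borel_sets_weak_subset unfolding Xd by blast+
    then obtain g where "g \<in> bits \<rightarrow>\<^sub>M prob_algebra M" "range g \<subseteq> R" "inj g"
      using c.uncountable_measurable_family_contains_bits by metis
    then show ?thesis using that card by blast
  qed
qed

theorem corollaryC5:
  fixes M :: "'a measure" and P :: "'a measure set"
  assumes "continuum_hypothesis"
    and "P \<subseteq> space (prob_algebra M)" and "P \<noteq> {}" and "class_S M P"
  shows
    "((\<exists>Q. disjoint_supported_alternative M P Q \<and> Q \<noteq> {} \<and> Q \<lesssim> (UNIV :: nat set set)) \<and>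
      ca_c M P - sca_c M P \<noteq> {}
      \<longrightarrow> \<not> dedekind_complete (Linf (univ_completion M) (univ_extension M ` P))) \<and>
     (\<forall>X :: 'a topology. \<forall>Q R.
      polish X \<and> space M = topspace X \<and> sets M = borel_sets X \<and>
      disjoint_supported_alternative M P Q \<and> R \<subseteq> Q \<and>
      ((R \<noteq> {} \<and> perfect_in (weak_topology X M) R) \<or>
       (uncountable R \<and> analytic_in (weak_topology X M) R) \<or>
       (uncountable R \<and> R \<in> borel_sets (weak_topology X M)))
      \<longrightarrow> \<not> dedekind_complete (Linf (univ_completion M) (univ_extension M ` P)))"
proof (intro conjI impI allI notI)
  assume dc: "dedekind_complete (Linf (univ_completion M) (univ_extension M ` P))"
    and "(\<exists>Q. disjoint_supported_alternative M P Q \<and> Q \<noteq> {} \<and> Q \<lesssim> (UNIV :: nat set set)) \<and>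
      ca_c M P - sca_c M P \<noteq> {}"
  then obtain Q where alt: "disjoint_supported_alternative M P Q" and card: "Q \<lesssim> (UNIV :: nat set set)"
    and ne: "ca_c M P - sca_c M P \<noteq> {}" by blast
  interpret supported_alt M P Q using assms(2) alt by unfold_locales
  show False using ca_c_eq_sca_c[OF assms(1,3) dc card] ne by simp
next
  fix X :: "'a topology" and Q R
  assume H: "polish X \<and> space M = topspace X \<and> sets M = borel_sets X \<and>
      disjoint_supported_alternative M P Q \<and> R \<subseteq> Q \<and>
      ((R \<noteq> {} \<and> perfect_in (weak_topology X M) R) \<or>
       (uncountable R \<and> analytic_in (weak_topology X M) R) \<or>
       (uncountable R \<and> R \<in> borel_sets (weak_topology X M)))"
    and dc: "dedekind_complete (Linf (univ_completion M) (univ_extension M ` P))"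
  have X: "polish X" "space M = topspace X" "sets M = borel_sets X" and RQ: "R \<subseteq> Q"
    and Q: "disjoint_supported_alternative M P Q" using H by simp_all
  interpret supported_alt M P Q using assms(2) Q by unfold_locales
  \<comment> \<open>A member of \<open>P\<close> shows that \<open>space M\<close> is nonempty, so
    that a dense sequence of centres exists.\<close>
  obtain p where "p \<in> space (prob_algebra M)" using assms(2,3) by blast
  then have "space M \<noteq> {}"
    using prob_space.not_empty[OF prob_space_prob_algebraD] space_prob_algebraD by metis
  moreover have "R \<subseteq> space (prob_algebra M)" using RQ Q_prob by blast
  ultimately obtain g where g: "g \<in> bits \<rightarrow>\<^sub>M prob_algebra M" "range g \<subseteq> R" "inj g"
    and card: "space (prob_algebra M) \<lesssim> (UNIV :: nat set set)"
    using H by (elim conjE) (rule polish_family_contains_bits[OF X])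
  have "Q \<lesssim> (UNIV :: nat set set)"
    using lepoll_trans[OF subset_imp_lepoll[OF Q_prob] card] .
  then show False
    using no_injective_bits_family[OF assms(1,3) dc _ g(1) _ g(3)] g(2) RQ by blast
qed

end
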